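(* Let $G$ be a finite bipartite graph with color classes $A$ and $B$, let $b:V(G)\to\mathbb{Z}_{\ge0}$, $n=|V(G)|$, $m=|E(G)|$. Given a maximum $b$-matching of $G$, the $b$-matching Dulmage–Mendelsohn decomposition of $G$ can be computed in $O(n+m)$ time.
   Context: A $b$-matching is $M\subseteq E(G)$ with at most $b(v)$ edges of $M$ at each vertex $v$; maximum = largest cardinality; $v$ is $M$-loose if fewer than $b(v)$ edges of $M$ are incident with it. An edge is allowed if in some maximum $b$-matching, forbidden otherwise; an allowed edge is inevitable if in every maximum $b$-matching, flexible otherwise. Flexible components: the induced subgraphs $G[V(K)]$ for $K$ a connected component of $(V(G),\{\text{flexible edges}\})$; $\mathcal{F}$ is their set. $\mathcal{D}$: vertices $M$-loose for some maximum $b$-matching $M$. $C\in\mathcal{F}$ is loose if it meets $\mathcal{D}$; $v$ is inactive if $b(v)=0$ (then $G[\{v\}]\in\mathcal{F}$ is inactive). For $W\in\{A,B\}$, $C$ is inconsistent hooked up by $W$ if $C$ is loose with $V(C)\cap\mathcal{D}\cap W\neq\emptyset$, or $C$ is inactive and its vertex has a neighbor in $\mathcal{D}\cap W$; $C$ is consistent if it is neither loose nor an inactive component whose vertex has a neighbor in $\mathcal{D}$. For $C_1,C_2\in\mathcal{F}$, $C_1\preceq^\circ_A C_2$ if $C_1=C_2$, or an inevitable edge joins $V(C_1)\cap A$ to $V(C_2)\cap B$, or a forbidden edge joins $V(C_2)\cap A$ to $V(C_1)\cap B$; $\le_A$ is the reflexive-transitive closure of $\preceq^\circ_A$ on $\mathcal{F}$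 (a partial order). The $b$-matching Dulmage–Mendelsohn decomposition consists of: the set $\mathcal{F}$ of flexible components (their vertex sets), the classification of each component as consistent, inconsistent hooked up by $A$, or inconsistent hooked up by $B$, and the partial order $\le_A$ on $\mathcal{F}$ (represented by a digraph on $\mathcal{F}$ whose reflexive-transitive closure is $\le_A$). *)

theory Defs
  imports Main
begin

section \<open>Bipartite graphs and b-matchings\<close>

text \<open>
  Edges are objects of their own, so parallel edges are permitted. Simple graphs are the
  instances in which no two edges have the same pair of ends. Bipartiteness is built into the
  two end maps: every edge has one end in colour class A and one in colour class B.
\<close>

record ('v, 'e) bgraph =
  colA :: "'v set"
  colB :: "'v set"
  edges :: "'e set"
  endA :: "'e \<Rightarrow> 'v"
  endB :: "'e \<Rightarrow> 'v"

definition verts :: "('v, 'e) bgraph \<Rightarrow> 'v set" where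
  "verts G = colA G \<union> colB G"

definition finite_bipartite :: "('v, 'e) bgraph \<Rightarrow> bool" where
  "finite_bipartite G \<longleftrightarrow>
     finite (colA G) \<and> finite (colB G) \<and> colA G \<inter> colB G = {} \<and>
     finite (edges G) \<and> endA G ` edges G \<subseteq> colA G \<and> endB G ` edges G \<subseteq> colB G"

definition ends :: "('v, 'e) bgraph \<Rightarrow> 'e \<Rightarrow> 'v set" where
  "ends G e = {endA G e, endB G e}"

definition adjacent :: "('v, 'e) bgraph \<Rightarrow> 'v \<Rightarrow> 'v \<Rightarrow> bool" where
  "adjacent G u v \<longleftrightarrow> (\<exists>e\<in>edges G. ends G e = {u, v})"

definition mdegree :: "('v, 'e) bgraph \<Rightarrow> 'e set \<Rightarrow> 'v \<Rightarrow> nat" where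
  "mdegree G M v = card {e \<in> M. v \<in> ends G e}"

definition b_matching :: "('v, 'e) bgraph \<Rightarrow> ('v \<Rightarrow> nat) \<Rightarrow> 'e set \<Rightarrow> bool" where
  "b_matching G b M \<longleftrightarrow> M \<subseteq> edges G \<and> (\<forall>v\<in>verts G. mdegree G M v \<le> b v)"

definition max_b_matching :: "('v, 'e) bgraph \<Rightarrow> ('v \<Rightarrow> nat) \<Rightarrow> 'e set \<Rightarrow> bool" where
  "max_b_matching G b M \<longleftrightarrow>
     b_matching G b M \<and> (\<forall>N. b_matching G b N \<longrightarrow> card N \<le> card M)"

definition allowed :: "('v, 'e) bgraph \<Rightarrow> ('v \<Rightarrow> nat) \<Rightarrow> 'e \<Rightarrow> bool" where
  "allowed G b e \<longleftrightarrow> e \<in> edges G \<and> (\<exists>M. max_b_matching G b M \<and> e \<in> M)"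

definition forbidden :: "('v, 'e) bgraph \<Rightarrow> ('v \<Rightarrow> nat) \<Rightarrow> 'e \<Rightarrow> bool" where
  "forbidden G b e \<longleftrightarrow> e \<in> edges G \<and> \<not> allowed G b e"

definition inevitable :: "('v, 'e) bgraph \<Rightarrow> ('v \<Rightarrow> nat) \<Rightarrow> 'e \<Rightarrow> bool" where
  "inevitable G b e \<longleftrightarrow> allowed G b e \<and> (\<forall>M. max_b_matching G b M \<longrightarrow> e \<in> M)"

definition flexible :: "('v, 'e) bgraph \<Rightarrow> ('v \<Rightarrow> nat) \<Rightarrow> 'e \<Rightarrow> bool" where
  "flexible G b e \<longleftrightarrow> allowed G b e \<and> \<not> inevitable G b e"

definition loose_vertices :: "('v, 'e) bgraph \<Rightarrow> ('v \<Rightarrow> nat) \<Rightarrow> 'v set" where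
  "loose_vertices G b = {v \<in> verts G. \<exists>M. max_b_matching G b M \<and> mdegree G M v < b v}"


section \<open>The Dulmage--Mendelsohn decomposition for b-matchings\<close>

definition flex_adj :: "('v, 'e) bgraph \<Rightarrow> ('v \<Rightarrow> nat) \<Rightarrow> ('v \<times> 'v) set" where
  "flex_adj G b = {(u, v). \<exists>e. flexible G b e \<and> ends G e = {u, v}}"

text \<open>A flexible component is an induced subgraph, so it is represented by its vertex set.\<close>

definition flex_comps :: "('v, 'e) bgraph \<Rightarrow> ('v \<Rightarrow> nat) \<Rightarrow> 'v set set" where
  "flex_comps G b = (\<lambda>v. (flex_adj G b)\<^sup>* `` {v}) ` verts G"

definition loose_comp :: "('v, 'e) bgraph \<Rightarrow> ('v \<Rightarrow> nat) \<Rightarrow> 'v set \<Rightarrow> bool" where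
  "loose_comp G b C \<longleftrightarrow> C \<inter> loose_vertices G b \<noteq> {}"

definition inactive_next_to ::
    "('v, 'e) bgraph \<Rightarrow> ('v \<Rightarrow> nat) \<Rightarrow> 'v set \<Rightarrow> 'v set \<Rightarrow> bool" where
  "inactive_next_to G b C S \<longleftrightarrow> (\<exists>v. C = {v} \<and> b v = 0 \<and> (\<exists>u\<in>S. adjacent G v u))"

definition hooked_up_by ::
    "('v, 'e) bgraph \<Rightarrow> ('v \<Rightarrow> nat) \<Rightarrow> 'v set \<Rightarrow> 'v set \<Rightarrow> bool" where
  "hooked_up_by G b W C \<longleftrightarrow>
     loose_comp G b C \<and> C \<inter> loose_vertices G b \<inter> W \<noteq> {} \<or>
     inactive_next_to G b C (loose_vertices G b \<inter> W)"

definition consistent :: "('v, 'e) bgraph \<Rightarrow> ('v \<Rightarrow> nat) \<Rightarrow> 'v set \<Rightarrow> bool" where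
  "consistent G b C \<longleftrightarrow>
     \<not> loose_comp G b C \<and> \<not> inactive_next_to G b C (loose_vertices G b)"

definition prec_A ::
    "('v, 'e) bgraph \<Rightarrow> ('v \<Rightarrow> nat) \<Rightarrow> ('v set \<times> 'v set) set" where
  "prec_A G b = {(C1, C2). C1 \<in> flex_comps G b \<and> C2 \<in> flex_comps G b \<and>
     (C1 = C2 \<or>
      (\<exists>e. inevitable G b e \<and> endA G e \<in> C1 \<and> endB G e \<in> C2) \<or>
      (\<exists>e. forbidden G b e \<and> endA G e \<in> C2 \<and> endB G e \<in> C1))}"

definition rtrancl_within :: "'a set \<Rightarrow> ('a \<times> 'a) set \<Rightarrow> ('a \<times> 'a) set" where
  "rtrancl_within S r = r\<^sup>* \<inter> S \<times> S"

definition le_A :: "('v, 'e) bgraph \<Rightarrow> ('v \<Rightarrow> nat) \<Rightarrow> ('v set \<times> 'v set) set" where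
  "le_A G b = rtrancl_within (flex_comps G b) (prec_A G b)"


section \<open>Machine model\<close>

text \<open>
  A random access machine with structured control flow. A program uses finitely many
  registers and finitely many arrays of natural numbers, referred to by name, with indirect
  addressing. The only arithmetic is successor and (truncated) predecessor, so in \<open>t\<close> steps
  no number can exceed the largest number in the input or the program by more than \<open>t\<close>. This is
  what justifies unit cost: there is no way to build up long numbers. Every node of
  an expression is charged for each time the expression is evaluated.
\<close>

datatype aexp =
    Const nat
  | Reg string
  | Cell string aexp
  | Succ aexp
  | Pred aexp

datatype bexp =
    Less aexp aexp
  | Equal aexp aexp
  | Not bexp
  | And bexp bexp

datatype com =
    Skip
  | SetReg string aexp
  | SetCell string aexp aexp
  | Seq com com
  | If bexp com com
  | While bexp com

record state =
  reg :: "string \<Rightarrow> nat"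
  cell :: "string \<Rightarrow> nat \<Rightarrow> nat"

primrec aval :: "aexp \<Rightarrow> state \<Rightarrow> nat" where
  "aval (Const k) s = k"
| "aval (Reg x) s = reg s x"
| "aval (Cell a i) s = cell s a (aval i s)"
| "aval (Succ e) s = aval e s + 1"
| "aval (Pred e) s = aval e s - 1"

primrec bval :: "bexp \<Rightarrow> state \<Rightarrow> bool" where
  "bval (Less e f) s \<longleftrightarrow> aval e s < aval f s"
| "bval (Equal e f) s \<longleftrightarrow> aval e s = aval f s"
| "bval (Not p) s \<longleftrightarrow> \<not> bval p s"
| "bval (And p q) s \<longleftrightarrow> bval p s \<and> bval q s"

primrec acost :: "aexp \<Rightarrow> nat" where
  "acost (Const k) = 1"
| "acost (Reg x) = 1"
| "acost (Cell a i) = acost i + 1"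
| "acost (Succ e) = acost e + 1"
| "acost (Pred e) = acost e + 1"

primrec bcost :: "bexp \<Rightarrow> nat" where
  "bcost (Less e f) = acost e + acost f + 1"
| "bcost (Equal e f) = acost e + acost f + 1"
| "bcost (Not p) = bcost p + 1"
| "bcost (And p q) = bcost p + bcost q + 1"

definition set_reg :: "string \<Rightarrow> nat \<Rightarrow> state \<Rightarrow> state" where
  "set_reg x k s = s\<lparr>reg := (reg s)(x := k)\<rparr>"

definition set_cell :: "string \<Rightarrow> nat \<Rightarrow> nat \<Rightarrow> state \<Rightarrow> state" where
  "set_cell a i k s = s\<lparr>cell := (cell s)(a := (cell s a)(i := k))\<rparr>"

text \<open>\<open>runs c s t s'\<close>: started in \<open>s\<close>, program \<open>c\<close> halts in \<open>s'\<close> after exactly \<open>t\<close> steps.\<close>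

inductive runs :: "com \<Rightarrow> state \<Rightarrow> nat \<Rightarrow> state \<Rightarrow> bool" where
  runs_Skip: "runs Skip s 1 s"
| runs_SetReg: "runs (SetReg x e) s (acost e + 1) (set_reg x (aval e s) s)"
| runs_SetCell:
    "runs (SetCell a i e) s (acost i + acost e + 1) (set_cell a (aval i s) (aval e s) s)"
| runs_Seq: "runs c1 s t1 s1 \<Longrightarrow> runs c2 s1 t2 s2 \<Longrightarrow> runs (Seq c1 c2) s (t1 + t2) s2"
| runs_IfTrue: "bval p s \<Longrightarrow> runs c1 s t s' \<Longrightarrow> runs (If p c1 c2) s (bcost p + t + 1) s'"
| runs_IfFalse: "\<not> bval p s \<Longrightarrow> runs c2 s t s' \<Longrightarrow> runs (If p c1 c2) s (bcost p + t + 1) s'"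
| runs_WhileFalse: "\<not> bval p s \<Longrightarrow> runs (While p c) s (bcost p + 1) s"
| runs_WhileTrue:
    "bval p s \<Longrightarrow> runs c s t1 s1 \<Longrightarrow> runs (While p c) s1 t2 s2 \<Longrightarrow>
     runs (While p c) s (bcost p + t1 + t2 + 1) s2"

lemma runs_deterministic:
  "runs c s t s' \<Longrightarrow> runs c s u s'' \<Longrightarrow> t = u \<and> s' = s''"
proof (induction arbitrary: u s'' rule: runs.induct)
  case (runs_Seq c1 s t1 s1 c2 t2 s2)
  from runs_Seq.prems show ?case
    by (cases rule: runs.cases) (auto dest!: runs_Seq.IH)
next
  case (runs_WhileTrue p s c t1 s1 t2 s2)
  from runs_WhileTrue.prems show ?case
    by (cases rule: runs.cases) (use runs_WhileTrue.hyps in \<open>auto dest!: runs_WhileTrue.IH\<close>)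
qed (erule runs.cases; fastforce)+


section \<open>Input and output\<close>

definition array_of :: "nat \<Rightarrow> (nat \<Rightarrow> nat) \<Rightarrow> nat \<Rightarrow> nat" where
  "array_of k f = (\<lambda>i. if i < k then f i else 0)"

text \<open>
  Vertices and edges are numbered from 0. The graph is given as an array of colours and a list
  of edges, the b-matching by its characteristic vector. All other memory is zero.
\<close>

definition input_state ::
    "(nat, nat) bgraph \<Rightarrow> (nat \<Rightarrow> nat) \<Rightarrow> nat set \<Rightarrow> state" where
  "input_state G b M =
    (let n = card (verts G); m = card (edges G) in
     \<lparr>reg = (\<lambda>_. 0)(''n'' := n, ''m'' := m),
      cell = (\<lambda>_ _. 0)(
        ''colour'' := array_of n (\<lambda>v. if v \<in> colA G then 0 else 1),
        ''b'' := array_of n b,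
        ''endA'' := array_of m (endA G),
        ''endB'' := array_of m (endB G),
        ''M'' := array_of m (\<lambda>e. if e \<in> M then 1 else 0))\<rparr>)"

definition block :: "(nat, nat) bgraph \<Rightarrow> state \<Rightarrow> nat \<Rightarrow> nat set" where
  "block G s i = {v \<in> verts G. cell s ''comp'' v = i}"

text \<open>
  The components are numbered from 0 to \<open>reg s ''comps'' - 1\<close>, and \<open>comp\<close> maps each vertex to the
  number of its component. \<open>class\<close> is 0 for consistent components, 1 for inconsistent components
  hooked up by A, and 2 for those hooked up by B. The arcs of the digraph that represents the
  order are listed in \<open>src\<close> and \<open>tgt\<close>.
\<close>

definition outputs_decomposition ::
    "(nat, nat) bgraph \<Rightarrow> (nat \<Rightarrow> nat) \<Rightarrow> state \<Rightarrow> bool" where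
  "outputs_decomposition G b s \<longleftrightarrow>
     bij_betw (block G s) {..<reg s ''comps''} (flex_comps G b) \<and>
     (\<forall>i < reg s ''comps''.
        (cell s ''class'' i = 0 \<longleftrightarrow> consistent G b (block G s i)) \<and>
        (cell s ''class'' i = 1 \<longleftrightarrow> hooked_up_by G b (colA G) (block G s i)) \<and>
        (cell s ''class'' i = 2 \<longleftrightarrow> hooked_up_by G b (colB G) (block G s i))) \<and>
     (\<forall>j < reg s ''arcs''.
        cell s ''src'' j < reg s ''comps'' \<and> cell s ''tgt'' j < reg s ''comps'') \<and>
     rtrancl_within (flex_comps G b)
       {(block G s (cell s ''src'' j), block G s (cell s ''tgt'' j)) | j. j < reg s ''arcs''}
     = le_A G b"

end

theory Submission
  imports Defs
begin

text \<open>
  Orient the edges of the given maximum \<open>b\<close>-matching \<open>M\<close> from \<open>B\<close> to \<open>A\<close> and the others from \<open>A\<close> to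
  \<open>B\<close>. Add a node \<open>s\<close> with arcs from every vertex of \<open>A\<close> and to the \<open>M\<close>-loose ones, and a node
  \<open>t\<close> with arcs to every vertex of \<open>B\<close> and from the \<open>M\<close>-loose ones. Maximum \<open>b\<close>-matchings differ
  from \<open>M\<close> by circulations in this digraph. Hence an edge is flexible iff its ends are strongly
  connected, and a vertex of \<open>A\<close> (of \<open>B\<close>) is loose for some maximum \<open>b\<close>-matching iff it is strongly
  connected to \<open>s\<close> (to \<open>t\<close>). So two depth-first searches (Kosaraju) yield the flexible edges, and a
  third one yields their connected components.
\<close>

section \<open>Flexible edges and strong components\<close>

text \<open>Another maximum \<open>b\<close>-matching may change a degree by more than one, more
  than a single slack or free arc carries, so the difference of two matchings is never decomposed
  into cycles. To show that a change is possible, a simple cycle through a given arc is flipped; it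
  uses each arc at most once, so its flow is a set of arcs. To show that a change is impossible,
  degree changes are counted over a set of nodes that no arc leaves. Free arcs can be put at every
  vertex: in a balanced set, a free arc at a vertex without matching edges can only cancel the slack
  arc there. Strong components can be coarser than flexible components, since vertices may be tied
  together only through \<open>s\<close> or \<open>t\<close>; hence the third search, along flexible
  edges alone. The machine has no procedures, and linear time requires a bound on the total work, so
  the search keeps an explicit stack and is one flat loop with a potential function.\<close>

text \<open>Edges of \<open>F\<close> inside \<open>M\<close> are removed and count negatively, the
  others are added. In the degree lemmas this sign is matched by the orientation of the
  edges.\<close>

lemma sum_sym_diff:
  fixes f :: "'a \<Rightarrow> int"
  assumes "finite M" "finite F"
  shows "(\<Sum>e\<in>sym_diff M F. f e) = (\<Sum>e\<in>M. f e) + (\<Sum>e\<in>F. if e \<in> M then - f e else f e)"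
proof -
  have a: "(\<Sum>e\<in>sym_diff M F. f e) = (\<Sum>e\<in>M - F. f e) + (\<Sum>e\<in>F - M. f e)"
    using assms by (intro sum.union_disjoint) auto
  have b: "(\<Sum>e\<in>M. f e) = (\<Sum>e\<in>M - F. f e) + (\<Sum>e\<in>M \<inter> F. f e)"
    using sum.Int_Diff[OF assms(1), of f F] by simp
  have "(\<Sum>e\<in>F. if e \<in> M then - f e else f e)
      = (\<Sum>e\<in>F - M. if e \<in> M then - f e else f e) + (\<Sum>e\<in>M \<inter> F. if e \<in> M then - f e else f e)"
    using sum.Int_Diff[OF assms(2), of "\<lambda>e. if e \<in> M then - f e else f e" M]
    by (simp add: Int_commute)
  also have "(\<Sum>e\<in>F - M. if e \<in> M then - f e else f e) = (\<Sum>e\<in>F - M. f e)"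
    by (rule sum.cong) auto
  also have "(\<Sum>e\<in>M \<inter> F. if e \<in> M then - f e else f e) = - (\<Sum>e\<in>M \<inter> F. f e)"
    by (subst sum_negf[symmetric], rule sum.cong) auto
  finally show ?thesis using a b by simp
qed

text \<open>Cutting a walk at its last visit to \<open>y\<close> leaves a tail that avoids
  \<open>y\<close>; the first alternative is a walk that never meets \<open>y\<close>. Deleting
  \<open>y\<close> from the relation lets an induction on the number of arcs extract simple
  paths.\<close>

lemma rtrancl_last_visit:
  assumes "(z, x) \<in> r\<^sup>*" "x \<noteq> y"
  shows "z \<noteq> y \<and> (z, x) \<in> (r \<inter> (- {y}) \<times> (- {y}))\<^sup>* \<or>
    (\<exists>y'. (y, y') \<in> r \<and> y' \<noteq> y \<and> (y', x) \<in> (r \<inter> (- {y}) \<times> (- {y}))\<^sup>*)"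
  using assms(1)
proof (induction rule: converse_rtrancl_induct)
  case base
  then show ?case using assms(2) by blast
next
  case (step u z)
  then show ?case
    by (cases "u = y") (auto intro: converse_rtrancl_into_rtrancl)
qed

text \<open>Arcs keep names, so parallel arcs stay distinct and a set of arcs can serve as a flow
  with values 0 and 1. The relation forgets the names, which is all that reachability
  requires.\<close>

definition arc_rel :: "('a \<Rightarrow> 'v) \<Rightarrow> ('a \<Rightarrow> 'v) \<Rightarrow> 'a set \<Rightarrow> ('v \<times> 'v) set" where
  "arc_rel src tgt I = (\<lambda>a. (src a, tgt a)) ` I"

definition net_outflow :: "('a \<Rightarrow> 'v) \<Rightarrow> ('a \<Rightarrow> 'v) \<Rightarrow> 'a set \<Rightarrow> 'v \<Rightarrow> int" where
  "net_outflow src tgt X v = (\<Sum>a\<in>X. of_bool (src a = v) - of_bool (tgt a = v))"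

text \<open>After the last visit to \<open>y\<close> all arcs at \<open>y\<close> can be deleted,
  which drives the induction and keeps every arc from being used twice. Because no chosen arc enters
  \<open>y\<close>, an arc with head \<open>y\<close> can later be added as a new element.\<close>

lemma simple_path_flow:
  assumes "finite I" "(y, x) \<in> (arc_rel src tgt I)\<^sup>*"
  shows "\<exists>X \<subseteq> I. (\<forall>a\<in>X. tgt a \<noteq> y) \<and>
    (\<forall>v. net_outflow src tgt X v = of_bool (v = y) - of_bool (v = x))"
  using assms
proof (induction "card I" arbitrary: I y rule: less_induct)
  case less
  show ?case
  proof (cases "y = x")
    case True
    then show ?thesis by (intro exI[of _ "{}"]) (auto simp: net_outflow_def)
  next
    case False
    let ?J = "{a \<in> I. src a \<noteq> y \<and> tgt a \<noteq> y}"
    have J: "arc_rel src tgt I \<inter> (- {y}) \<times> (- {y}) = arc_rel src tgt ?J"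
      unfolding arc_rel_def by auto
    from rtrancl_last_visit[OF less.prems(2), of y] False J obtain y' where
      y': "(y, y') \<in> arc_rel src tgt I" "y' \<noteq> y" "(y', x) \<in> (arc_rel src tgt ?J)\<^sup>*" by auto
    then obtain a where a: "a \<in> I" "src a = y" "tgt a = y'" unfolding arc_rel_def by auto
    have "card ?J < card I" using a less.prems(1) by (intro psubset_card_mono) auto
    from less.hyps[OF this _ y'(3)] less.prems(1) obtain X where
      X: "X \<subseteq> ?J" "\<forall>v. net_outflow src tgt X v = of_bool (v = y') - of_bool (v = x)" by auto
    have "finite X" "a \<notin> X" using X(1) a less.prems(1) finite_subset by fastforce+
    then have "net_outflow src tgt (insert a X) v = of_bool (v = y) - of_bool (v = x)" for v
      using X(2) a y'(2) by (auto simp: net_outflow_def)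
    then show ?thesis using X(1) a y'(2) by (intro exI[of _ "insert a X"]) auto
  qed
qed

datatype ('v, 'e) arc = Edge 'e | Free 'v | Slack 'v

text \<open>
  Slack arcs exist at the vertices that are loose for the given matching \<open>M\<close>, and free arcs at all
  vertices. Reversing the membership in \<open>M\<close> of the edges on a directed cycle keeps the degree
  constraints: only a slack arc can raise a degree, and only a free arc can lower one.
\<close>

locale maximum_b_matching =
  fixes G :: "('v, 'e) bgraph" and b :: "'v \<Rightarrow> nat" and M :: "'e set" and s t :: 'v
  assumes G: "finite_bipartite G" and M: "max_b_matching G b M"
    and s: "s \<notin> verts G" and t: "t \<notin> verts G" and st: "s \<noteq> t"
begin

abbreviation "A \<equiv> colA G"
abbreviation "B \<equiv> colB G"

definition arc_tail :: "('v, 'e) arc \<Rightarrow> 'v" where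
  "arc_tail a = (case a of
     Edge e \<Rightarrow> if e \<in> M then endB G e else endA G e
   | Free v \<Rightarrow> if v \<in> A then v else t
   | Slack v \<Rightarrow> if v \<in> A then s else v)"

definition arc_head :: "('v, 'e) arc \<Rightarrow> 'v" where
  "arc_head a = (case a of
     Edge e \<Rightarrow> if e \<in> M then endA G e else endB G e
   | Free v \<Rightarrow> if v \<in> A then s else v
   | Slack v \<Rightarrow> if v \<in> A then v else t)"

definition arcs :: "('v, 'e) arc set" where
  "arcs = Edge ` edges G \<union> Free ` verts G \<union> Slack ` {v \<in> verts G. mdegree G M v < b v}"

definition dgraph :: "('v \<times> 'v) set" where
  "dgraph = arc_rel arc_tail arc_head arcs"

definition scc :: "('v \<times> 'v) set" where
  "scc = dgraph\<^sup>* \<inter> (dgraph\<^sup>*)\<inverse>"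

lemma fin [simp]: "finite A" "finite B" "finite (edges G)" "finite (verts G)"
  and disj: "A \<inter> B = {}"
  and endA: "e \<in> edges G \<Longrightarrow> endA G e \<in> A" and endB: "e \<in> edges G \<Longrightarrow> endB G e \<in> B"
  using G by (auto simp: finite_bipartite_def verts_def)

lemma fin_arcs: "finite arcs" by (simp add: arcs_def)

lemma M_b: "b_matching G b M" and M_max: "b_matching G b N \<Longrightarrow> card N \<le> card M"
  and M_edges: "M \<subseteq> edges G" and fin_M: "finite M"
  using M finite_subset[OF _ fin(3)] by (auto simp: max_b_matching_def b_matching_def)

lemma max_iff: "max_b_matching G b N \<longleftrightarrow> b_matching G b N \<and> card N = card M"
  using M by (force simp: max_b_matching_def)

section \<open>Degree changes caused by flipping arcs\<close>

lemma mdegree_sum: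
  "finite N \<Longrightarrow> int (mdegree G N v) = (\<Sum>e\<in>N. of_bool (v \<in> ends G e))"
  by (simp add: mdegree_def Int_def)

definition edge_outflow :: "'e set \<Rightarrow> 'v \<Rightarrow> int" where
  "edge_outflow F v = (\<Sum>e\<in>F. of_bool (arc_tail (Edge e) = v) - of_bool (arc_head (Edge e) = v))"

text \<open>At a vertex of \<open>A\<close>, an edge outside \<open>M\<close> points away and raises
  the degree when flipped, while an edge of \<open>M\<close> points towards the vertex and lowers
  it. At \<open>B\<close> both directions are reversed, hence the opposite sign there.\<close>

lemma mdegree_sym_diff_A:
  assumes "F \<subseteq> edges G" "v \<in> A"
  shows "int (mdegree G (sym_diff M F) v) = int (mdegree G M v) + edge_outflow F v"
proof -
  have f: "finite F" using assms(1) fin(3) finite_subset by blast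
  have "(\<Sum>e\<in>F. if e \<in> M then - of_bool (v \<in> ends G e) else of_bool (v \<in> ends G e)) = edge_outflow F v"
    unfolding edge_outflow_def
    by (rule sum.cong) (use assms disj endB endA in \<open>auto simp: ends_def arc_tail_def arc_head_def\<close>)
  moreover have "finite (sym_diff M F)" using f fin_M by simp
  ultimately show ?thesis
    using sum_sym_diff[OF fin_M f, of "\<lambda>e. of_bool (v \<in> ends G e)"]
    by (simp only: mdegree_sum fin_M)
qed

lemma mdegree_sym_diff_B:
  assumes "F \<subseteq> edges G" "v \<in> B"
  shows "int (mdegree G (sym_diff M F) v) = int (mdegree G M v) - edge_outflow F v"
proof -
  have f: "finite F" using assms(1) fin(3) finite_subset by blast
  have "(\<Sum>e\<in>F. if e \<in> M then - of_bool (v \<in> ends G e) else of_bool (v \<in> ends G e)) = - edge_outflow F v"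
    unfolding edge_outflow_def sum_negf[symmetric]
    by (rule sum.cong) (use assms disj endB endA in \<open>auto simp: ends_def arc_tail_def arc_head_def\<close>)
  moreover have "finite (sym_diff M F)" using f fin_M by simp
  ultimately show ?thesis
    using sum_sym_diff[OF fin_M f, of "\<lambda>e. of_bool (v \<in> ends G e)"]
    by (simp only: mdegree_sum fin_M)
qed

text \<open>Each edge has exactly one end in either class. Equal cardinality of two matchings thus
  becomes a zero sum of degree changes over \<open>A\<close> and over \<open>B\<close>
  separately.\<close>

lemma card_sum_mdegree:
  assumes "N \<subseteq> edges G"
  shows "int (card N) = (\<Sum>v\<in>A. int (mdegree G N v))" "int (card N) = (\<Sum>v\<in>B. int (mdegree G N v))"
proof -
  have f: "finite N" using assms fin(3) finite_subset by blast
  have "(\<Sum>v\<in>A. int (mdegree G N v)) = (\<Sum>e\<in>N. \<Sum>v\<in>A. of_bool (v \<in> ends G e))"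
    unfolding mdegree_sum[OF f] by (rule sum.swap)
  also have "\<dots> = (\<Sum>e\<in>N. 1)"
  proof (rule sum.cong)
    fix e assume "e \<in> N"
    then have "(\<Sum>v\<in>A. of_bool (v \<in> ends G e)) = (\<Sum>v\<in>A. if v = endA G e then 1 else (0::int))"
      using assms endB disj by (intro sum.cong) (auto simp: ends_def)
    then show "(\<Sum>v\<in>A. of_bool (v \<in> ends G e)) = (1::int)"
      using \<open>e \<in> N\<close> assms endA by (auto simp: sum.delta)
  qed simp
  finally show "int (card N) = (\<Sum>v\<in>A. int (mdegree G N v))" by simp
  have "(\<Sum>v\<in>B. int (mdegree G N v)) = (\<Sum>e\<in>N. \<Sum>v\<in>B. of_bool (v \<in> ends G e))"
    unfolding mdegree_sum[OF f] by (rule sum.swap)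
  also have "\<dots> = (\<Sum>e\<in>N. 1)"
  proof (rule sum.cong)
    fix e assume "e \<in> N"
    then have "(\<Sum>v\<in>B. of_bool (v \<in> ends G e)) = (\<Sum>v\<in>B. if v = endB G e then 1 else (0::int))"
      using assms endA disj by (intro sum.cong) (auto simp: ends_def)
    then show "(\<Sum>v\<in>B. of_bool (v \<in> ends G e)) = (1::int)"
      using \<open>e \<in> N\<close> assms endB by (auto simp: sum.delta)
  qed simp
  finally show "int (card N) = (\<Sum>v\<in>B. int (mdegree G N v))" by simp
qed

text \<open>Balance is required at the vertices of the graph only, so \<open>X\<close> may be a
  cycle as well as a path from \<open>s\<close> to \<open>t\<close>; the outflow at \<open>s\<close>
  is the gain in size. At a vertex the edges of \<open>X\<close> must balance its slack and free
  arcs, which fixes the change of degree, and a slack arc exists only where \<open>M\<close> leaves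
  room.\<close>

lemma flip_balanced:
  assumes X: "X \<subseteq> arcs" and bal: "\<And>v. v \<in> verts G \<Longrightarrow> net_outflow arc_tail arc_head X v = 0"
  defines "N \<equiv> sym_diff M {e. Edge e \<in> X}"
  shows "b_matching G b N"
    and "int (card N) = int (card M) + net_outflow arc_tail arc_head X s"
    and "v \<in> A \<Longrightarrow> int (mdegree G N v) =
      int (mdegree G M v) + of_bool (Slack v \<in> X) - of_bool (Free v \<in> X)"
    and "v \<in> B \<Longrightarrow> int (mdegree G N v) =
      int (mdegree G M v) + of_bool (Slack v \<in> X) - of_bool (Free v \<in> X)"
proof -
  define F where "F = {e. Edge e \<in> X}"
  define P where "P = {v. Free v \<in> X}"
  define Q where "Q = {v. Slack v \<in> X}"
  have N: "N = sym_diff M F" by (simp add: N_def F_def)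
  have sub: "F \<subseteq> edges G" "P \<subseteq> verts G" "Q \<subseteq> verts G" and Q: "\<And>v. v \<in> Q \<Longrightarrow> mdegree G M v < b v"
    using X by (auto simp: F_def P_def Q_def arcs_def)
  have f: "finite F" "finite P" "finite Q" using sub fin finite_subset by metis+
  have XFPQ: "X = Edge ` F \<union> Free ` P \<union> Slack ` Q" using X by (auto simp: F_def P_def Q_def arcs_def)
  have split: "net_outflow arc_tail arc_head X v = edge_outflow F v
      + (\<Sum>p\<in>P. of_bool (arc_tail (Free p) = v) - of_bool (arc_head (Free p) = v))
      + (\<Sum>q\<in>Q. of_bool (arc_tail (Slack q) = v) - of_bool (arc_head (Slack q) = v))" for v
    unfolding net_outflow_def edge_outflow_def XFPQ
    using f by (subst sum.union_disjoint, simp, simp, force)+ (simp add: sum.reindex inj_on_def)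
  have nA: "s \<notin> A" "t \<notin> A" "s \<notin> B" "t \<notin> B" using s t by (auto simp: verts_def)
  have eA: "edge_outflow F v = of_bool (v \<in> Q) - of_bool (v \<in> P)" if v: "v \<in> A" for v
  proof -
    have p: "(\<Sum>p\<in>P. of_bool (arc_tail (Free p) = v) - of_bool (arc_head (Free p) = v))
      = (\<Sum>p\<in>P. if p = v then 1 else (0::int))"
      by (rule sum.cong) (use v sub disj nA in \<open>auto simp: arc_tail_def arc_head_def verts_def\<close>)
    have q: "(\<Sum>p\<in>Q. of_bool (arc_tail (Slack p) = v) - of_bool (arc_head (Slack p) = v))
      = (\<Sum>p\<in>Q. if p = v then - 1 else (0::int))"
      by (rule sum.cong) (use v sub disj nA in \<open>auto simp: arc_tail_def arc_head_def verts_def\<close>)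
    show ?thesis using split[of v] bal[of v] v f unfolding p q by (auto simp: verts_def split: if_splits)
  qed
  have eB: "edge_outflow F v = of_bool (v \<in> P) - of_bool (v \<in> Q)" if v: "v \<in> B" for v
  proof -
    have p: "(\<Sum>p\<in>P. of_bool (arc_tail (Free p) = v) - of_bool (arc_head (Free p) = v))
      = (\<Sum>p\<in>P. if p = v then - 1 else (0::int))"
      by (rule sum.cong) (use v sub disj nA in \<open>auto simp: arc_tail_def arc_head_def verts_def\<close>)
    have q: "(\<Sum>p\<in>Q. of_bool (arc_tail (Slack p) = v) - of_bool (arc_head (Slack p) = v))
      = (\<Sum>p\<in>Q. if p = v then 1 else (0::int))"
      by (rule sum.cong) (use v sub disj nA in \<open>auto simp: arc_tail_def arc_head_def verts_def\<close>)
    show ?thesis using split[of v] bal[of v] v f unfolding p q by (auto simp: verts_def split: if_splits)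
  qed
  show dA: "int (mdegree G N v) = int (mdegree G M v) + of_bool (Slack v \<in> X) - of_bool (Free v \<in> X)"
    if "v \<in> A" for v
    using mdegree_sym_diff_A[OF sub(1) that] eA[OF that] by (simp add: N P_def Q_def)
  show dB: "int (mdegree G N v) = int (mdegree G M v) + of_bool (Slack v \<in> X) - of_bool (Free v \<in> X)"
    if "v \<in> B" for v
    using mdegree_sym_diff_B[OF sub(1) that] eB[OF that] by (simp add: N P_def Q_def)
  have NE: "N \<subseteq> edges G" using M_edges sub(1) by (auto simp: N)
  have "mdegree G N v \<le> b v" if "v \<in> verts G" for v
  proof -
    have "int (mdegree G N v) = int (mdegree G M v) + of_bool (v \<in> Q) - of_bool (v \<in> P)"
      using dA[of v] dB[of v] that by (auto simp: Q_def P_def verts_def)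
    moreover have "mdegree G M v \<le> b v" using M_b that by (auto simp: b_matching_def)
    ultimately show ?thesis using Q[of v] by (cases "v \<in> Q"; cases "v \<in> P") simp_all
  qed
  then show "b_matching G b N" using NE by (auto simp: b_matching_def)
  have "int (card N) = (\<Sum>v\<in>A. int (mdegree G M v) + (of_bool (v \<in> Q) - of_bool (v \<in> P)))"
    unfolding card_sum_mdegree(1)[OF NE] by (rule sum.cong) (auto simp: dA P_def Q_def)
  also have "\<dots> = int (card M) + ((\<Sum>v\<in>A. of_bool (v \<in> Q)) - (\<Sum>v\<in>A. of_bool (v \<in> P)))"
    by (simp add: card_sum_mdegree(1)[OF M_edges] sum.distrib sum_subtractf)
  also have "(\<Sum>v\<in>A. of_bool (v \<in> Q)) = (\<Sum>v\<in>Q. of_bool (v \<in> A) :: int)"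
    using f by (simp add: Int_commute)
  also have "(\<Sum>v\<in>A. of_bool (v \<in> P)) = (\<Sum>v\<in>P. of_bool (v \<in> A) :: int)"
    using f by (simp add: Int_commute)
  \<comment> \<open>Only slack and free arcs at vertices of \<open>A\<close> touch \<open>s\<close>,
    so the total degree change over \<open>A\<close> is the net outflow of \<open>s\<close>.\<close>
  also have "(\<Sum>v\<in>Q. of_bool (v \<in> A) :: int) =
      (\<Sum>q\<in>Q. of_bool (arc_tail (Slack q) = s) - of_bool (arc_head (Slack q) = s))"
    by (rule sum.cong) (use s st sub nA in \<open>auto simp: arc_tail_def arc_head_def\<close>)
  also have "(\<Sum>v\<in>P. of_bool (v \<in> A) :: int) =
      - (\<Sum>q\<in>P. of_bool (arc_tail (Free q) = s) - of_bool (arc_head (Free q) = s))"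
    unfolding sum_negf[symmetric]
    by (rule sum.cong) (use s st sub nA in \<open>auto simp: arc_tail_def arc_head_def\<close>)
  also have "(\<Sum>q\<in>Q. of_bool (arc_tail (Slack q) = s) - of_bool (arc_head (Slack q) = s)) -
      - (\<Sum>q\<in>P. of_bool (arc_tail (Free q) = s) - of_bool (arc_head (Free q) = s))
      = net_outflow arc_tail arc_head X s - edge_outflow F s"
    unfolding split by simp
  also have "edge_outflow F s = 0"
    unfolding edge_outflow_def
    by (rule sum.neutral) (use sub(1) endA endB nA in \<open>auto simp: arc_tail_def arc_head_def\<close>)
  finally show "int (card N) = int (card M) + net_outflow arc_tail arc_head X s" by simp
qed

section \<open>Closed node sets, cycles and strong connectivity\<close>

lemma dgraph_intros:
  "e \<in> edges G \<Longrightarrow> (arc_tail (Edge e), arc_head (Edge e)) \<in> dgraph"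
  "v \<in> A \<Longrightarrow> (v, s) \<in> dgraph"
  "v \<in> B \<Longrightarrow> (t, v) \<in> dgraph"
  "v \<in> A \<Longrightarrow> mdegree G M v < b v \<Longrightarrow> (s, v) \<in> dgraph"
  "v \<in> B \<Longrightarrow> mdegree G M v < b v \<Longrightarrow> (v, t) \<in> dgraph"
proof -
  have *: "a \<in> arcs \<Longrightarrow> (arc_tail a, arc_head a) \<in> dgraph" for a
    by (auto simp: dgraph_def arc_rel_def)
  have nAB: "v \<in> B \<Longrightarrow> v \<notin> A" using disj by blast
  show "e \<in> edges G \<Longrightarrow> (arc_tail (Edge e), arc_head (Edge e)) \<in> dgraph"
    by (rule *) (auto simp: arcs_def)
  show "v \<in> A \<Longrightarrow> (v, s) \<in> dgraph" "v \<in> B \<Longrightarrow> (t, v) \<in> dgraph"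
    using *[of "Free v"] nAB by (force simp: arcs_def arc_tail_def arc_head_def verts_def)+
  show "v \<in> A \<Longrightarrow> mdegree G M v < b v \<Longrightarrow> (s, v) \<in> dgraph"
   "v \<in> B \<Longrightarrow> mdegree G M v < b v \<Longrightarrow> (v, t) \<in> dgraph"
    using *[of "Slack v"] nAB by (force simp: arcs_def arc_tail_def arc_head_def verts_def)+
qed

text \<open>No arc leaves \<open>S\<close>, so edges on which \<open>M\<close> and \<open>N\<close>
  differ can cross its boundary only inwards. Closure also forces the total degree change to be
  nonnegative over \<open>A \<inter> S\<close> and nonpositive over \<open>B \<inter> S\<close>,
  while the difference of these totals is minus the number of entering edges. Hence all three
  numbers are zero.\<close>

lemma closed_set_saturated:
  assumes closed: "\<And>x y. x \<in> S \<Longrightarrow> (x, y) \<in> dgraph \<Longrightarrow> y \<in> S" and N: "max_b_matching G b N"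
  shows "s \<in> S \<Longrightarrow> v \<in> A \<Longrightarrow> v \<notin> S \<Longrightarrow> mdegree G N v = b v"
    and "t \<notin> S \<Longrightarrow> v \<in> B \<Longrightarrow> v \<in> S \<Longrightarrow> mdegree G N v = b v"
    and "e \<in> sym_diff M N \<Longrightarrow> arc_head (Edge e) \<in> S \<Longrightarrow> arc_tail (Edge e) \<in> S"
proof -
  define F where "F = sym_diff M N"
  have Nb: "b_matching G b N" and cN: "card N = card M" using N by (auto simp: max_iff)
  have NE: "N \<subseteq> edges G" and dN: "\<And>v. v \<in> verts G \<Longrightarrow> mdegree G N v \<le> b v"
    using Nb by (auto simp: b_matching_def)
  have dM: "\<And>v. v \<in> verts G \<Longrightarrow> mdegree G M v \<le> b v" using M_b by (auto simp: b_matching_def)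
  have FE: "F \<subseteq> edges G" and NF: "sym_diff M F = N" using NE M_edges by (auto simp: F_def)
  have finF: "finite F" using FE fin(3) finite_subset by blast
  define dg where "dg v = int (mdegree G N v) - int (mdegree G M v)" for v
  have dA: "edge_outflow F v = dg v" if "v \<in> A" for v
    using mdegree_sym_diff_A[OF FE that] by (simp add: NF dg_def)
  have dB: "edge_outflow F v = - dg v" if "v \<in> B" for v
    using mdegree_sym_diff_B[OF FE that] by (simp add: NF dg_def)
  have sumA: "(\<Sum>v\<in>A. dg v) = 0" and sumB: "(\<Sum>v\<in>B. dg v) = 0"
    using card_sum_mdegree[OF NE] card_sum_mdegree[OF M_edges] cN
    by (simp_all add: dg_def sum_subtractf)
  have satA: "mdegree G M v = b v" if "s \<in> S" "v \<in> A" "v \<notin> S" for v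
    using that closed[OF that(1), of v] dM[of v] dgraph_intros(4)[of v]
    by (force simp: verts_def)
  have satB: "mdegree G M v = b v" if "t \<notin> S" "v \<in> B" "v \<in> S" for v
    using that closed[OF that(3), of t] dM[of v] dgraph_intros(5)[of v]
    by (force simp: verts_def)
  have a0: "(\<Sum>v\<in>A \<inter> S. dg v) = - (\<Sum>v\<in>A - S. dg v)"
    using sumA sum.Int_Diff[of A dg S] by simp
  \<comment> \<open>As soon as \<open>S\<close> meets \<open>A\<close>, a free arc puts
    \<open>s\<close> into \<open>S\<close>. The vertices of \<open>A\<close> outside
    \<open>S\<close> are then full under \<open>M\<close>, so their degrees can only fall.\<close>
  have a1: "(\<Sum>v\<in>A \<inter> S. dg v) \<ge> 0"
  proof (cases "A \<inter> S = {}")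
    case False
    then have "s \<in> S" using closed dgraph_intros(2) by blast
    then have "(\<Sum>v\<in>A - S. dg v) \<le> 0"
      by (intro sum_nonpos) (use satA dN in \<open>auto simp: dg_def verts_def\<close>)
    then show ?thesis using a0 by simp
  qed simp
  have b1: "(\<Sum>v\<in>B \<inter> S. dg v) \<le> 0"
  proof (cases "t \<in> S")
    case True
    then have "B \<inter> S = B" using closed dgraph_intros(3) by blast
    then show ?thesis using sumB by simp
  next
    case False
    then show ?thesis by (intro sum_nonpos) (use satB dN in \<open>auto simp: dg_def verts_def\<close>)
  qed
  have "(\<Sum>v\<in>A \<inter> S. dg v) - (\<Sum>v\<in>B \<inter> S. dg v)
      = (\<Sum>v\<in>A \<inter> S. edge_outflow F v) + (\<Sum>v\<in>B \<inter> S. edge_outflow F v)"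
    using dA dB by (simp add: sum_negf)
  also have "\<dots> = (\<Sum>v\<in>(A \<inter> S) \<union> (B \<inter> S). edge_outflow F v)"
    using disj by (subst sum.union_disjoint) auto
  also have "(A \<inter> S) \<union> (B \<inter> S) = verts G \<inter> S" by (auto simp: verts_def)
  also have "(\<Sum>v\<in>verts G \<inter> S. edge_outflow F v) =
      (\<Sum>e\<in>F. \<Sum>v\<in>verts G \<inter> S. of_bool (arc_tail (Edge e) = v) - of_bool (arc_head (Edge e) = v))"
    unfolding edge_outflow_def by (rule sum.swap)
  \<comment> \<open>An edge inside \<open>S\<close> cancels and none leaves \<open>S\<close>, so
    each edge that enters \<open>S\<close> contributes \<open>-1\<close>.\<close>
  also have "\<dots> = (\<Sum>e\<in>F. - of_bool (arc_tail (Edge e) \<notin> S \<and> arc_head (Edge e) \<in> S))"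
  proof (rule sum.cong)
    fix e assume "e \<in> F"
    then have e: "e \<in> edges G" using FE by auto
    have "arc_tail (Edge e) \<in> verts G" "arc_head (Edge e) \<in> verts G"
      using endA[OF e] endB[OF e] by (auto simp: arc_tail_def arc_head_def verts_def)
    then show "(\<Sum>v\<in>verts G \<inter> S. of_bool (arc_tail (Edge e) = v) - of_bool (arc_head (Edge e) = v)) =
       - (of_bool (arc_tail (Edge e) \<notin> S \<and> arc_head (Edge e) \<in> S) :: int)"
      using closed[OF _ dgraph_intros(1)[OF e]]
      by (auto simp: sum_subtractf of_bool_def sum.delta' sum.delta)
  qed simp
  also have "\<dots> = - (\<Sum>e\<in>F. of_bool (arc_tail (Edge e) \<notin> S \<and> arc_head (Edge e) \<in> S))"
    by (simp only: sum_negf)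
  finally have eq: "(\<Sum>v\<in>A \<inter> S. dg v) - (\<Sum>v\<in>B \<inter> S. dg v) =
    - (\<Sum>e\<in>F. of_bool (arc_tail (Edge e) \<notin> S \<and> arc_head (Edge e) \<in> S))" .
  have ge: "(\<Sum>e\<in>F. of_bool (arc_tail (Edge e) \<notin> S \<and> arc_head (Edge e) \<in> S) :: int) \<ge> 0"
    by (rule sum_nonneg) auto
  \<comment> \<open>One side of \<open>eq\<close> is nonnegative and the other nonpositive. Single
    terms are then extracted from vanishing sums whose terms have one sign.\<close>
  have zA: "(\<Sum>v\<in>A \<inter> S. dg v) = 0" and zB: "(\<Sum>v\<in>B \<inter> S. dg v) = 0"
    and zF: "(\<Sum>e\<in>F. of_bool (arc_tail (Edge e) \<notin> S \<and> arc_head (Edge e) \<in> S) :: int) = 0"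
    using eq a1 b1 ge by linarith+
  show "mdegree G N v = b v" if "s \<in> S" "v \<in> A" "v \<notin> S"
  proof -
    have "(\<Sum>v\<in>A - S. - dg v) = 0" using zA a0 by (simp add: sum_negf)
    then have "- dg v = 0"
      by (subst (asm) sum_nonneg_eq_0_iff) (use that satA dN in \<open>auto simp: dg_def verts_def\<close>)
    then show ?thesis using satA[OF that] by (simp add: dg_def)
  qed
  show "mdegree G N v = b v" if "t \<notin> S" "v \<in> B" "v \<in> S"
  proof -
    have "(\<Sum>v\<in>B \<inter> S. - dg v) = 0" using zB by (simp add: sum_negf)
    then have "- dg v = 0"
      by (subst (asm) sum_nonneg_eq_0_iff) (use that satB dN in \<open>auto simp: dg_def verts_def\<close>)
    then show ?thesis using satB[OF that] by (simp add: dg_def)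
  qed
  show "arc_tail (Edge e) \<in> S" if "e \<in> sym_diff M N" "arc_head (Edge e) \<in> S"
    using zF that finF unfolding F_def[symmetric]
    by (subst (asm) sum_nonneg_eq_0_iff) auto
qed

text \<open>The unit flow of such a path is balanced on \<open>verts G\<close> and leaves
  \<open>s\<close> once, so flipping it would give a \<open>b\<close>-matching with one more
  edge.\<close>

lemma no_augmenting_path: "(s, t) \<notin> dgraph\<^sup>*"
proof
  assume "(s, t) \<in> dgraph\<^sup>*"
  from simple_path_flow[OF fin_arcs this[unfolded dgraph_def]] obtain X where X: "X \<subseteq> arcs"
    and bal: "\<And>v. net_outflow arc_tail arc_head X v = of_bool (v = s) - of_bool (v = t)"
    by blast
  have "net_outflow arc_tail arc_head X v = 0" if "v \<in> verts G" for v
    using that s t by (auto simp: bal)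
  from flip_balanced(1,2)[OF X this] show False
    using M_max[of "sym_diff M {e. Edge e \<in> X}"] st by (simp add: bal)
qed

text \<open>The arc \<open>a\<close> closes a simple path from its head to its tail. No arc of that
  path enters the head of \<open>a\<close>, so \<open>a\<close> is new and certainly lies in
  \<open>X\<close>.\<close>

lemma cycle_matching:
  assumes a: "a \<in> arcs" "arc_tail a \<noteq> arc_head a" "(arc_head a, arc_tail a) \<in> dgraph\<^sup>*"
  obtains X where "X \<subseteq> arcs" "a \<in> X" "\<And>v. net_outflow arc_tail arc_head X v = 0"
proof -
  obtain X where X: "X \<subseteq> arcs" "\<forall>a'\<in>X. arc_head a' \<noteq> arc_head a"
    "\<And>v. net_outflow arc_tail arc_head X v = of_bool (v = arc_head a) - of_bool (v = arc_tail a)"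
    using simple_path_flow[OF fin_arcs a(3)[unfolded dgraph_def]] by blast
  have "finite X" using X(1) fin_arcs by (rule finite_subset)
  moreover have "a \<notin> X" using X(2) by auto
  ultimately have "net_outflow arc_tail arc_head (insert a X) v = 0" for v
    using X(3)[of v] by (simp add: net_outflow_def of_bool_def split: if_splits)
  then show ?thesis using that[of "insert a X"] X a by auto
qed

text \<open>If two maximum \<open>b\<close>-matchings disagree on \<open>e\<close>, one of them
  disagrees with \<open>M\<close>, and counting over a closed set applies to it. Conversely,
  flipping a cycle through \<open>e\<close> gives a maximum \<open>b\<close>-matching that disagrees
  with \<open>M\<close> on \<open>e\<close>.\<close>

lemma flexible_iff: "flexible G b e \<longleftrightarrow> e \<in> edges G \<and> (endA G e, endB G e) \<in> scc"
proof
  assume fl: "flexible G b e"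
  then obtain N N' where "max_b_matching G b N" "e \<in> N" "max_b_matching G b N'" "e \<notin> N'"
    and e: "e \<in> edges G"
    unfolding flexible_def inevitable_def allowed_def by blast
  then obtain N where N: "max_b_matching G b N" "e \<in> sym_diff M N" by (cases "e \<in> M") auto
  \<comment> \<open>The closed set is everything reachable from the head of \<open>e\<close>; a
    changed edge cannot enter it from outside.\<close>
  have "arc_tail (Edge e) \<in> dgraph\<^sup>* `` {arc_head (Edge e)}"
    by (rule closed_set_saturated(3)[OF _ N]) (auto intro: rtrancl_into_rtrancl)
  then show "e \<in> edges G \<and> (endA G e, endB G e) \<in> scc"
    using e dgraph_intros(1)[OF e]
    by (auto simp: scc_def arc_tail_def arc_head_def split: if_splits)
next
  assume e: "e \<in> edges G \<and> (endA G e, endB G e) \<in> scc"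
  have "Edge e \<in> arcs" "arc_tail (Edge e) \<noteq> arc_head (Edge e)"
    "(arc_head (Edge e), arc_tail (Edge e)) \<in> dgraph\<^sup>*"
    using e endA[of e] endB[of e] disj by (auto simp: arcs_def arc_tail_def arc_head_def scc_def)
  then obtain X where X: "X \<subseteq> arcs" "Edge e \<in> X" "\<And>v. net_outflow arc_tail arc_head X v = 0"
    using cycle_matching by metis
  from flip_balanced(1,2)[OF X(1,3)] X(3)[of s]
  have "max_b_matching G b (sym_diff M {e. Edge e \<in> X})" by (simp add: max_iff)
  moreover have "e \<in> sym_diff M {e. Edge e \<in> X} \<longleftrightarrow> e \<notin> M" using X(2) by auto
  ultimately show "flexible G b e" using M e
    unfolding flexible_def inevitable_def allowed_def by blast
qed

text \<open>An edge that is not flexible has the same status in all maximum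
  \<open>b\<close>-matchings, so the given \<open>M\<close> decides whether it is inevitable or
  forbidden.\<close>

lemma inevitable_iff: "inevitable G b e \<longleftrightarrow> e \<in> M \<and> \<not> flexible G b e"
  using M M_edges unfolding flexible_def inevitable_def allowed_def by blast

lemma forbidden_iff: "forbidden G b e \<longleftrightarrow> e \<in> edges G \<and> e \<notin> M \<and> \<not> flexible G b e"
  using M unfolding flexible_def inevitable_def allowed_def forbidden_def by blast

lemma scc_refl: "(v, v) \<in> scc" and scc_sym: "(u, v) \<in> scc \<Longrightarrow> (v, u) \<in> scc"
  and scc_trans: "(u, v) \<in> scc \<Longrightarrow> (v, w) \<in> scc \<Longrightarrow> (u, w) \<in> scc"
  by (auto simp: scc_def)

lemma not_scc_st: "(s, t) \<notin> scc"
  using no_augmenting_path by (auto simp: scc_def)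

text \<open>A vertex of \<open>A\<close> not reachable from \<open>s\<close> lies outside a closed
  set containing \<open>s\<close> and is therefore full in every maximum \<open>b\<close>-matching.
  Conversely, flipping a cycle through its free arc lowers its degree.\<close>

lemma loose_A_iff: assumes v: "v \<in> A" shows "v \<in> loose_vertices G b \<longleftrightarrow> (v, s) \<in> scc"
proof
  assume "v \<in> loose_vertices G b"
  then obtain N where N: "max_b_matching G b N" "mdegree G N v < b v" by (auto simp: loose_vertices_def)
  have "v \<in> dgraph\<^sup>* `` {s}"
  proof (rule ccontr)
    assume "v \<notin> dgraph\<^sup>* `` {s}"
    from closed_set_saturated(1)[OF _ N(1) _ v this] N(2) show False
      by (auto intro: rtrancl_into_rtrancl)
  qed
  then show "(v, s) \<in> scc" using dgraph_intros(2)[OF v] by (auto simp: scc_def)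
next
  assume vs: "(v, s) \<in> scc"
  have vG: "v \<in> verts G" using v by (auto simp: verts_def)
  show "v \<in> loose_vertices G b"
  proof (cases "mdegree G M v < b v")
    case True
    then show ?thesis using M vG by (auto simp: loose_vertices_def)
  next
    case False
    have "Free v \<in> arcs" "arc_tail (Free v) \<noteq> arc_head (Free v)"
      "(arc_head (Free v), arc_tail (Free v)) \<in> dgraph\<^sup>*"
      using v s vs by (auto simp: arcs_def arc_tail_def arc_head_def scc_def verts_def)
    then obtain X where X: "X \<subseteq> arcs" "Free v \<in> X" "\<And>v. net_outflow arc_tail arc_head X v = 0"
      using cycle_matching by metis
    \<comment> \<open>A slack arc in \<open>X\<close> would offset the free arc and leave the degree
      unchanged; where slack arcs exist, \<open>M\<close> itself is already the witness.\<close>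
    have "Slack v \<notin> X" using X(1) False by (auto simp: arcs_def)
    with flip_balanced(3)[OF X(1,3) v] X(2)
    have "mdegree G (sym_diff M {e. Edge e \<in> X}) v < mdegree G M v" by simp
    moreover have "mdegree G M v \<le> b v" using M_b vG by (auto simp: b_matching_def)
    moreover from flip_balanced(1,2)[OF X(1,3)] X(3)[of s]
    have "max_b_matching G b (sym_diff M {e. Edge e \<in> X})" by (simp add: max_iff)
    ultimately show ?thesis using vG by (fastforce simp: loose_vertices_def)
  qed
qed

text \<open>The free arc runs from \<open>t\<close> to the vertex, so the direction in question is
  from the vertex to \<open>t\<close>. The closed set is accordingly the set of nodes that cannot
  reach \<open>t\<close>.\<close>

lemma loose_B_iff: assumes v: "v \<in> B" shows "v \<in> loose_vertices G b \<longleftrightarrow> (v, t) \<in> scc"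
proof
  assume "v \<in> loose_vertices G b"
  then obtain N where N: "max_b_matching G b N" "mdegree G N v < b v" by (auto simp: loose_vertices_def)
  have "(v, t) \<in> dgraph\<^sup>*"
  proof (rule ccontr)
    assume "(v, t) \<notin> dgraph\<^sup>*"
    then have "v \<in> {x. (x, t) \<notin> dgraph\<^sup>*}" by simp
    from closed_set_saturated(2)[OF _ N(1) _ v this] N(2) show False
      by (auto intro: converse_rtrancl_into_rtrancl)
  qed
  then show "(v, t) \<in> scc" using dgraph_intros(3)[OF v] by (auto simp: scc_def)
next
  assume vs: "(v, t) \<in> scc"
  have vG: "v \<in> verts G" using v by (auto simp: verts_def)
  show "v \<in> loose_vertices G b"
  proof (cases "mdegree G M v < b v")
    case True
    then show ?thesis using M vG by (auto simp: loose_vertices_def)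
  next
    case False
    have "Free v \<in> arcs" "arc_tail (Free v) \<noteq> arc_head (Free v)"
      "(arc_head (Free v), arc_tail (Free v)) \<in> dgraph\<^sup>*"
      using v t vs disj by (auto simp: arcs_def arc_tail_def arc_head_def scc_def verts_def)
    then obtain X where X: "X \<subseteq> arcs" "Free v \<in> X" "\<And>v. net_outflow arc_tail arc_head X v = 0"
      using cycle_matching by metis
    have "Slack v \<notin> X" using X(1) False by (auto simp: arcs_def)
    with flip_balanced(4)[OF X(1,3) v] X(2)
    have "mdegree G (sym_diff M {e. Edge e \<in> X}) v < mdegree G M v" by simp
    moreover have "mdegree G M v \<le> b v" using M_b vG by (auto simp: b_matching_def)
    moreover from flip_balanced(1,2)[OF X(1,3)] X(3)[of s]
    have "max_b_matching G b (sym_diff M {e. Edge e \<in> X})" by (simp add: max_iff)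
    ultimately show ?thesis using vG by (fastforce simp: loose_vertices_def)
  qed
qed


section \<open>Flexible components, their classification and their order\<close>

abbreviation flex_comp :: "'v \<Rightarrow> 'v set" where
  "flex_comp v \<equiv> (flex_adj G b)\<^sup>* `` {v}"

lemma flex_adj_iff: "(u, v) \<in> flex_adj G b \<longleftrightarrow>
    (\<exists>e\<in>edges G. (endA G e, endB G e) \<in> scc \<and> (u, v) \<in> {(endA G e, endB G e), (endB G e, endA G e)})"
  by (auto simp: flex_adj_def flexible_iff ends_def doubleton_eq_iff)

lemma sym_flex_adj: "sym (flex_adj G b)"
  by (auto simp: sym_def flex_adj_iff)

lemma flex_reach_sym: "(u, v) \<in> (flex_adj G b)\<^sup>* \<Longrightarrow> (v, u) \<in> (flex_adj G b)\<^sup>*"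
  using sym_rtrancl[OF sym_flex_adj] by (rule symD)

lemma flex_comp_eq: "v \<in> flex_comp u \<Longrightarrow> flex_comp v = flex_comp u"
  using flex_reach_sym by (auto intro: rtrancl_trans)

lemma flex_comp_iff: "flex_comp u = flex_comp v \<longleftrightarrow> (u, v) \<in> (flex_adj G b)\<^sup>*"
  using flex_comp_eq[of v u] by auto

lemma flex_comp_scc: "v \<in> flex_comp u \<Longrightarrow> (u, v) \<in> scc"
proof -
  have "(u, v) \<in> (flex_adj G b)\<^sup>* \<Longrightarrow> (u, v) \<in> scc"
    by (induction rule: rtrancl_induct)
       (auto simp: scc_refl flex_adj_iff intro: scc_trans scc_sym)
  then show "v \<in> flex_comp u \<Longrightarrow> (u, v) \<in> scc" by simp
qed

lemma flex_comp_verts: "v \<in> flex_comp u \<Longrightarrow> u \<in> verts G \<Longrightarrow> v \<in> verts G"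
proof -
  have "(u, v) \<in> (flex_adj G b)\<^sup>* \<Longrightarrow> u \<in> verts G \<Longrightarrow> v \<in> verts G"
    by (induction rule: rtrancl_induct) (use endA endB in \<open>auto simp: flex_adj_iff verts_def\<close>)
  then show "v \<in> flex_comp u \<Longrightarrow> u \<in> verts G \<Longrightarrow> v \<in> verts G" by simp
qed

text \<open>No \<open>b\<close>-matching has an edge at \<open>v\<close>, so no edge at
  \<open>v\<close> is allowed. Testing \<open>b\<close> at one vertex of a component thus already
  shows that the component is a singleton.\<close>

lemma inactive_flex_comp:
  assumes "b v = 0" "v \<in> verts G"
  shows "flex_comp v = {v}"
proof -
  have "(v, w) \<notin> flex_adj G b" for w
  proof
    assume "(v, w) \<in> flex_adj G b"
    then obtain e N where e: "v \<in> ends G e" "e \<in> N" "max_b_matching G b N"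
      by (auto simp: flex_adj_def flexible_def allowed_def)
    then have "b_matching G b N" by (simp add: max_b_matching_def)
    then have "finite N" "mdegree G N v = 0"
      using assms finite_subset[OF _ fin(3)] by (auto simp: b_matching_def)
    then show False using e by (auto simp: mdegree_def)
  qed
  then have "w = v" if "(v, w) \<in> (flex_adj G b)\<^sup>*" for w
    using that by (auto elim: converse_rtranclE)
  then show ?thesis by auto
qed

lemma loose_verts: "loose_vertices G b \<subseteq> A \<union> B"
  by (auto simp: loose_vertices_def verts_def)

text \<open>This is the form that one pass over the vertices and one over the edges can evaluate:
  looseness becomes strong connection to \<open>s\<close>, and the singleton condition follows from
  \<open>b = 0\<close>.\<close>

lemma hooked_up_by_A:
  assumes "v \<in> verts G"
  shows "hooked_up_by G b A (flex_comp v) \<longleftrightarrow>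
    (\<exists>u\<in>A. (u, s) \<in> scc \<and> u \<in> flex_comp v) \<or>
    (\<exists>e\<in>edges G. b (endB G e) = 0 \<and> (endA G e, s) \<in> scc \<and> endB G e \<in> flex_comp v)"
    (is "?l \<longleftrightarrow> ?r1 \<or> ?r2")
proof
  assume ?l
  then consider u where "u \<in> flex_comp v" "u \<in> loose_vertices G b" "u \<in> A"
    | w u where "flex_comp v = {w}" "b w = 0" "u \<in> loose_vertices G b" "u \<in> A" "adjacent G w u"
    unfolding hooked_up_by_def inactive_next_to_def by blast
  then show "?r1 \<or> ?r2"
  proof cases
    case 1 then show ?thesis using loose_A_iff by blast
  next
    case 2
    then obtain e where e: "e \<in> edges G" "{endA G e, endB G e} = {w, u}"
      by (auto simp: adjacent_def ends_def)
    then have "endA G e = u" "endB G e = w"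
      using endA[OF e(1)] endB[OF e(1)] disj \<open>u \<in> A\<close> by (auto simp: doubleton_eq_iff)
    then show ?thesis using 2 e loose_A_iff by blast
  qed
next
  assume "?r1 \<or> ?r2"
  then show ?l
  proof
    assume ?r1
    then show ?l using loose_A_iff by (auto simp: hooked_up_by_def loose_comp_def)
  next
    assume ?r2
    then obtain e where e: "e \<in> edges G" "b (endB G e) = 0" "(endA G e, s) \<in> scc"
      "endB G e \<in> flex_comp v" by blast
    have "flex_comp v = {endB G e}"
      using flex_comp_eq[OF e(4)] inactive_flex_comp[OF e(2)] endB[OF e(1)] by (simp add: verts_def)
    moreover have "endA G e \<in> loose_vertices G b" using loose_A_iff endA e by blast
    moreover have "adjacent G (endB G e) (endA G e)" using e by (auto simp: adjacent_def ends_def)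
    ultimately show ?l using e(2) endA[OF e(1)] unfolding hooked_up_by_def inactive_next_to_def by blast
  qed
qed

lemma hooked_up_by_B:
  assumes "v \<in> verts G"
  shows "hooked_up_by G b B (flex_comp v) \<longleftrightarrow>
    (\<exists>u\<in>B. (u, t) \<in> scc \<and> u \<in> flex_comp v) \<or>
    (\<exists>e\<in>edges G. b (endA G e) = 0 \<and> (endB G e, t) \<in> scc \<and> endA G e \<in> flex_comp v)"
    (is "?l \<longleftrightarrow> ?r1 \<or> ?r2")
proof
  assume ?l
  then consider u where "u \<in> flex_comp v" "u \<in> loose_vertices G b" "u \<in> B"
    | w u where "flex_comp v = {w}" "b w = 0" "u \<in> loose_vertices G b" "u \<in> B" "adjacent G w u"
    unfolding hooked_up_by_def inactive_next_to_def by blast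
  then show "?r1 \<or> ?r2"
  proof cases
    case 1 then show ?thesis using loose_B_iff by blast
  next
    case 2
    then obtain e where e: "e \<in> edges G" "{endA G e, endB G e} = {w, u}"
      by (auto simp: adjacent_def ends_def)
    then have "endB G e = u" "endA G e = w"
      using endA[OF e(1)] endB[OF e(1)] disj \<open>u \<in> B\<close> by (auto simp: doubleton_eq_iff)
    then show ?thesis using 2 e loose_B_iff by blast
  qed
next
  assume "?r1 \<or> ?r2"
  then show ?l
  proof
    assume ?r1
    then show ?l using loose_B_iff by (auto simp: hooked_up_by_def loose_comp_def)
  next
    assume ?r2
    then obtain e where e: "e \<in> edges G" "b (endA G e) = 0" "(endB G e, t) \<in> scc"
      "endA G e \<in> flex_comp v" by blast
    have "flex_comp v = {endA G e}"
      using flex_comp_eq[OF e(4)] inactive_flex_comp[OF e(2)] endA[OF e(1)] by (simp add: verts_def)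
    moreover have "endB G e \<in> loose_vertices G b" using loose_B_iff endB e by blast
    moreover have "adjacent G (endA G e) (endB G e)" using e by (auto simp: adjacent_def ends_def)
    ultimately show ?l using e(2) endB[OF e(1)] unfolding hooked_up_by_def inactive_next_to_def by blast
  qed
qed

lemma consistent_iff:
  "consistent G b C \<longleftrightarrow> \<not> hooked_up_by G b A C \<and> \<not> hooked_up_by G b B C"
  using loose_verts
  unfolding consistent_def hooked_up_by_def loose_comp_def inactive_next_to_def by blast

text \<open>A vertex of \<open>A\<close> tied to \<open>s\<close> and a vertex of \<open>B\<close>
  tied to \<open>t\<close> in one component would tie \<open>s\<close> to \<open>t\<close>, against
  maximality. If an inactive vertex is involved, it forms the whole component; it has no room to be
  loose and cannot lie in both classes.\<close>

lemma hooked_up_exclusive: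
  assumes v: "v \<in> verts G"
  shows "\<not> (hooked_up_by G b A (flex_comp v) \<and> hooked_up_by G b B (flex_comp v))"
proof
  assume "hooked_up_by G b A (flex_comp v) \<and> hooked_up_by G b B (flex_comp v)"
  then consider
      u w where "u \<in> A" "(u, s) \<in> scc" "u \<in> flex_comp v" "w \<in> B" "(w, t) \<in> scc" "w \<in> flex_comp v"
    | u e where "u \<in> A" "u \<in> flex_comp v" "e \<in> edges G" "b (endA G e) = 0" "endA G e \<in> flex_comp v" "(u, s) \<in> scc"
    | u e where "u \<in> B" "u \<in> flex_comp v" "e \<in> edges G" "b (endB G e) = 0" "endB G e \<in> flex_comp v" "(u, t) \<in> scc"
    | e e' where "e \<in> edges G" "e' \<in> edges G" "b (endA G e) = 0" "endA G e \<in> flex_comp v" "endB G e' \<in> flex_comp v"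
    unfolding hooked_up_by_A[OF v] hooked_up_by_B[OF v] by blast
  then show False
  proof cases
    case 1
    then have "(u, w) \<in> scc" using flex_comp_scc scc_sym scc_trans by blast
    then show ?thesis using 1 not_scc_st scc_sym scc_trans by blast
  next
    case 2
    then have "flex_comp v = {endA G e}"
      using flex_comp_eq[of "endA G e" v] inactive_flex_comp[of "endA G e"] endA by (simp add: verts_def)
    then have "u = endA G e" using 2 by blast
    moreover have "u \<in> loose_vertices G b" using 2 loose_A_iff by blast
    ultimately show ?thesis using 2 by (auto simp: loose_vertices_def)
  next
    case 3
    then have "flex_comp v = {endB G e}"
      using flex_comp_eq[of "endB G e" v] inactive_flex_comp[of "endB G e"] endB by (simp add: verts_def)
    then have "u = endB G e" using 3 by blast
    moreover have "u \<in> loose_vertices G b" using 3 loose_B_iff by blast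
    ultimately show ?thesis using 3 by (auto simp: loose_vertices_def)
  next
    case 4
    then have "flex_comp v = {endA G e}"
      using flex_comp_eq[of "endA G e" v] inactive_flex_comp[of "endA G e"] endA by (simp add: verts_def)
    then show ?thesis using 4 endA[of e] endB[of e'] disj by auto
  qed
qed

text \<open>Arcs inside a component do not change the order, so every edge may contribute an arc.\<close>

lemma le_A_arcs:
  "rtrancl_within (flex_comps G b)
    ((\<lambda>e. if e \<in> M then (flex_comp (endA G e), flex_comp (endB G e))
          else (flex_comp (endB G e), flex_comp (endA G e))) ` edges G) = le_A G b"
proof -
  let ?R = "(\<lambda>e. if e \<in> M then (flex_comp (endA G e), flex_comp (endB G e))
      else (flex_comp (endB G e), flex_comp (endA G e))) ` edges G"
  have comps: "flex_comp (endA G e) \<in> flex_comps G b" "flex_comp (endB G e) \<in> flex_comps G b"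
    if "e \<in> edges G" for e using endA[OF that] endB[OF that] by (auto simp: flex_comps_def verts_def)
  have rep: "C = flex_comp x" if "C \<in> flex_comps G b" "x \<in> C" for C x
    using that flex_comp_eq by (auto simp: flex_comps_def)
  have "?R \<subseteq> prec_A G b"
  proof
    fix p assume "p \<in> ?R"
    then obtain e where e: "e \<in> edges G"
      "p = (if e \<in> M then (flex_comp (endA G e), flex_comp (endB G e))
          else (flex_comp (endB G e), flex_comp (endA G e)))" by blast
    show "p \<in> prec_A G b"
    proof (cases "flexible G b e")
      case True
      then have "flex_comp (endA G e) = flex_comp (endB G e)"
        unfolding flex_comp_iff by (auto simp: flex_adj_def ends_def)
      then show ?thesis using e comps[OF e(1)] by (simp add: prec_A_def)
    next
      case False
      have in_comp: "endA G e \<in> flex_comp (endA G e)" "endB G e \<in> flex_comp (endB G e)" by auto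
      show ?thesis
      proof (cases "e \<in> M")
        case True
        then have "inevitable G b e" using False inevitable_iff by blast
        then have "(flex_comp (endA G e), flex_comp (endB G e)) \<in> prec_A G b"
          using comps[OF e(1)] in_comp unfolding prec_A_def by blast
        then show ?thesis using e(2) True by simp
      next
        case nM: False
        then have "forbidden G b e" using False forbidden_iff e(1) by blast
        then have "(flex_comp (endB G e), flex_comp (endA G e)) \<in> prec_A G b"
          using comps[OF e(1)] in_comp unfolding prec_A_def by blast
        then show ?thesis using e(2) nM by simp
      qed
    qed
  qed
  moreover have "prec_A G b \<subseteq> ?R\<^sup>*"
  proof
    fix p assume "p \<in> prec_A G b"
    then obtain C1 C2 where p: "p = (C1, C2)" "C1 \<in> flex_comps G b" "C2 \<in> flex_comps G b"
      and "C1 = C2 \<or> (\<exists>e. inevitable G b e \<and> endA G e \<in> C1 \<and> endB G e \<in> C2) \<or>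
        (\<exists>e. forbidden G b e \<and> endA G e \<in> C2 \<and> endB G e \<in> C1)"
      unfolding prec_A_def by blast
    then consider "C1 = C2"
      | e where "inevitable G b e" "endA G e \<in> C1" "endB G e \<in> C2"
      | e where "forbidden G b e" "endA G e \<in> C2" "endB G e \<in> C1" by blast
    then show "p \<in> ?R\<^sup>*"
    proof cases
      case 1 then show ?thesis using p(1) by simp
    next
      case 2
      then have e: "e \<in> M" "e \<in> edges G" using inevitable_iff M_edges by auto
      have "p = (flex_comp (endA G e), flex_comp (endB G e))"
        using rep[OF p(2) 2(2)] rep[OF p(3) 2(3)] p(1) by simp
      then show ?thesis by (intro r_into_rtrancl image_eqI[OF _ e(2)]) (simp add: e(1))
    next
      case 3
      then have e: "e \<notin> M" "e \<in> edges G" using forbidden_iff by auto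
      have "p = (flex_comp (endB G e), flex_comp (endA G e))"
        using rep[OF p(3) 3(2)] rep[OF p(2) 3(3)] p(1) by simp
      then show ?thesis by (intro r_into_rtrancl image_eqI[OF _ e(2)]) (simp add: e(1))
    qed
  qed
  ultimately have "(prec_A G b)\<^sup>* = ?R\<^sup>*" by (rule rtrancl_subset)
  then show ?thesis by (simp add: le_A_def rtrancl_within_def)
qed

text \<open>Grouping the arcs by edge and by vertex mirrors the two loops that append them to the
  arc list.\<close>

lemma dgraph_eq:
  "dgraph = (\<lambda>e. if e \<in> M then (endB G e, endA G e) else (endA G e, endB G e)) ` edges G \<union>
    (\<Union>v\<in>verts G. if v \<in> A then insert (v, s) (if mdegree G M v < b v then {(s, v)} else {})
      else insert (t, v) (if mdegree G M v < b v then {(v, t)} else {}))"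
  (is "_ = ?E \<union> ?V")
proof -
  have "dgraph = (\<lambda>e. (arc_tail (Edge e), arc_head (Edge e))) ` edges G \<union>
    ((\<lambda>v. (arc_tail (Free v), arc_head (Free v))) ` verts G \<union>
     (\<lambda>v. (arc_tail (Slack v), arc_head (Slack v))) ` {v \<in> verts G. mdegree G M v < b v})"
    unfolding dgraph_def arc_rel_def arcs_def by (simp add: image_Un image_image Un_assoc)
  moreover have "(\<lambda>e. (arc_tail (Edge e), arc_head (Edge e))) ` edges G = ?E"
    by (rule image_cong) (auto simp: arc_tail_def arc_head_def)
  moreover have "(\<lambda>v. (arc_tail (Free v), arc_head (Free v))) ` verts G \<union>
     (\<lambda>v. (arc_tail (Slack v), arc_head (Slack v))) ` {v \<in> verts G. mdegree G M v < b v} = ?V"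
    by (auto simp: arc_tail_def arc_head_def image_iff split: if_splits)
  ultimately show ?thesis by simp
qed

text \<open>The exact range makes every block nonempty, and nonempty blocks with different numbers
  are distinct; this gives injectivity.\<close>

lemma labelling_blocks:
  fixes cp :: "'v \<Rightarrow> nat"
  assumes comp: "\<forall>u\<in>verts G. \<forall>v\<in>verts G. cp u = cp v \<longleftrightarrow> (u, v) \<in> (flex_adj G b)\<^sup>*"
    and range: "cp ` verts G = {..<k}"
  defines "blk \<equiv> \<lambda>i. {v \<in> verts G. cp v = i}"
  shows "v \<in> verts G \<Longrightarrow> blk (cp v) = flex_comp v"
    and "bij_betw blk {..<k} (flex_comps G b)"
    and "i < k \<Longrightarrow> \<exists>v\<in>verts G. cp v = i \<and> blk i = flex_comp v"
proof -
  show blk: "blk (cp v) = flex_comp v" if "v \<in> verts G" for v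
  proof -
    have "u \<in> blk (cp v) \<longleftrightarrow> u \<in> flex_comp v" for u
      using comp that flex_comp_verts[OF _ that, of u] flex_reach_sym by (auto simp: blk_def)
    then show ?thesis by blast
  qed
  show ex: "\<exists>v\<in>verts G. cp v = i \<and> blk i = flex_comp v" if "i < k" for i
    using that range blk by (metis imageE lessThan_iff)
  have "inj_on blk {..<k}"
  proof (rule inj_onI)
    fix i j assume ij: "i \<in> {..<k}" "j \<in> {..<k}" "blk i = blk j"
    then obtain v where "v \<in> verts G" "cp v = i" using ex by blast
    then have "v \<in> blk j" using ij by (auto simp: blk_def)
    then show "i = j" using \<open>cp v = i\<close> by (simp add: blk_def)
  qed
  moreover have "blk ` {..<k} = flex_comps G b"
    unfolding range[symmetric] flex_comps_def image_image using blk by (intro image_cong) auto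
  ultimately show "bij_betw blk {..<k} (flex_comps G b)" by (simp add: bij_betw_def)
qed

end

section \<open>Depth-first search\<close>

text \<open>Arcs have positive numbers and \<open>nx e\<close> is the next smaller arc with the same
  source, 0 if there is none. A list is thus traversed with decreasing numbers, and
  \<open>hd u < e\<close> can express that arc \<open>e\<close> at \<open>u\<close> has been
  scanned.\<close>

locale adjacency_lists =
  fixes N K :: nat and src dst nx ord :: "nat \<Rightarrow> nat"
  assumes src: "e \<in> {1..K} \<Longrightarrow> src e < N" and dst: "e \<in> {1..K} \<Longrightarrow> dst e < N"
    and nx_less: "e \<in> {1..K} \<Longrightarrow> nx e < e"
    and nx_src: "e \<in> {1..K} \<Longrightarrow> nx e \<noteq> 0 \<Longrightarrow> src (nx e) = src e"
    and nx_gap: "e \<in> {1..K} \<Longrightarrow> nx e < e' \<Longrightarrow> e' < e \<Longrightarrow> src e' \<noteq> src e"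
    and ord: "ord ` {..<N} = {..<N}"
begin

definition E :: "(nat \<times> nat) set" where
  "E = arc_rel src dst {1..K}"

lemma E_less: "(u, v) \<in> E \<Longrightarrow> u < N \<and> v < N"
  using src dst by (auto simp: E_def arc_rel_def)

lemma reach_less: "(u, v) \<in> E\<^sup>* \<Longrightarrow> u < N \<Longrightarrow> v < N"
  by (induction rule: rtrancl_induct) (auto dest: E_less)

end

text \<open>
  A state of a depth-first search: \<open>stk\<close> holds the current path, \<open>post\<close> the finished vertices in
  order of finishing, and \<open>hd u\<close> the next arc to be scanned at \<open>u\<close>. The roots are taken from
  \<open>ord\<close> with decreasing index, and \<open>lab\<close> is the number of the search tree (0 if unvisited).
\<close>

locale dfs_state = adjacency_lists +
  fixes i sp k cnt :: nat and lab post stk hd :: "nat \<Rightarrow> nat"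
  assumes i: "i \<le> N"
    and stk: "j < sp \<Longrightarrow> stk j < N" and post: "j < k \<Longrightarrow> post j < N"
    and vis: "v < N \<Longrightarrow> lab v \<noteq> 0 \<longleftrightarrow> v \<in> stk ` {..<sp} \<union> post ` {..<k}"
    and stk_inj: "inj_on stk {..<sp}" and post_inj: "inj_on post {..<k}"
    and stk_post: "stk ` {..<sp} \<inter> post ` {..<k} = {}"
    and path: "Suc j < sp \<Longrightarrow> (stk j, stk (Suc j)) \<in> E"
    and stk_lab: "j < sp \<Longrightarrow> lab (stk j) = cnt"
    and hd: "u < N \<Longrightarrow> hd u \<le> K \<and> (hd u \<noteq> 0 \<longrightarrow> src (hd u) = u)"
    and scanned: "e \<in> {1..K} \<Longrightarrow> hd (src e) < e \<Longrightarrow>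
      lab (src e) \<noteq> 0 \<and> lab (dst e) \<noteq> 0 \<and> lab (dst e) \<le> lab (src e)"
    and post_hd: "j < k \<Longrightarrow> hd (post j) = 0"
    and finish: "j < k \<Longrightarrow> (post j, v) \<in> E\<^sup>* \<Longrightarrow> v \<notin> post ` {..j} \<Longrightarrow>
      \<exists>g. (g, post j) \<in> E\<^sup>* \<and> (post j, g) \<in> E\<^sup>* \<and> g \<notin> post ` {..j}"
    and lab_cnt: "v < N \<Longrightarrow> lab v \<le> cnt"
    and lab_surj: "c \<in> {1..cnt} \<Longrightarrow> \<exists>v<N. lab v = c"
    and ord_lab: "i \<le> i' \<Longrightarrow> i' < N \<Longrightarrow> lab (ord i') \<noteq> 0"
    and root: "v < N \<Longrightarrow> lab v \<noteq> 0 \<Longrightarrow> \<exists>i'. i \<le> i' \<and> i' < N \<and> lab (ord i') = lab v \<and>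
      (ord i', v) \<in> E\<^sup>* \<and> (\<forall>i''. i' < i'' \<longrightarrow> i'' < N \<longrightarrow> lab (ord i'') < lab v)"
begin

section \<open>Steps of the depth-first search\<close>

lemma stack_reach: "j \<le> j' \<Longrightarrow> j' < sp \<Longrightarrow> (stk j, stk j') \<in> E\<^sup>*"
proof (induction j' rule: dec_induct)
  case (step l)
  then show ?case using path[of l] by (auto intro: rtrancl_into_rtrancl)
qed simp

text \<open>On a path from the finished \<open>u\<close> to an unfinished vertex, the first vertex
  outside the finished ones follows a vertex with all arcs scanned. It is therefore visited and lies
  on the stack. From there \<open>u\<close> is reachable, so it is strongly connected to
  \<open>u\<close> and finishes later, as \<open>finish\<close> demands.\<close>

lemma pop_step:
  assumes "0 < sp" "hd (stk (sp - 1)) = 0"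
  shows "dfs_state N K src dst nx ord i (sp - 1) (Suc k) cnt lab (post(k := stk (sp - 1))) stk hd"
proof -
  define u where "u = stk (sp - 1)"
  have u: "u < N" "u \<in> stk ` {..<sp}" using stk assms by (auto simp: u_def)
  then have u3: "u \<notin> post ` {..<k}" using stk_post by blast
  have sp: "{..<sp} = insert (sp - 1) {..<sp - 1}" using assms by auto
  have im: "stk ` {..<sp} = insert u (stk ` {..<sp - 1})" by (subst sp) (simp add: u_def)
  have nu: "u \<notin> stk ` {..<sp - 1}"
    using inj_onD[OF stk_inj, of "sp - 1"] assms(1) by (fastforce simp: u_def)
  have le: "(post(k := u)) ` {..j} = post ` {..j}" if "j < k" for j
    using that by (intro image_cong) auto
  have lt: "(post(k := u)) ` {..<k} = post ` {..<k}"
    by (intro image_cong) auto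
  have all: "(post(k := u)) ` {..<Suc k} = insert u (post ` {..<k})"
    by (simp only: lessThan_Suc image_insert fun_upd_same lt)
  have fin_u: "\<exists>g. (g, u) \<in> E\<^sup>* \<and> (u, g) \<in> E\<^sup>* \<and> g \<notin> insert u (post ` {..<k})"
    if v: "(u, v) \<in> E\<^sup>*" "v \<notin> insert u (post ` {..<k})" for v
    using v
  proof (induction rule: rtrancl_induct)
    case (step y z)
    show ?case
    proof (cases "y \<in> insert u (post ` {..<k})")
      case True
      then have y: "y < N" "hd y = 0" using u(1) post post_hd assms(2) by (auto simp: u_def)
      from step(2) obtain e where e: "e \<in> {1..K}" "src e = y" "dst e = z"
        by (auto simp: E_def arc_rel_def)
      then have "lab z \<noteq> 0" using scanned[of e] y by auto
      then have "z \<in> stk ` {..<sp}" using vis[of z] step E_less by auto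
      then obtain j where j: "j < sp" "z = stk j" by auto
      then have "(z, u) \<in> E\<^sup>*" using stack_reach[of j "sp - 1"] by (simp add: u_def)
      then show ?thesis using step by (auto intro: rtrancl_into_rtrancl)
    qed (use step in auto)
  qed simp
  show ?thesis unfolding u_def[symmetric]
  proof (unfold_locales, goal_cases)
    case (4 v) then show ?case using vis[of v] unfolding all im by auto
  next
    case 5 then show ?case using stk_inj by (rule inj_on_subset) auto
  next
    case 6 then show ?case using post_inj u3 lt by (auto simp: lessThan_Suc inj_on_def)
  next
    case 7 then show ?case using stk_post nu unfolding all im by auto
  next
    case (13 j v)
    show ?case
    proof (cases "j = k")
      case True
      have "(post(k := u)) ` {..j} = insert u (post ` {..<k})"
        using all by (simp only: True lessThan_Suc_atMost)
      moreover have "(post(k := u)) j = u" using True by simp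
      ultimately show ?thesis using 13 fin_u[of v] by (simp only: simp_thms)
    next
      case False
      then show ?thesis using 13 finish[of j v] le[of j] by auto
    qed
  next
    case (17 v) then show ?case by (rule root)
  qed (use assms i stk post u path stk_lab hd scanned post_hd lab_cnt lab_surj ord_lab in
        \<open>auto simp: less_Suc_eq u_def\<close>)
qed

text \<open>Stack vertices carry the largest tree number \<open>cnt\<close>, so the arc cannot lead
  to a later tree. By \<open>nx_gap\<close> it is the only arc that becomes scanned. The stack
  position is arbitrary because a newly found vertex is pushed, in the proof, before the list of its
  parent advances.\<close>

lemma scan_step:
  assumes "j < sp" "hd (stk j) \<noteq> 0" "lab (dst (hd (stk j))) \<noteq> 0"
  shows "dfs_state N K src dst nx ord i sp k cnt lab post stk
    (hd(stk j := nx (hd (stk j))))"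
proof -
  define u where "u = stk j"
  define e where "e = hd u"
  have u: "u < N" "lab u = cnt" using assms stk stk_lab by (auto simp: u_def)
  have e: "e \<in> {1..K}" "src e = u" "lab (dst e) \<noteq> 0"
    using hd[OF u(1)] assms by (auto simp: e_def u_def)
  have ne: "nx e \<noteq> 0 \<Longrightarrow> src (nx e) = u" "nx e < e" using nx_src[OF e(1)] nx_less[OF e(1)] e(2) by auto
  show ?thesis unfolding u_def[symmetric] e_def[symmetric]
  proof (unfold_locales, goal_cases)
    case (10 u')
    then show ?case using hd[of u'] ne e by (auto intro: order.trans[OF less_imp_le])
  next
    case (11 e')
    show ?case
    proof (cases "src e' = u \<and> e' \<le> e")
      case True
      then have "e' = e" using 11 nx_gap[OF e(1), of e'] e(2) by fastforce
      then show ?thesis using e u lab_cnt[of "dst e"] dst[OF e(1)] assms by (auto simp: u_def[symmetric])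
    next
      case False
      then show ?thesis using 11 scanned[of e'] by (auto simp: e_def split: if_splits)
    qed
  next
    case (12 l)
    then have "post l \<in> post ` {..<k}" "u \<in> stk ` {..<sp}" using assms by (auto simp: u_def)
    then have "post l \<noteq> u" using stk_post by auto
    then show ?case using 12 post_hd by simp
  next
    case (13 l v)
    then show ?case by (rule finish)
  next
    case (17 v)
    then show ?case by (rule root)
  qed (use i stk post vis stk_inj post_inj stk_post path stk_lab lab_cnt lab_surj ord_lab in auto)
qed

lemma cnt_pos: "0 < sp \<Longrightarrow> 0 < cnt"
  using stk_lab[of 0] vis[OF stk, of 0] by force

text \<open>Starting a tree and descending along an arc differ only in the tree number and the root
  index; the conditional hypothesis treats both at once.\<close>

lemma visit:
  assumes w: "w < N" "lab w = 0"
    and c: "if sp = 0 then c = Suc cnt \<and> i' < i \<and> i \<le> Suc i' \<and> w = ord i'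
      else c = cnt \<and> i' = i \<and> (stk (sp - 1), w) \<in> E"
  shows "dfs_state N K src dst nx ord i' (Suc sp) k c (lab(w := c)) post (stk(sp := w)) hd"
proof -
  have cnt: "c \<noteq> 0" "cnt \<le> c" "sp \<noteq> 0 \<Longrightarrow> c = cnt" "i' \<le> i"
    using c cnt_pos by (auto split: if_splits)
  have wn: "w \<notin> stk ` {..<sp}" "w \<notin> post ` {..<k}" using vis[of w] w by auto
  have lt: "(stk(sp := w)) ` {..<sp} = stk ` {..<sp}"
    by (intro image_cong) auto
  have all: "(stk(sp := w)) ` {..<Suc sp} = insert w (stk ` {..<sp})"
    by (simp only: lessThan_Suc image_insert fun_upd_same lt)
  have labv: "lab v \<noteq> 0 \<Longrightarrow> v \<noteq> w" for v using w by auto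
  have root': "\<exists>i''. i' \<le> i'' \<and> i'' < N \<and> (lab(w := c)) (ord i'') = (lab(w := c)) v \<and>
      (ord i'', v) \<in> E\<^sup>* \<and> (\<forall>l. i'' < l \<longrightarrow> l < N \<longrightarrow> (lab(w := c)) (ord l) < (lab(w := c)) v)"
    if v: "v < N" "lab v \<noteq> 0" for v
  proof -
    from root[OF v] obtain i'' where i'': "i \<le> i''" "i'' < N" "lab (ord i'') = lab v"
      "(ord i'', v) \<in> E\<^sup>*" "\<forall>l. i'' < l \<longrightarrow> l < N \<longrightarrow> lab (ord l) < lab v" by blast
    \<comment> \<open>Vertices at indices from \<open>i\<close> on have been visited, so none of
      them is \<open>w\<close> and their labels stay as they are.\<close>
    have "ord l \<noteq> w" if "i \<le> l" "l < N" for l using ord_lab[OF that] labv by auto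
    then show ?thesis using i'' cnt(4) labv[OF v(2)] v by (intro exI[of _ i'']) auto
  qed
  show ?thesis
  proof (unfold_locales, goal_cases)
    case 1 then show ?case using i cnt by simp
  next
    case (4 v) then show ?case using vis[of v] cnt unfolding all by auto
  next
    case 5 then show ?case using stk_inj wn(1) lt by (auto simp: lessThan_Suc inj_on_def)
  next
    case 7 then show ?case using stk_post wn unfolding all by auto
  next
    case (8 j)
    show ?case
    proof (cases "Suc j = sp")
      case True then show ?thesis using c by auto
    next
      case False then show ?thesis using 8 path[of j] by auto
    qed
  next
    case (9 j)
    then show ?case using stk_lab[of j] cnt(3) by (cases "j = sp") auto
  next
    case (11 e)
    then have "lab (src e) \<noteq> 0 \<and> lab (dst e) \<noteq> 0 \<and> lab (dst e) \<le> lab (src e)" by (rule scanned)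
    then show ?case using w cnt by auto
  next
    case (13 j v) then show ?case by (rule finish)
  next
    case (14 v) then show ?case using lab_cnt[of v] cnt by auto
  next
    case (15 l)
    show ?case
    proof (cases "l = c")
      case True then show ?thesis using w by auto
    next
      case False
      then have "l \<in> {1..cnt}" using 15 c by (auto split: if_splits)
      then obtain v where "v < N" "lab v = l" "l \<noteq> 0" using lab_surj by fastforce
      then show ?thesis using labv[of v] by (intro exI[of _ v]) auto
    qed
  next
    case (16 l)
    then have "l = i' \<and> w = ord i' \<or> i \<le> l" using c by (auto split: if_splits)
    then show ?case using ord_lab[of l] 16 cnt by auto
  next
    case (17 v)
    show ?case
    proof (cases "v = w")
      case False then show ?thesis using root'[of v] 17 by auto
    next
      case vw: True
      show ?thesis
      proof (cases "sp = 0")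
        case True
        \<comment> \<open>All earlier labels are at most \<open>cnt\<close>, hence below the number
          of the new tree; so its root has the largest index within that tree.\<close>
        have "lab (ord l) < c" if "i' < l" "l < N" for l
        proof -
          have "ord l < N" using ord that by auto
          then show ?thesis using lab_cnt c True by (auto simp: less_Suc_eq_le)
        qed
        moreover have "ord l \<noteq> w" if "i' < l" "l < N" for l
          using ord_lab[of l] that w c True by auto
        moreover have "i' < N" using i c True by auto
        ultimately show ?thesis using c True vw by (intro exI[of _ i']) auto
      next
        case False
        let ?u = "stk (sp - 1)"
        have u: "?u < N" "lab ?u = c" using False stk stk_lab cnt(3) by auto
        have ne: "?u \<noteq> w" using u cnt(1) labv by auto
        from root'[OF u(1)] u cnt ne obtain i'' where i'': "i' \<le> i''" "i'' < N"
            "(lab(w := c)) (ord i'') = c" "(ord i'', ?u) \<in> E\<^sup>*"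
            "\<forall>l. i'' < l \<longrightarrow> l < N \<longrightarrow> (lab(w := c)) (ord l) < c" by auto
        moreover have "(ord i'', w) \<in> E\<^sup>*"
          using i''(4) c False by (auto intro: rtrancl_into_rtrancl)
        ultimately show ?thesis using vw by (intro exI[of _ i'']) auto
      qed
    qed
  qed (use w stk post hd post_inj post_hd in \<open>auto simp: less_Suc_eq\<close>)
qed

lemma root_skip:
  assumes "0 < i" "lab (ord (i - 1)) \<noteq> 0"
  shows "dfs_state N K src dst nx ord (i - 1) sp k cnt lab post stk hd"
proof (unfold_locales, goal_cases)
  case (13 j v) then show ?case by (rule finish)
next
  case (16 i')
  then show ?case using ord_lab[of i'] assms by (cases "i' = i - 1") auto
next
  case (17 v)
  from root[OF 17] obtain i' where "i \<le> i'" "i' < N" "lab (ord i') = lab v"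
    "(ord i', v) \<in> E\<^sup>*" "\<forall>l. i' < l \<longrightarrow> l < N \<longrightarrow> lab (ord l) < lab v" by blast
  then show ?case by (intro exI[of _ i']) auto
qed (use i stk post vis stk_inj post_inj stk_post path stk_lab hd scanned post_hd lab_cnt lab_surj in auto)

text \<open>The unscanned arcs are those with \<open>e \<le> hd (src e)\<close>. The arc at the
  current list position leaves this set, which pays for the step in the time bound.\<close>

lemma scan_step_arcs:
  assumes "j < sp" "hd (stk j) \<noteq> 0"
  shows "card {e \<in> {1..K}. e \<le> (hd(stk j := nx (hd (stk j)))) (src e)}
    < card {e \<in> {1..K}. e \<le> hd (src e)}"
proof -
  define u where "u = stk j"
  have u: "u < N" using assms stk by (auto simp: u_def)
  have e: "hd u \<in> {1..K}" "src (hd u) = u" using hd[OF u] assms by (auto simp: u_def)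
  let ?hd' = "hd(u := nx (hd u))"
  have less: "nx (hd u) < hd u" using nx_less[OF e(1)] .
  then have "?hd' (src e') \<le> hd (src e')" for e' by simp
  then have "{e \<in> {1..K}. e \<le> ?hd' (src e)} \<subseteq> {e \<in> {1..K}. e \<le> hd (src e)}"
    using order.trans by blast
  moreover have "hd u \<notin> {e \<in> {1..K}. e \<le> ?hd' (src e)}" "hd u \<in> {e \<in> {1..K}. e \<le> hd (src e)}"
    using e less by (simp_all add: e(2))
  ultimately show ?thesis unfolding u_def[symmetric]
    by (intro psubset_card_mono) (simp, blast)
qed

lemma visit_unvisited:
  assumes "w < N" "lab w = 0" "c \<noteq> 0"
  shows "Suc (card {v. v < N \<and> (lab(w := c)) v = 0}) = card {v. v < N \<and> lab v = 0}"
proof -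
  have "{v. v < N \<and> (lab(w := c)) v = 0} = {v. v < N \<and> lab v = 0} - {w}" using assms by auto
  moreover have "finite {v. v < N \<and> lab v = 0}" by simp
  ultimately show ?thesis using assms by (simp only: card_Suc_Diff1 mem_Collect_eq simp_thms)
qed

end

text \<open>Kosaraju's algorithm takes \<open>post_order\<close> from its first search and
  \<open>lab_mono\<close> and \<open>tree_root\<close> from its second. By \<open>tree_root\<close>,
  the root of a tree sits at the last index of \<open>ord\<close> that carries the label of the
  tree.\<close>

locale dfs_result = adjacency_lists +
  fixes cnt :: nat and lab post :: "nat \<Rightarrow> nat"
  assumes post_perm: "bij_betw post {..<N} {..<N}"
    and post_order: "j < N \<Longrightarrow> (post j, v) \<in> E\<^sup>* \<Longrightarrow> v \<notin> post ` {..j} \<Longrightarrow>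
      \<exists>g. (g, post j) \<in> E\<^sup>* \<and> (post j, g) \<in> E\<^sup>* \<and> g \<notin> post ` {..j}"
    and lab_image: "lab ` {..<N} = {1..cnt}"
    and lab_mono: "(u, v) \<in> E \<Longrightarrow> lab v \<le> lab u"
    and tree_root: "v < N \<Longrightarrow> \<exists>i<N. lab (ord i) = lab v \<and> (ord i, v) \<in> E\<^sup>* \<and>
      (\<forall>i'. i < i' \<longrightarrow> i' < N \<longrightarrow> lab (ord i') < lab v)"
begin

section \<open>Search trees, components and strong components\<close>

lemma lab_mono_reach: "(u, v) \<in> E\<^sup>* \<Longrightarrow> lab v \<le> lab u"
  by (induction rule: rtrancl_induct) (auto dest: lab_mono)

text \<open>Vertices with equal labels share a root, since the root index is the last one with that
  label. By symmetry both are connected to it, and monotone labels give the converse.\<close>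

lemma symmetric_components:
  assumes "sym E" "u < N" "v < N"
  shows "lab u = lab v \<longleftrightarrow> (u, v) \<in> E\<^sup>*"
proof
  assume uv: "lab u = lab v"
  have sym: "sym (E\<^sup>*)" using assms(1) by (rule sym_rtrancl)
  obtain i j where i: "i < N" "lab (ord i) = lab u" "(ord i, u) \<in> E\<^sup>*"
      "\<forall>i'. i < i' \<longrightarrow> i' < N \<longrightarrow> lab (ord i') < lab u"
    and j: "j < N" "lab (ord j) = lab v" "(ord j, v) \<in> E\<^sup>*"
      "\<forall>i'. j < i' \<longrightarrow> i' < N \<longrightarrow> lab (ord i') < lab v"
    using tree_root[OF assms(2)] tree_root[OF assms(3)] by blast
  have "i = j" using i j uv by (metis less_irrefl linorder_neqE_nat)
  then show "(u, v) \<in> E\<^sup>*" using i(3) j(3) sym by (meson rtrancl_trans symD)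
next
  assume "(u, v) \<in> E\<^sup>*"
  moreover from this have "(v, u) \<in> E\<^sup>*" using sym_rtrancl[OF assms(1)] by (rule symD[rotated])
  ultimately show "lab u = lab v" using lab_mono_reach by (simp add: order.antisym)
qed

end

text \<open>With all root indices tried and \<open>ord\<close> onto, every vertex is visited; with
  an empty stack, every visited vertex is finished. Counting then gives
  \<open>k = N\<close>.\<close>

lemma (in dfs_state) dfs_done:
  assumes "sp = 0" "i = 0"
  shows "dfs_result N K src dst nx ord cnt lab post"
proof -
  have lab: "lab v \<noteq> 0" if "v < N" for v
  proof -
    have "v \<in> ord ` {..<N}" using that ord by simp
    then show ?thesis using ord_lab assms by auto
  qed
  have im: "post ` {..<k} = {..<N}" using vis lab post assms by auto
  then have "k = N" using card_image[OF post_inj] by simp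
  show ?thesis
  proof (unfold_locales, goal_cases)
    case 1 then show ?case using post_inj im \<open>k = N\<close> by (simp add: bij_betw_def)
  next
    case (2 j v) then show ?case using finish \<open>k = N\<close> by blast
  next
    case 3
    have "c \<in> lab ` {..<N}" if "c \<in> {1..cnt}" for c using lab_surj[OF that] by auto
    then show ?case using lab_cnt lab by (fastforce simp: Suc_le_eq)
  next
    case (4 u v)
    then obtain e where e: "e \<in> {1..K}" "src e = u" "dst e = v" by (auto simp: E_def arc_rel_def)
    have "u \<in> post ` {..<k}" using e src im by auto
    then have "hd u = 0" using post_hd by auto
    then show ?case using scanned[of e] e by auto
  next
    case (5 v) then show ?case using root[of v] lab[of v] by blast
  qed
qed

text \<open>
  Kosaraju's algorithm. The vertex of a strong component that finishes last in the first search
  finishes after everything reachable from the component, so it is the root of the second search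
  tree that contains the component, and everything in that tree can also be reached from it.
\<close>

lemma kosaraju:
  assumes "dfs_result N K src dst nx ord cnt lab post" "dfs_result N K dst src nx' post cnt' lab' post'"
    and u: "u < N" and v: "v < N"
  defines "R \<equiv> (arc_rel src dst {1..K})\<^sup>*"
  shows "lab' u = lab' v \<longleftrightarrow> (u, v) \<in> R \<and> (v, u) \<in> R"
proof -
  interpret d1: dfs_result N K src dst nx ord cnt lab post by fact
  interpret d2: dfs_result N K dst src nx' post cnt' lab' post' by fact
  have "d2.E = d1.E\<inverse>" by (auto simp: d1.E_def d2.E_def arc_rel_def)
  then have R2: "d2.E\<^sup>* = R\<inverse>" by (simp add: R_def d1.E_def rtrancl_converse)
  have R1: "d1.E\<^sup>* = R" by (simp add: R_def d1.E_def)
  have tr: "trans R" by (simp add: R_def trans_rtrancl)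
  have mono: "lab' x \<le> lab' y" if "(x, y) \<in> R" for x y using d2.lab_mono_reach[of y x] that R2 by simp
  have root: "\<exists>i<N. lab' (post i) = lab' x \<and> (x, post i) \<in> R \<and> (post i, x) \<in> R \<and>
      (\<forall>i'. i < i' \<longrightarrow> i' < N \<longrightarrow> lab' (post i') < lab' x)" if x: "x < N" for x
  proof -
    obtain i where i: "i < N" "lab' (post i) = lab' x" "(x, post i) \<in> R"
      "\<forall>i'. i < i' \<longrightarrow> i' < N \<longrightarrow> lab' (post i') < lab' x"
      using d2.tree_root[OF x] R2 by auto
    define J where "J = {j. j < N \<and> (x, post j) \<in> R \<and> (post j, x) \<in> R}"
    have "x \<in> post ` {..<N}" using x d1.post_perm by (simp add: bij_betw_def)
    then have "J \<noteq> {}" by (auto simp: J_def R_def)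
    moreover have "finite J" by (simp add: J_def)
    ultimately have mJ: "Max J \<in> J" and J_le: "\<And>j. j \<in> J \<Longrightarrow> j \<le> Max J" by auto
    define j where "j = Max J"
    have j: "j < N" "(x, post j) \<in> R" "(post j, x) \<in> R" using mJ by (auto simp: J_def j_def)
    have "lab' (post j) = lab' x" using mono j by (simp add: order.antisym)
    \<comment> \<open>All vertices of the strong component share the label of \<open>x\<close>, and
      \<open>i\<close> is the last index with that label.\<close>
    then have ji: "j \<le> i" using i(4) j(1) by (metis less_irrefl not_le)
    have "i \<le> j"
    proof (rule ccontr)
      assume ij: "\<not> i \<le> j"
      then have "post i \<notin> post ` {..j}"
        using inj_onD[OF bij_betw_imp_inj_on[OF d1.post_perm], of i] i(1) by fastforce
      moreover have "(post j, post i) \<in> R" using i(3) j(3) tr by (meson transD)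
      ultimately obtain g where g: "(g, post j) \<in> R" "(post j, g) \<in> R" "g \<notin> post ` {..j}"
        using d1.post_order[OF j(1)] R1 by blast
      have "g < N" using g(2) d1.reach_less[of "post j" g] R1 j(1) d1.post_perm
        by (auto simp: bij_betw_def)
      then have "g \<in> post ` {..<N}" using d1.post_perm by (simp add: bij_betw_def)
      then obtain l where l: "l < N" "g = post l" by auto
      then have "l \<in> J" using g j tr unfolding J_def by (blast dest: transD)
      then have "l \<le> j" using J_le j_def by auto
      then show False using l g by auto
    qed
    then have "i = j" using ji by simp
    then show ?thesis using i j by blast
  qed
  show ?thesis
  proof
    assume uv: "lab' u = lab' v"
    obtain i where i: "i < N" "lab' (post i) = lab' u" "(u, post i) \<in> R" "(post i, u) \<in> R"
      "\<forall>i'. i < i' \<longrightarrow> i' < N \<longrightarrow> lab' (post i') < lab' u" using root[OF u] by blast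
    obtain j where j: "j < N" "lab' (post j) = lab' v" "(v, post j) \<in> R" "(post j, v) \<in> R"
      "\<forall>i'. j < i' \<longrightarrow> i' < N \<longrightarrow> lab' (post i') < lab' v" using root[OF v] by blast
    have "i = j" using i j uv by (metis less_irrefl linorder_neqE_nat)
    then show "(u, v) \<in> R \<and> (v, u) \<in> R" using i j tr by (meson transD)
  next
    assume "(u, v) \<in> R \<and> (v, u) \<in> R"
    then show "lab' u = lab' v" using mono by (simp add: order.antisym)
  qed
qed

section \<open>Running time of structured programs\<close>

primrec loop_free :: "com \<Rightarrow> bool" where
  "loop_free Skip = True"
| "loop_free (SetReg x e) = True"
| "loop_free (SetCell a i e) = True"
| "loop_free (Seq c1 c2) = (loop_free c1 \<and> loop_free c2)"
| "loop_free (If p c1 c2) = (loop_free c1 \<and> loop_free c2)"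
| "loop_free (While p c) = False"

text \<open>Loop-free code is run as a function, so its effect can be computed by simplification.
  The clause for \<open>While\<close> is a filler value; the link to \<open>runs\<close> assumes
  \<open>loop_free\<close>.\<close>

primrec exec :: "com \<Rightarrow> state \<Rightarrow> state" where
  "exec Skip s = s"
| "exec (SetReg x e) s = set_reg x (aval e s) s"
| "exec (SetCell a i e) s = set_cell a (aval i s) (aval e s) s"
| "exec (Seq c1 c2) s = exec c2 (exec c1 s)"
| "exec (If p c1 c2) s = (if bval p s then exec c1 s else exec c2 s)"
| "exec (While p c) s = s"

primrec max_cost :: "com \<Rightarrow> nat" where
  "max_cost Skip = 1"
| "max_cost (SetReg x e) = acost e + 1"
| "max_cost (SetCell a i e) = acost i + acost e + 1"
| "max_cost (Seq c1 c2) = max_cost c1 + max_cost c2"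
| "max_cost (If p c1 c2) = bcost p + max (max_cost c1) (max_cost c2) + 1"
| "max_cost (While p c) = 0"

primrec written_regs :: "com \<Rightarrow> string set" where
  "written_regs Skip = {}"
| "written_regs (SetReg x e) = {x}"
| "written_regs (SetCell a i e) = {}"
| "written_regs (Seq c1 c2) = written_regs c1 \<union> written_regs c2"
| "written_regs (If p c1 c2) = written_regs c1 \<union> written_regs c2"
| "written_regs (While p c) = written_regs c"

primrec written_cells :: "com \<Rightarrow> string set" where
  "written_cells Skip = {}"
| "written_cells (SetReg x e) = {}"
| "written_cells (SetCell a i e) = {a}"
| "written_cells (Seq c1 c2) = written_cells c1 \<union> written_cells c2"
| "written_cells (If p c1 c2) = written_cells c1 \<union> written_cells c2"
| "written_cells (While p c) = written_cells c"

lemma state_simps [simp]: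
  "reg (set_reg x k s) = (reg s)(x := k)"
  "cell (set_reg x k s) = cell s"
  "reg (set_cell a i k s) = reg s"
  "cell (set_cell a i k s) = (cell s)(a := (cell s a)(i := k))"
  by (simp_all add: set_reg_def set_cell_def)

lemma exec_runs: "loop_free c \<Longrightarrow> \<exists>t\<le>max_cost c. runs c s t (exec c s)"
proof (induction c arbitrary: s)
  case (Seq c1 c2)
  then obtain t1 t2 where "t1 \<le> max_cost c1" "runs c1 s t1 (exec c1 s)"
    "t2 \<le> max_cost c2" "runs c2 (exec c1 s) t2 (exec c2 (exec c1 s))" by fastforce
  then show ?case by (auto intro!: exI[of _ "t1 + t2"] runs_Seq)
next
  case (If p c1 c2)
  then obtain t1 t2 where "t1 \<le> max_cost c1" "runs c1 s t1 (exec c1 s)"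
    "t2 \<le> max_cost c2" "runs c2 s t2 (exec c2 s)" by fastforce
  then show ?case
    using runs_IfTrue[of p s c1 t1 "exec c1 s" c2] runs_IfFalse[of p s c2 t2 "exec c2 s" c1]
    by (cases "bval p s") (auto simp: le_max_iff_disj intro: exI[of _ "Suc (bcost p + t1)"] exI[of _ "Suc (bcost p + t2)"])
qed (auto intro: runs.intros[simplified])

lemma runs_frame:
  "runs c s t s' \<Longrightarrow>
    (\<forall>x. x \<notin> written_regs c \<longrightarrow> reg s' x = reg s x) \<and>
    (\<forall>a. a \<notin> written_cells c \<longrightarrow> cell s' a = cell s a)"
  by (induction rule: runs.induct) auto

text \<open>A total-correctness triple with a time bound, tied to one start state so that the
  postcondition can mention initial values.\<close>

definition halts :: "com \<Rightarrow> state \<Rightarrow> nat \<Rightarrow> (state \<Rightarrow> bool) \<Rightarrow> bool" where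
  "halts c s T Q \<longleftrightarrow> (\<exists>t s'. runs c s t s' \<and> t \<le> T \<and> Q s')"

lemma halts_mono:
  "halts c s T Q \<Longrightarrow> T \<le> T' \<Longrightarrow> (\<And>s'. Q s' \<Longrightarrow> Q' s') \<Longrightarrow> halts c s T' Q'"
  unfolding halts_def using order.trans by blast

lemma halts_exec: "loop_free c \<Longrightarrow> Q (exec c s) \<Longrightarrow> max_cost c \<le> T \<Longrightarrow> halts c s T Q"
  unfolding halts_def using exec_runs order.trans by blast

lemma halts_Seq:
  "halts c1 s T1 Q1 \<Longrightarrow> (\<And>s'. Q1 s' \<Longrightarrow> halts c2 s' T2 Q) \<Longrightarrow> T1 + T2 \<le> T \<Longrightarrow> halts (Seq c1 c2) s T Q"
  unfolding halts_def by (meson add_mono order.trans runs_Seq)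

lemma halts_frame:
  "halts c s T Q \<Longrightarrow> halts c s T (\<lambda>s'. Q s' \<and>
    (\<forall>x. x \<notin> written_regs c \<longrightarrow> reg s' x = reg s x) \<and>
    (\<forall>a. a \<notin> written_cells c \<longrightarrow> cell s' a = cell s a))"
  unfolding halts_def using runs_frame by blast

text \<open>A loop-free body has a uniform cost bound, so the potential \<open>\<mu>\<close> counts
  iterations; the additional 1 pays for the final test.\<close>

lemma halts_While:
  assumes c: "loop_free c" and I: "I s"
    and step: "\<And>s. I s \<Longrightarrow> bval p s \<Longrightarrow> I (exec c s) \<and> \<mu> (exec c s) < \<mu> s"
  shows "halts (While p c) s ((bcost p + max_cost c + 1) * (\<mu> s + 1)) (\<lambda>s'. I s' \<and> \<not> bval p s')"
  using I
proof (induction "\<mu> s" arbitrary: s rule: less_induct)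
  case less
  let ?C = "bcost p + max_cost c + 1"
  show ?case
  proof (cases "bval p s")
    case True
    obtain t where t: "t \<le> max_cost c" "runs c s t (exec c s)" using exec_runs[OF c] by blast
    from step[OF less.prems True] have I': "I (exec c s)" and m: "\<mu> (exec c s) < \<mu> s" by auto
    from less.hyps[OF m I'] obtain t' s' where
      s': "runs (While p c) (exec c s) t' s'" "t' \<le> ?C * (\<mu> (exec c s) + 1)" "I s'" "\<not> bval p s'"
      unfolding halts_def by auto
    have "?C * (\<mu> (exec c s) + 1) \<le> ?C * \<mu> s" using m by (intro mult_le_mono2) simp
    then have "bcost p + t + t' + 1 \<le> ?C * (\<mu> s + 1)"
      using t(1) s'(2) by (simp add: algebra_simps)
    then show ?thesis unfolding halts_def using runs_WhileTrue[OF True t(2) s'(1)] s' by blast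
  next
    case False
    then show ?thesis unfolding halts_def using runs_WhileFalse[OF False] less.prems by fastforce
  qed
qed

definition For :: "string \<Rightarrow> string \<Rightarrow> com \<Rightarrow> com" where
  "For x r c = Seq (SetReg x (Const 0)) (While (Less (Reg x) (Reg r)) (Seq c (SetReg x (Succ (Reg x)))))"

lemma written_For [simp]:
  "written_regs (For x r c) = insert x (written_regs c)"
  "written_cells (For x r c) = written_cells c"
  by (auto simp: For_def)

lemma exec_reg: "x \<notin> written_regs c \<Longrightarrow> reg (exec c s) x = reg s x"
  and exec_cell: "a \<notin> written_cells c \<Longrightarrow> cell (exec c s) a = cell s a"
  by (induction c arbitrary: s) auto

text \<open>The body writes no register, so the loop bound is stable and the invariant speaks of
  arrays only. The constant 9 consists of 4 for the test and loop step, 3 for the increment and 2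
  for the initial assignment.\<close>

lemma halts_For:
  assumes c: "loop_free c" "written_regs c = {}" and xr: "x \<noteq> r"
    and init: "I 0 (cell s)"
    and step: "\<And>i s'. i < reg s r \<Longrightarrow> I i (cell s') \<Longrightarrow> reg s' = (reg s)(x := i) \<Longrightarrow>
      (\<And>a. a \<notin> written_cells c \<Longrightarrow> cell s' a = cell s a) \<Longrightarrow> I (Suc i) (cell (exec c s'))"
    and T: "(max_cost c + 9) * (reg s r + 1) \<le> T"
  shows "halts (For x r c) s T (\<lambda>s'. I (reg s r) (cell s') \<and> reg s' = (reg s)(x := reg s r) \<and>
    (\<forall>a. a \<notin> written_cells c \<longrightarrow> cell s' a = cell s a))"
  unfolding For_def
proof (rule halts_Seq[where ?T1.0 = 2 and ?T2.0 = "T - 2"])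
  let ?L = "reg s r"
  let ?J = "\<lambda>i c'. I i c' \<and> (\<forall>a. a \<notin> written_cells c \<longrightarrow> c' a = cell s a)"
  let ?I = "\<lambda>s'. \<exists>i\<le>?L. ?J i (cell s') \<and> reg s' = (reg s)(x := i)"
  show "halts (SetReg x (Const 0)) s 2 (\<lambda>s'. ?J 0 (cell s') \<and> reg s' = (reg s)(x := 0))"
    by (rule halts_exec) (use init in auto)
  show "2 + (T - 2) \<le> T" using T by auto
  fix s1 :: state assume s1: "?J 0 (cell s1) \<and> reg s1 = (reg s)(x := 0)"
  have reg: "reg (exec c s') = reg s'" for s' using exec_reg c(2) by auto
  let ?p = "Less (Reg x) (Reg r)" and ?d = "Seq c (SetReg x (Succ (Reg x)))"
  have I1: "?I s1" using s1 by auto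
  have step': "?I (exec ?d s') \<and> ?L - reg (exec ?d s') x < ?L - reg s' x"
    if s': "?I s'" "bval ?p s'" for s'
  proof -
    obtain i where i: "i \<le> ?L" "?J i (cell s')" "reg s' = (reg s)(x := i)" using s'(1) by blast
    moreover have "i < ?L" using s'(2) i(3) xr by auto
    ultimately show ?thesis using step[of i s'] reg[of s'] exec_cell[of _ c s']
      by (auto intro!: exI[of _ "Suc i"])
  qed
  have "halts (While ?p ?d) s1 ((bcost ?p + max_cost ?d + 1) * (?L - reg s1 x + 1))
      (\<lambda>s'. ?I s' \<and> \<not> bval ?p s')"
    by (rule halts_While[where I = ?I and \<mu> = "\<lambda>s'. ?L - reg s' x"], use c in simp, fact I1, fact step')
  then show "halts (While ?p ?d) s1 (T - 2) (\<lambda>s'. I ?L (cell s') \<and> reg s' = (reg s)(x := ?L) \<and>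
    (\<forall>a. a \<notin> written_cells c \<longrightarrow> cell s' a = cell s a))"
  proof (rule halts_mono)
    have "(max_cost c + 7) * (?L + 1) + 2 \<le> (max_cost c + 9) * (?L + 1)"
      by (simp add: algebra_simps)
    then show "(bcost ?p + max_cost ?d + 1) * (?L - reg s1 x + 1) \<le> T - 2"
      using T s1 by (simp add: numeral_eq_Suc)
  next
    fix s' assume s': "?I s' \<and> \<not> bval ?p s'"
    then obtain i where i: "i \<le> ?L" "?J i (cell s')" "reg s' = (reg s)(x := i)" by blast
    moreover have "i = ?L" using s' i xr by auto
    ultimately show "I ?L (cell s') \<and> reg s' = (reg s)(x := ?L) \<and>
      (\<forall>a. a \<notin> written_cells c \<longrightarrow> cell s' a = cell s a)" by simp
  qed
qed

section \<open>The search program\<close>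

text \<open>Each arc is put in front of the list of its source, which yields decreasing numbers. The
  counter starts at 0 and arcs at 1, hence \<open>Succ\<close>. The prefix \<open>p\<close> gives
  each search fresh arrays.\<close>

definition link :: "char \<Rightarrow> string \<Rightarrow> string \<Rightarrow> com" where
  "link p src rK = For ''e'' rK
    (Seq (SetCell (p # ''nx'') (Succ (Reg ''e'')) (Cell (p # ''hd'') (Cell src (Succ (Reg ''e'')))))
         (SetCell (p # ''hd'') (Cell src (Succ (Reg ''e''))) (Succ (Reg ''e''))))"

definition linked :: "nat \<Rightarrow> (nat \<Rightarrow> nat) \<Rightarrow> (nat \<Rightarrow> nat) \<Rightarrow> (nat \<Rightarrow> nat) \<Rightarrow> bool" where
  "linked K src head nx \<longleftrightarrow>
     (\<forall>u. head u \<le> K \<and> (head u \<noteq> 0 \<longrightarrow> src (head u) = u)) \<and>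
     (\<forall>e\<in>{1..K}. e \<le> head (src e) \<and> nx e < e \<and> (nx e \<noteq> 0 \<longrightarrow> src (nx e) = src e) \<and>
       (\<forall>e'. nx e < e' \<and> e' < e \<longrightarrow> src e' \<noteq> src e))"

text \<open>The former first arc becomes the successor of the new one. It is the largest earlier arc
  with that source, so no arc is skipped.\<close>

lemma linked_Suc:
  assumes "linked K src head nx"
  shows "linked (Suc K) src (head(src (Suc K) := Suc K)) (nx(Suc K := head (src (Suc K))))"
proof -
  let ?e = "Suc K" let ?u = "src ?e"
  have h: "head u \<le> K" "head u \<noteq> 0 \<Longrightarrow> src (head u) = u" for u using assms by (auto simp: linked_def)
  have n: "e \<le> head (src e)" "nx e < e" "nx e \<noteq> 0 \<Longrightarrow> src (nx e) = src e"
     "nx e < e' \<Longrightarrow> e' < e \<Longrightarrow> src e' \<noteq> src e" if "e \<in> {1..K}" for e e'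
    using assms that by (auto simp: linked_def)
  have gap: "src e' \<noteq> ?u" if "head ?u < e'" "e' < ?e" for e'
    using n(1)[of e'] that by auto
  show ?thesis unfolding linked_def
  proof (intro conjI ballI allI)
    fix u show "(head(?u := ?e)) u \<le> ?e" using h(1)[of u] by simp
    show "(head(?u := ?e)) u \<noteq> 0 \<longrightarrow> src ((head(?u := ?e)) u) = u" using h(2)[of u] by simp
  next
    fix e assume e: "e \<in> {1..?e}"
    then have c: "e = ?e \<or> e \<in> {1..K} \<and> e \<noteq> ?e" by auto
    show "e \<le> (head(?u := ?e)) (src e)" using c n(1)[of e] by auto
    show "(nx(?e := head ?u)) e < e" using c n(2)[of e] h(1)[of ?u] by auto
    show "(nx(?e := head ?u)) e \<noteq> 0 \<longrightarrow> src ((nx(?e := head ?u)) e) = src e"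
      using c n(3)[of e] h(2)[of ?u] by auto
    show "(nx(?e := head ?u)) e < e' \<and> e' < e \<longrightarrow> src e' \<noteq> src e" for e'
      using c n(4)[of e e'] gap[of e'] by auto
  qed
qed

text \<open>The body costs 13, to which the loop rule adds 9.\<close>

lemma link_halts:
  assumes "src \<noteq> p # ''hd''" "src \<noteq> p # ''nx''" "rK \<noteq> ''e''" "cell s (p # ''hd'') = (\<lambda>_. 0)"
  shows "halts (link p src rK) s (22 * (reg s rK + 1))
    (\<lambda>s'. linked (reg s rK) (cell s src) (cell s' (p # ''hd'')) (cell s' (p # ''nx'')))"
  unfolding link_def
proof (rule halts_mono[OF halts_For[where T = "22 * (reg s rK + 1)" and
    I = "\<lambda>i c. linked i (cell s src) (c (p # ''hd'')) (c (p # ''nx''))"]], goal_cases)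
  case (5 i s')
  then show ?case using assms linked_Suc[of i "cell s src"] by (simp add: fun_upd_def)
qed (use assms in \<open>auto simp: linked_def\<close>)

section \<open>The search as a single loop\<close>

definition visit :: "char \<Rightarrow> com" where
  "visit p = Seq (SetCell (p # ''lab'') (Reg ''w'') (Reg ''cnt''))
    (Seq (SetCell (p # ''stk'') (Reg ''sp'') (Reg ''w''))
     (SetReg ''sp'' (Succ (Reg ''sp''))))"

text \<open>One iteration pops a vertex, scans one arc or tries one root index. This flattens the
  nested traversal of vertices and their lists.\<close>

definition dfs_body :: "char \<Rightarrow> string \<Rightarrow> string \<Rightarrow> com" where
  "dfs_body p dst ord =
    If (Less (Const 0) (Reg ''sp''))
     (Seq (SetReg ''u'' (Cell (p # ''stk'') (Pred (Reg ''sp''))))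
     (Seq (SetReg ''e'' (Cell (p # ''hd'') (Reg ''u'')))
      (If (Equal (Reg ''e'') (Const 0))
        (Seq (SetCell (p # ''post'') (Reg ''k'') (Reg ''u''))
        (Seq (SetReg ''k'' (Succ (Reg ''k''))) (SetReg ''sp'' (Pred (Reg ''sp'')))))
        (Seq (SetCell (p # ''hd'') (Reg ''u'') (Cell (p # ''nx'') (Reg ''e'')))
        (Seq (SetReg ''w'' (Cell dst (Reg ''e'')))
         (If (Equal (Cell (p # ''lab'') (Reg ''w'')) (Const 0)) (visit p) Skip))))))
     (Seq (SetReg ''i'' (Pred (Reg ''i'')))
     (Seq (SetReg ''w'' (Cell ord (Reg ''i'')))
      (If (Equal (Cell (p # ''lab'') (Reg ''w'')) (Const 0))
        (Seq (SetReg ''cnt'' (Succ (Reg ''cnt''))) (visit p)) Skip)))"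

definition dfs :: "char \<Rightarrow> string \<Rightarrow> string \<Rightarrow> string \<Rightarrow> com" where
  "dfs p dst ord rN =
    Seq (Seq (SetReg ''i'' (Reg rN)) (Seq (SetReg ''sp'' (Const 0))
      (Seq (SetReg ''k'' (Const 0)) (SetReg ''cnt'' (Const 0)))))
    (While (Not (And (Equal (Reg ''sp'') (Const 0)) (Equal (Reg ''i'') (Const 0)))) (dfs_body p dst ord))"

context
  fixes N K :: nat and src dst nx ord :: "nat \<Rightarrow> nat" and p :: char and adst aord :: string
  assumes names: "\<And>x. x \<in> {''hd'', ''lab'', ''post'', ''stk''} \<Longrightarrow> adst \<noteq> p # x \<and> aord \<noteq> p # x"
begin

abbreviation dfs_inv :: "state \<Rightarrow> bool" where
  "dfs_inv s \<equiv> cell s adst = dst \<and> cell s (p # ''nx'') = nx \<and> cell s aord = ord \<and>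
    dfs_state N K src dst nx ord (reg s ''i'') (reg s ''sp'') (reg s ''k'') (reg s ''cnt'')
      (cell s (p # ''lab'')) (cell s (p # ''post'')) (cell s (p # ''stk'')) (cell s (p # ''hd''))"

text \<open>A visit releases two units, one of which reappears as a stack entry and is spent when
  the vertex is popped.\<close>

definition dfs_potential :: "state \<Rightarrow> nat" where
  "dfs_potential s = reg s ''i'' + 2 * card {v. v < N \<and> cell s (p # ''lab'') v = 0} + reg s ''sp''
    + card {e \<in> {1..K}. e \<le> cell s (p # ''hd'') (src e)}"

lemma dfs_body_step:
  assumes I: "dfs_inv s" and c: "\<not> (reg s ''sp'' = 0 \<and> reg s ''i'' = 0)"
  defines "s' \<equiv> exec (dfs_body p adst aord) s"
  shows "dfs_inv s' \<and> dfs_potential s' < dfs_potential s"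
proof -
  let ?i = "reg s ''i''" and ?sp = "reg s ''sp''" and ?k = "reg s ''k''" and ?cnt = "reg s ''cnt''"
  let ?lab = "cell s (p # ''lab'')" and ?post = "cell s (p # ''post'')"
  let ?stk = "cell s (p # ''stk'')" and ?hd = "cell s (p # ''hd'')"
  interpret d: dfs_state N K src dst nx ord ?i ?sp ?k ?cnt ?lab ?post ?stk ?hd using I by blast
  have a: "cell s adst = dst" "cell s (p # ''nx'') = nx" "cell s aord = ord" using I by auto
  have nm: "adst \<noteq> p # ''hd''" "adst \<noteq> p # ''lab''" "adst \<noteq> p # ''post''" "adst \<noteq> p # ''stk''"
    "aord \<noteq> p # ''hd''" "aord \<noteq> p # ''lab''" "aord \<noteq> p # ''post''" "aord \<noteq> p # ''stk''"
    using names by auto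
  let ?u = "?stk (?sp - 1)"
  let ?e = "?hd ?u"
  consider (pop) "0 < ?sp" "?e = 0" | (scan) "0 < ?sp" "?e \<noteq> 0" "?lab (dst ?e) \<noteq> 0"
    | (new) "0 < ?sp" "?e \<noteq> 0" "?lab (dst ?e) = 0"
    | (skip) "?sp = 0" "0 < ?i" "?lab (ord (?i - 1)) \<noteq> 0"
    | (root) "?sp = 0" "0 < ?i" "?lab (ord (?i - 1)) = 0" using c by blast
  then show ?thesis
  proof cases
    case pop
    then show ?thesis using d.pop_step[OF pop] a nm
      by (simp add: s'_def dfs_body_def dfs_potential_def)
  next
    case scan
    then show ?thesis using d.scan_step[of "?sp - 1"] d.scan_step_arcs[of "?sp - 1"] a nm
      by (simp add: s'_def dfs_body_def dfs_potential_def)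
  next
    case new
    have u: "?u < N" using d.stk new by simp
    have e: "?e \<in> {1..K}" "src ?e = ?u" using d.hd[OF u] new by auto
    have w: "dst ?e < N" using d.dst[OF e(1)] .
    have uw: "(?u, dst ?e) \<in> d.E" unfolding d.E_def arc_rel_def
      by (rule image_eqI[OF _ e(1)], subst e(2), rule refl)
    \<comment> \<open>The program advances the list before the visit. The proof reverses the order,
      since an arc may count as scanned only when its target is visited; the resulting states
      agree.\<close>
    interpret v: dfs_state N K src dst nx ord ?i "Suc ?sp" ?k ?cnt "?lab(dst ?e := ?cnt)" ?post
        "?stk(?sp := dst ?e)" ?hd
      by (rule d.visit) (use w uw new in auto)
    have "?sp - 1 \<noteq> ?sp" using new by simp
    then have top: "(?stk(?sp := dst ?e)) (?sp - 1) = ?u" by simp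
    have "dfs_state N K src dst nx ord ?i (Suc ?sp) ?k ?cnt (?lab(dst ?e := ?cnt)) ?post
        (?stk(?sp := dst ?e)) (?hd(?u := nx ?e))"
      by (rule v.scan_step[of "?sp - 1", unfolded top]) (use new d.cnt_pos in auto)
    then show ?thesis using new d.scan_step_arcs[of "?sp - 1"]
        d.visit_unvisited[of "dst ?e" ?cnt] d.cnt_pos w a nm
      by (simp add: s'_def dfs_body_def visit_def dfs_potential_def)
  next
    case skip
    then show ?thesis using d.root_skip a nm
      by (simp add: s'_def dfs_body_def dfs_potential_def)
  next
    case root
    have "ord (?i - 1) \<in> ord ` {..<N}" using root d.i by auto
    then have w: "ord (?i - 1) < N" using d.ord by auto
    have "dfs_state N K src dst nx ord (?i - 1) (Suc ?sp) ?k (Suc ?cnt) (?lab(ord (?i - 1) := Suc ?cnt))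
      ?post (?stk(?sp := ord (?i - 1))) ?hd"
      by (rule d.visit) (use w root in auto)
    then show ?thesis using root d.visit_unvisited[of "ord (?i - 1)" "Suc ?cnt"] w a nm
      by (simp add: s'_def dfs_body_def visit_def dfs_potential_def)
  qed
qed

text \<open>The initial potential is at most \<open>3 * N + K\<close>, an iteration costs at most
  100, and the initial assignments at most 10.\<close>

lemma dfs_halts:
  assumes a: "adjacency_lists N K src dst nx ord"
    and s: "cell s adst = dst" "cell s (p # ''nx'') = nx" "cell s aord = ord" "reg s rN = N"
    and hd: "linked K src (cell s (p # ''hd'')) nx" and lab: "cell s (p # ''lab'') = (\<lambda>_. 0)"
  shows "halts (dfs p adst aord rN) s (1000 * (N + K + 1))
    (\<lambda>s'. dfs_result N K src dst nx ord (reg s' ''cnt'') (cell s' (p # ''lab'')) (cell s' (p # ''post'')))"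
  unfolding dfs_def
proof (rule halts_Seq[where ?T1.0 = 10 and ?Q1.0 = "\<lambda>s'. dfs_inv s' \<and> dfs_potential s' \<le> 3 * N + K"])
  interpret adjacency_lists N K src dst nx ord by fact
  \<comment> \<open>The contents of \<open>post\<close> and \<open>stk\<close> are arbitrary: the
    invariant looks only at entries below \<open>k\<close> and \<open>sp\<close>, both 0.\<close>
  have d: "dfs_state N K src dst nx ord N 0 0 0 (\<lambda>_. 0) post stk (cell s (p # ''hd''))" for post stk
  proof (unfold_locales, goal_cases)
    case (10 u)
    then show ?case using hd by (simp add: linked_def)
  next
    case (11 e)
    then have "e \<le> cell s (p # ''hd'') (src e)" using hd by (simp add: linked_def)
    then show ?case using 11 by simp
  qed simp_all
  have "card {e \<in> {1..K}. e \<le> cell s (p # ''hd'') (src e)} \<le> card {1..K}" by (intro card_mono) auto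
  then show "halts (Seq (SetReg ''i'' (Reg rN)) (Seq (SetReg ''sp'' (Const 0))
      (Seq (SetReg ''k'' (Const 0)) (SetReg ''cnt'' (Const 0))))) s 10
      (\<lambda>s'. dfs_inv s' \<and> dfs_potential s' \<le> 3 * N + K)"
    by (intro halts_exec) (use s lab d in \<open>auto simp: dfs_potential_def\<close>)
  fix s1 :: state assume s1: "dfs_inv s1 \<and> dfs_potential s1 \<le> 3 * N + K"
  let ?p = "Not (And (Equal (Reg ''sp'') (Const 0)) (Equal (Reg ''i'') (Const 0)))"
  show "halts (While ?p (dfs_body p adst aord)) s1 (100 * (3 * N + K + 1))
    (\<lambda>s'. dfs_result N K src dst nx ord (reg s' ''cnt'') (cell s' (p # ''lab'')) (cell s' (p # ''post'')))"
  proof (rule halts_mono[OF halts_While[where I = dfs_inv and \<mu> = dfs_potential]], goal_cases)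
    case (3 s')
    then show ?case using dfs_body_step by simp
  next
    case 4
    have "bcost ?p + max_cost (dfs_body p adst aord) + 1 \<le> 100"
      by (simp add: dfs_body_def visit_def)
    then show ?case using s1 by (intro mult_le_mono) auto
  next
    case (5 s')
    then show ?case by (auto intro: dfs_state.dfs_done)
  qed (use s1 in \<open>auto simp: dfs_body_def visit_def\<close>)
qed auto

end

definition search :: "char \<Rightarrow> string \<Rightarrow> string \<Rightarrow> string \<Rightarrow> string \<Rightarrow> string \<Rightarrow> com" where
  "search p src dst ord rN rK = Seq (link p src rK) (dfs p dst ord rN)"

lemma written_search:
  "written_regs (search p src dst ord rN rK) \<subseteq> {''i'', ''sp'', ''k'', ''cnt'', ''u'', ''e'', ''w''}"
  "written_cells (search p src dst ord rN rK) \<subseteq>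
    {p # ''hd'', p # ''nx'', p # ''lab'', p # ''post'', p # ''stk''}"
  by (simp_all add: search_def link_def dfs_def dfs_body_def visit_def)

text \<open>The constant 1022 is 22 for linking the lists plus 1000 for the search.\<close>

lemma search_halts:
  assumes names: "\<And>a. a \<in> {asrc, adst, aord} \<Longrightarrow> a \<notin> {p # ''hd'', p # ''nx'', p # ''lab'', p # ''post'', p # ''stk''}"
    "rN \<noteq> ''e''" "rK \<noteq> ''e''"
    and zero: "cell s (p # ''hd'') = (\<lambda>_. 0)" "cell s (p # ''lab'') = (\<lambda>_. 0)"
    and arcs: "\<And>e. e \<in> {1..reg s rK} \<Longrightarrow> cell s asrc e < reg s rN \<and> cell s adst e < reg s rN"
    and ord: "cell s aord ` {..<reg s rN} = {..<reg s rN}"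
  shows "halts (search p asrc adst aord rN rK) s (1022 * (reg s rN + reg s rK + 1))
    (\<lambda>s'. \<exists>nx. dfs_result (reg s rN) (reg s rK) (cell s asrc) (cell s adst) nx (cell s aord)
      (reg s' ''cnt'') (cell s' (p # ''lab'')) (cell s' (p # ''post'')))"
  unfolding search_def
proof (rule halts_Seq)
  have asrc: "asrc \<notin> {p # ''hd'', p # ''nx'', p # ''lab'', p # ''post'', p # ''stk''}"
    and adst: "adst \<notin> {p # ''hd'', p # ''nx'', p # ''lab'', p # ''post'', p # ''stk''}"
    and aord: "aord \<notin> {p # ''hd'', p # ''nx'', p # ''lab'', p # ''post'', p # ''stk''}"
    using names(1) by blast+
  show "halts (link p asrc rK) s (22 * (reg s rK + 1)) (\<lambda>s'.
    linked (reg s rK) (cell s asrc) (cell s' (p # ''hd'')) (cell s' (p # ''nx'')) \<and>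
    (\<forall>x. x \<notin> written_regs (link p asrc rK) \<longrightarrow> reg s' x = reg s x) \<and>
    (\<forall>a. a \<notin> written_cells (link p asrc rK) \<longrightarrow> cell s' a = cell s a))"
    by (rule halts_frame[OF link_halts]) (use asrc names(2,3) zero in auto)
  fix s1 :: state assume s1: "linked (reg s rK) (cell s asrc) (cell s1 (p # ''hd'')) (cell s1 (p # ''nx'')) \<and>
    (\<forall>x. x \<notin> written_regs (link p asrc rK) \<longrightarrow> reg s1 x = reg s x) \<and>
    (\<forall>a. a \<notin> written_cells (link p asrc rK) \<longrightarrow> cell s1 a = cell s a)"
  then have l: "linked (reg s rK) (cell s asrc) (cell s1 (p # ''hd'')) (cell s1 (p # ''nx''))"
    and c: "cell s1 adst = cell s adst" "cell s1 aord = cell s aord"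
      "cell s1 (p # ''lab'') = (\<lambda>_. 0)" "reg s1 rN = reg s rN"
    using asrc adst aord names(2,3) zero by (auto simp: link_def)
  have "adjacency_lists (reg s rN) (reg s rK) (cell s asrc) (cell s adst) (cell s1 (p # ''nx'')) (cell s aord)"
    using l arcs ord by unfold_locales (auto simp: linked_def)
  then have "halts (dfs p adst aord rN) s1 (1000 * (reg s rN + reg s rK + 1))
     (\<lambda>s'. dfs_result (reg s rN) (reg s rK) (cell s asrc) (cell s adst) (cell s1 (p # ''nx'')) (cell s aord)
        (reg s' ''cnt'') (cell s' (p # ''lab'')) (cell s' (p # ''post'')))"
    by (intro dfs_halts) (use adst aord c l in auto)
  then show "halts (dfs p adst aord rN) s1 (1000 * (reg s rN + reg s rK + 1))
     (\<lambda>s'. \<exists>nx. dfs_result (reg s rN) (reg s rK) (cell s asrc) (cell s adst) nx (cell s aord)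
        (reg s' ''cnt'') (cell s' (p # ''lab'')) (cell s' (p # ''post'')))"
    by (rule halts_mono) auto
qed auto

section \<open>The decomposition program\<close>

lemma arc_rel_append:
  "arc_rel (f(Suc q := x)) (g(Suc q := y)) {Suc 0..Suc q} = insert (x, y) (arc_rel f g {Suc 0..q})"
proof -
  have "(\<lambda>a. ((f(Suc q := x)) a, (g(Suc q := y)) a)) ` {Suc 0..q} = (\<lambda>a. (f a, g a)) ` {Suc 0..q}"
    by (rule image_cong) auto
  moreover have "{Suc 0..Suc q} = insert (Suc q) {Suc 0..q}" by auto
  ultimately show ?thesis by (simp only: arc_rel_def image_insert fun_upd_same)
qed

text \<open>
  Bodies of \<open>For\<close> loops may not write registers, so the number of arcs added so far is kept in a
  cell. Arcs are numbered from 1, and 0 ends an adjacency list.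
\<close>

definition add_arc :: "char \<Rightarrow> aexp \<Rightarrow> aexp \<Rightarrow> com" where
  "add_arc p x y =
    Seq (SetCell (p # ''src'') (Succ (Cell (p # ''len'') (Const 0))) x)
    (Seq (SetCell (p # ''dst'') (Succ (Cell (p # ''len'') (Const 0))) y)
    (SetCell (p # ''len'') (Const 0) (Succ (Cell (p # ''len'') (Const 0)))))"

definition cell_arcs :: "char \<Rightarrow> (string \<Rightarrow> nat \<Rightarrow> nat) \<Rightarrow> (nat \<times> nat) set" where
  "cell_arcs p c = arc_rel (c (p # ''src'')) (c (p # ''dst'')) {1..c (p # ''len'') 0}"

definition incr_cell :: "string \<Rightarrow> aexp \<Rightarrow> com" where
  "incr_cell a i = SetCell a i (Succ (Cell a i))"

section \<open>Phases of the program\<close>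

definition edge_arcs :: com where
  "edge_arcs = For ''v'' ''m''
    (If (Equal (Cell ''M'' (Reg ''v'')) (Const 0))
      (add_arc (CHR ''1'') (Cell ''endA'' (Reg ''v'')) (Cell ''endB'' (Reg ''v'')))
      (Seq (add_arc (CHR ''1'') (Cell ''endB'' (Reg ''v'')) (Cell ''endA'' (Reg ''v'')))
      (Seq (incr_cell ''deg'' (Cell ''endA'' (Reg ''v''))) (incr_cell ''deg'' (Cell ''endB'' (Reg ''v''))))))"

definition vertex_arcs :: com where
  "vertex_arcs = For ''v'' ''n''
    (If (Equal (Cell ''colour'' (Reg ''v'')) (Const 0))
      (Seq (add_arc (CHR ''1'') (Reg ''v'') (Reg ''n''))
        (If (Less (Cell ''deg'' (Reg ''v'')) (Cell ''b'' (Reg ''v'')))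
          (add_arc (CHR ''1'') (Reg ''n'') (Reg ''v'')) Skip))
      (Seq (add_arc (CHR ''1'') (Succ (Reg ''n'')) (Reg ''v''))
        (If (Less (Cell ''deg'' (Reg ''v'')) (Cell ''b'' (Reg ''v'')))
          (add_arc (CHR ''1'') (Reg ''v'') (Succ (Reg ''n''))) Skip)))"

definition set_sizes :: com where
  "set_sizes = Seq (SetReg ''N'' (Succ (Succ (Reg ''n'')))) (SetReg ''K'' (Cell ''1len'' (Const 0)))"

definition set_ident :: com where
  "set_ident = For ''v'' ''N'' (SetCell ''id'' (Reg ''v'') (Reg ''v''))"

text \<open>The search follows arcs forwards only, so each flexible edge is entered in both
  directions; the trees are then connected components.\<close>

definition scc_arcs :: com where
  "scc_arcs = For ''v'' ''m''
    (If (Equal (Cell ''2lab'' (Cell ''endA'' (Reg ''v''))) (Cell ''2lab'' (Cell ''endB'' (Reg ''v''))))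
      (Seq (add_arc (CHR ''3'') (Cell ''endA'' (Reg ''v'')) (Cell ''endB'' (Reg ''v'')))
           (add_arc (CHR ''3'') (Cell ''endB'' (Reg ''v'')) (Cell ''endA'' (Reg ''v''))))
      Skip)"

text \<open>Tree numbers start at 1 because 0 marks unvisited vertices, whereas components are
  numbered from 0.\<close>

definition set_comp :: com where
  "set_comp = For ''v'' ''n'' (SetCell ''comp'' (Reg ''v'') (Pred (Cell ''3lab'' (Reg ''v''))))"

definition set_arcs :: com where
  "set_arcs = For ''v'' ''m''
    (If (Equal (Cell ''M'' (Reg ''v'')) (Const 0))
      (Seq (SetCell ''src'' (Reg ''v'') (Cell ''comp'' (Cell ''endB'' (Reg ''v''))))
           (SetCell ''tgt'' (Reg ''v'') (Cell ''comp'' (Cell ''endA'' (Reg ''v'')))))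
      (Seq (SetCell ''src'' (Reg ''v'') (Cell ''comp'' (Cell ''endA'' (Reg ''v''))))
           (SetCell ''tgt'' (Reg ''v'') (Cell ''comp'' (Cell ''endB'' (Reg ''v''))))))"

definition same_scc :: "aexp \<Rightarrow> aexp \<Rightarrow> bexp" where
  "same_scc x y = Equal (Cell ''2lab'' x) (Cell ''2lab'' y)"

definition class_vertex :: com where
  "class_vertex =
    (If (Equal (Cell ''colour'' (Reg ''v'')) (Const 0))
      (If (same_scc (Reg ''v'') (Reg ''n'')) (SetCell ''class'' (Cell ''comp'' (Reg ''v'')) (Const 1)) Skip)
      (If (same_scc (Reg ''v'') (Succ (Reg ''n''))) (SetCell ''class'' (Cell ''comp'' (Reg ''v'')) (Const 2)) Skip))"

definition class_vertices :: com where
  "class_vertices = For ''v'' ''n'' class_vertex"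

definition class_edge :: com where
  "class_edge =
    (Seq (If (And (Equal (Cell ''b'' (Cell ''endB'' (Reg ''v''))) (Const 0))
                  (same_scc (Cell ''endA'' (Reg ''v'')) (Reg ''n'')))
            (SetCell ''class'' (Cell ''comp'' (Cell ''endB'' (Reg ''v''))) (Const 1)) Skip)
         (If (And (Equal (Cell ''b'' (Cell ''endA'' (Reg ''v''))) (Const 0))
                  (same_scc (Cell ''endB'' (Reg ''v'')) (Succ (Reg ''n''))))
            (SetCell ''class'' (Cell ''comp'' (Cell ''endA'' (Reg ''v''))) (Const 2)) Skip))"

definition class_edges :: com where
  "class_edges = For ''v'' ''m'' class_edge"

text \<open>The second search swaps \<open>1src\<close> and \<open>1dst\<close> to traverse the
  reversed digraph. Root indices decrease, so the order \<open>1post\<close> starts it at the vertex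
  finished last.\<close>

definition decompose :: com where
  "decompose =
    Seq edge_arcs (Seq vertex_arcs (Seq (Seq set_sizes set_ident)
    (Seq (search (CHR ''1'') ''1src'' ''1dst'' ''id'' ''N'' ''K'')
    (Seq (search (CHR ''2'') ''1dst'' ''1src'' ''1post'' ''N'' ''K'')
    (Seq scc_arcs (Seq (SetReg ''K'' (Cell ''3len'' (Const 0)))
    (Seq (search (CHR ''3'') ''3src'' ''3dst'' ''id'' ''n'' ''K'')
    (Seq (Seq (SetReg ''comps'' (Reg ''cnt'')) (SetReg ''arcs'' (Reg ''m'')))
    (Seq set_comp (Seq set_arcs (Seq class_vertices class_edges)))))))))))"

lemma search_halts_frame:
  assumes "\<And>a. a \<in> {asrc, adst, aord} \<Longrightarrow> a \<notin> {p # ''hd'', p # ''nx'', p # ''lab'', p # ''post'', p # ''stk''}"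
    "rN \<noteq> ''e''" "rK \<noteq> ''e''"
    and "cell s (p # ''hd'') = (\<lambda>_. 0)" "cell s (p # ''lab'') = (\<lambda>_. 0)"
    and "\<And>e. e \<in> {1..reg s rK} \<Longrightarrow> cell s asrc e < reg s rN \<and> cell s adst e < reg s rN"
    and "cell s aord ` {..<reg s rN} = {..<reg s rN}"
  shows "halts (search p asrc adst aord rN rK) s (1022 * (reg s rN + reg s rK + 1))
    (\<lambda>s'. (\<exists>nx. dfs_result (reg s rN) (reg s rK) (cell s asrc) (cell s adst) nx (cell s aord)
        (reg s' ''cnt'') (cell s' (p # ''lab'')) (cell s' (p # ''post''))) \<and>
      (\<forall>x. x \<notin> {''i'', ''sp'', ''k'', ''cnt'', ''u'', ''e'', ''w''} \<longrightarrow> reg s' x = reg s x) \<and>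
      (\<forall>a. a \<notin> {p # ''hd'', p # ''nx'', p # ''lab'', p # ''post'', p # ''stk''} \<longrightarrow> cell s' a = cell s a))"
proof (rule halts_mono[OF halts_frame[OF search_halts]], goal_cases)
  case (1 a) then show ?case by (rule assms(1))
next
  case (6 e) then show ?case by (rule assms(6))
next
  case (9 s')
  then show ?case
    using subsetD[OF written_search(1), of _ p asrc adst aord rN rK]
      subsetD[OF written_search(2), of _ p asrc adst aord rN rK]
    by (intro conjI allI impI) (blast, metis, metis)
qed (fact assms order.refl)+

text \<open>The first predicate has priority, so writing 2 is sound only where it fails. This is
  where exclusivity of the two hooks enters the loops.\<close>

definition marked :: "(nat \<Rightarrow> nat) \<Rightarrow> (nat \<Rightarrow> bool) \<Rightarrow> (nat \<Rightarrow> bool) \<Rightarrow> bool" where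
  "marked c P Q \<longleftrightarrow> (\<forall>i. c i = (if P i then 1 else if Q i then 2 else 0))"

lemma marked_1: "marked c P Q \<Longrightarrow> marked (c(j := 1)) (\<lambda>i. P i \<or> i = j) Q"
  and marked_2: "marked c P Q \<Longrightarrow> \<not> P j \<Longrightarrow> marked (c(j := 2)) P (\<lambda>i. Q i \<or> i = j)"
  by (auto simp: marked_def)

text \<open>The nodes \<open>n\<close> and \<open>n + 1\<close> play the roles of \<open>s\<close> and \<open>t\<close>.\<close>

locale matching_input = maximum_b_matching G b M n "Suc n"
  for G :: "(nat, nat) bgraph" and b M n +
  fixes m :: nat
  assumes verts: "verts G = {..<n}" and edges: "edges G = {..<m}"
begin

section \<open>Building the auxiliary digraph\<close>

definition stores_input :: "state \<Rightarrow> bool" where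
  "stores_input s \<longleftrightarrow> reg s ''n'' = n \<and> reg s ''m'' = m \<and>
    cell s ''colour'' = array_of n (\<lambda>v. if v \<in> A then 0 else 1) \<and>
    cell s ''b'' = array_of n b \<and> cell s ''endA'' = array_of m (endA G) \<and>
    cell s ''endB'' = array_of m (endB G) \<and> cell s ''M'' = array_of m (\<lambda>e. if e \<in> M then 1 else 0)"

text \<open>Fresh arrays and counters must still be zero when a later phase starts; the set shrinks
  from phase to phase.\<close>

definition zero_cells :: "string set \<Rightarrow> state \<Rightarrow> bool" where
  "zero_cells X s \<longleftrightarrow> (\<forall>a\<in>X. cell s a = (\<lambda>_. 0))"

lemma endA_less: "e < m \<Longrightarrow> endA G e < n" and endB_less: "e < m \<Longrightarrow> endB G e < n"
  using endA endB verts edges by (auto simp: verts_def)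

definition arc_of :: "nat \<Rightarrow> nat \<times> nat" where
  "arc_of e = (if e \<in> M then (endB G e, endA G e) else (endA G e, endB G e))"

definition arcs_at :: "nat \<Rightarrow> (nat \<times> nat) set" where
  "arcs_at v = (if v \<in> A then insert (v, n) (if mdegree G M v < b v then {(n, v)} else {})
      else insert (Suc n, v) (if mdegree G M v < b v then {(v, Suc n)} else {}))"

lemma dgraph_eq': "dgraph = arc_of ` {..<m} \<union> (\<Union>v<n. arcs_at v)"
  unfolding dgraph_eq arc_of_def arcs_at_def verts edges ..

definition after_edge_arcs :: "state \<Rightarrow> bool" where
  "after_edge_arcs s \<longleftrightarrow> stores_input s \<and>
    zero_cells {''3len'', ''class'', ''1hd'', ''1lab'', ''2hd'', ''2lab'', ''3hd'', ''3lab''} s \<and>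
    cell_arcs (CHR ''1'') (cell s) = arc_of ` {..<m} \<and> cell s ''1len'' 0 = m \<and>
    (\<forall>v<n. cell s ''deg'' v = mdegree G M v)"

lemma mdegree_upto_Suc:
  "mdegree G (M \<inter> {..<Suc i}) v = mdegree G (M \<inter> {..<i}) v + of_bool (i \<in> M \<and> v \<in> ends G i)"
proof -
  have "{e \<in> M \<inter> {..<Suc i}. v \<in> ends G e} =
    (if i \<in> M \<and> v \<in> ends G i then insert i {e \<in> M \<inter> {..<i}. v \<in> ends G e} else {e \<in> M \<inter> {..<i}. v \<in> ends G e})"
    by (auto simp: less_Suc_eq)
  moreover have "finite {e \<in> M \<inter> {..<i}. v \<in> ends G e}" by simp
  ultimately show ?thesis by (simp add: mdegree_def)
qed

lemma edge_arcs_halts: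
  assumes s: "stores_input s"
    "zero_cells {''1len'', ''deg'', ''3len'', ''class'', ''1hd'', ''1lab'', ''2hd'', ''2lab'', ''3hd'', ''3lab''} s"
  shows "halts edge_arcs s (100 * (n + m + 1)) after_edge_arcs"
  unfolding edge_arcs_def
proof (rule halts_mono[OF halts_For[where T = "100 * (n + m + 1)" and
    I = "\<lambda>i c. cell_arcs (CHR ''1'') c = arc_of ` {..<i} \<and> c ''1len'' 0 = i \<and>
      c ''deg'' = mdegree G (M \<inter> {..<i})"]], goal_cases)
  case 4
  show ?case using s by (auto simp: cell_arcs_def arc_rel_def zero_cells_def mdegree_def)
next
  case (5 i s')
  have i: "i < m" using 5 s by (simp add: stores_input_def)
  \<comment> \<open>The two degree increments of one edge must hit different cells.\<close>
  have e: "endA G i \<noteq> endB G i" using endA[of i] endB[of i] i edges disj by auto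
  have "mdegree G (M \<inter> {..<Suc i}) = (mdegree G (M \<inter> {..<i}))(endA G i := Suc (mdegree G (M \<inter> {..<i}) (endA G i)),
      endB G i := Suc (mdegree G (M \<inter> {..<i}) (endB G i)))" if "i \<in> M"
    using that e by (auto simp: fun_eq_iff mdegree_upto_Suc ends_def)
  moreover have "mdegree G (M \<inter> {..<Suc i}) = mdegree G (M \<inter> {..<i})" if "i \<notin> M"
    using that by (auto simp: fun_eq_iff mdegree_upto_Suc)
  moreover have "arc_rel (cell s' ''1src'') (cell s' ''1dst'') {Suc 0..i} = arc_of ` {..<i}"
    using conjunct1[OF 5(2)] conjunct1[OF conjunct2[OF 5(2)]] by (simp add: cell_arcs_def)
  ultimately show ?case using 5(2,3) 5(4)[of "''endA''"] 5(4)[of "''endB''"] 5(4)[of "''M''"] s i e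
    by (simp add: add_arc_def incr_cell_def stores_input_def array_of_def cell_arcs_def arc_rel_append
        lessThan_Suc arc_of_def[of i])
next
  case 6
  then show ?case using s by (simp add: stores_input_def add_arc_def incr_cell_def)
next
  case (8 s')
  have "M \<inter> {..<m} = M" using M_edges edges by auto
  then show ?case using 8 s
    by (simp add: after_edge_arcs_def stores_input_def zero_cells_def add_arc_def incr_cell_def)
qed (use s in \<open>auto simp: add_arc_def incr_cell_def stores_input_def\<close>)


lemma dgraph_less: "(x, y) \<in> dgraph \<Longrightarrow> x < Suc (Suc n) \<and> y < Suc (Suc n)"
  using endA_less endB_less
  by (fastforce simp: dgraph_eq' arc_of_def arcs_at_def less_Suc_eq split: if_splits)

text \<open>Every vertex adds at most two arcs, which keeps the digraph linear in the size of the
  input.\<close>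

definition after_vertex_arcs :: "state \<Rightarrow> bool" where
  "after_vertex_arcs s \<longleftrightarrow> stores_input s \<and>
    zero_cells {''3len'', ''class'', ''1hd'', ''1lab'', ''2hd'', ''2lab'', ''3hd'', ''3lab''} s \<and>
    cell_arcs (CHR ''1'') (cell s) = dgraph \<and> cell s ''1len'' 0 \<le> m + 2 * n"

lemma vertex_arcs_halts:
  assumes s: "after_edge_arcs s"
  shows "halts vertex_arcs s (100 * (n + m + 1)) after_vertex_arcs"
  unfolding vertex_arcs_def
proof (rule halts_mono[OF halts_For[where T = "100 * (n + m + 1)" and
    I = "\<lambda>i c. cell_arcs (CHR ''1'') c = arc_of ` {..<m} \<union> (\<Union>v<i. arcs_at v) \<and>
      c ''1len'' 0 \<le> m + 2 * i"]], goal_cases)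
  case (5 i s')
  have i: "i < n" using 5 s by (simp add: after_edge_arcs_def stores_input_def)
  then show ?case using 5(2,3) 5(4)[of "''deg''"] 5(4)[of "''b''"] 5(4)[of "''colour''"] s
    by (simp add: add_arc_def after_edge_arcs_def stores_input_def array_of_def cell_arcs_def
        arc_rel_append lessThan_Suc arcs_at_def[of i] insert_commute)
next
  case 6
  then show ?case using s by (simp add: after_edge_arcs_def stores_input_def add_arc_def)
next
  case (8 s')
  then show ?case using s
    by (simp add: after_vertex_arcs_def after_edge_arcs_def stores_input_def zero_cells_def add_arc_def dgraph_eq')
qed (use s in \<open>auto simp: add_arc_def after_edge_arcs_def stores_input_def\<close>)

definition digraph_ready :: "state \<Rightarrow> bool" where
  "digraph_ready s \<longleftrightarrow> stores_input s \<and> arc_rel (cell s ''1src'') (cell s ''1dst'') {1..reg s ''K''} = dgraph \<and>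
    reg s ''K'' \<le> m + 2 * n \<and> reg s ''N'' = Suc (Suc n) \<and> (\<forall>v<Suc (Suc n). cell s ''id'' v = v)"

lemma digraph_ready_less:
  assumes "digraph_ready s" "e \<in> {1..reg s ''K''}"
  shows "cell s ''1src'' e < Suc (Suc n) \<and> cell s ''1dst'' e < Suc (Suc n)"
proof -
  have "(cell s ''1src'' e, cell s ''1dst'' e) \<in> dgraph"
    using assms by (auto simp: digraph_ready_def arc_rel_def)
  then show ?thesis by (rule dgraph_less)
qed

lemma set_ident_halts:
  assumes s: "after_vertex_arcs s"
  shows "halts (Seq set_sizes set_ident) s (100 * (n + m + 1)) (\<lambda>s'. digraph_ready s' \<and>
    zero_cells {''3len'', ''class'', ''1hd'', ''1lab'', ''2hd'', ''2lab'', ''3hd'', ''3lab''} s')"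
proof (rule halts_Seq[where ?T1.0 = 10 and ?T2.0 = "50 * (n + m + 1)"])
  let ?s = "exec set_sizes s"
  show "halts set_sizes s 10 (\<lambda>s'. s' = ?s)"
    by (rule halts_exec) (simp_all add: set_sizes_def)
  show "10 + 50 * (n + m + 1) \<le> 100 * (n + m + 1)" by simp
  fix s1 assume s1: "s1 = ?s"
  show "halts set_ident s1 (50 * (n + m + 1)) (\<lambda>s'. digraph_ready s' \<and>
    zero_cells {''3len'', ''class'', ''1hd'', ''1lab'', ''2hd'', ''2lab'', ''3hd'', ''3lab''} s')"
    unfolding set_ident_def
  proof (rule halts_mono[OF halts_For[where T = "50 * (n + m + 1)" and
      I = "\<lambda>i c. \<forall>v<i. c ''id'' v = v"]], goal_cases)
    case (8 s')
    then show ?case using s s1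
      by (simp add: set_sizes_def after_vertex_arcs_def stores_input_def zero_cells_def digraph_ready_def cell_arcs_def)
  qed (use s s1 in \<open>auto simp: set_sizes_def less_Suc_eq after_vertex_arcs_def stores_input_def\<close>)
qed

section \<open>Strong components and component numbers\<close>

definition after_search_1 :: "state \<Rightarrow> bool" where
  "after_search_1 s \<longleftrightarrow> digraph_ready s \<and>
    zero_cells {''3len'', ''class'', ''2hd'', ''2lab'', ''3hd'', ''3lab''} s \<and>
    (\<exists>nx cnt. dfs_result (Suc (Suc n)) (reg s ''K'') (cell s ''1src'') (cell s ''1dst'') nx (cell s ''id'')
      cnt (cell s ''1lab'') (cell s ''1post''))"

text \<open>With \<open>n + 2\<close> nodes and at most \<open>m + 2 * n\<close> arcs, the search
  takes at most \<open>1022 * (3 * n + m + 3)\<close> steps.\<close>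

lemma search_1_halts:
  assumes s: "digraph_ready s"
    "zero_cells {''3len'', ''class'', ''1hd'', ''1lab'', ''2hd'', ''2lab'', ''3hd'', ''3lab''} s"
  shows "halts (search (CHR ''1'') ''1src'' ''1dst'' ''id'' ''N'' ''K'') s (4000 * (n + m + 1)) after_search_1"
proof (rule halts_mono[OF search_halts_frame], goal_cases)
  case (6 e)
  then show ?case using digraph_ready_less[OF s(1)] s(1) by (simp add: digraph_ready_def)
next
  case 7
  have "cell s ''id'' ` {..<Suc (Suc n)} = (\<lambda>v. v) ` {..<Suc (Suc n)}"
    by (rule image_cong) (use s in \<open>auto simp: digraph_ready_def\<close>)
  then show ?case using s by (simp add: digraph_ready_def)
next
  case (9 s')
  then show ?case using s
    unfolding after_search_1_def
    by (auto simp: digraph_ready_def stores_input_def zero_cells_def)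
qed (use s in \<open>auto simp: zero_cells_def digraph_ready_def\<close>)

definition scc_labels :: "state \<Rightarrow> bool" where
  "scc_labels s \<longleftrightarrow> (\<forall>u<Suc (Suc n). \<forall>v<Suc (Suc n). cell s ''2lab'' u = cell s ''2lab'' v \<longleftrightarrow> (u, v) \<in> scc)"

definition after_search_2 :: "state \<Rightarrow> bool" where
  "after_search_2 s \<longleftrightarrow> stores_input s \<and> scc_labels s \<and>
    zero_cells {''3len'', ''class'', ''3hd'', ''3lab''} s \<and> (\<forall>v<n. cell s ''id'' v = v)"

lemma search_2_halts:
  assumes s: "after_search_1 s"
  shows "halts (search (CHR ''2'') ''1dst'' ''1src'' ''1post'' ''N'' ''K'') s (4000 * (n + m + 1)) after_search_2"
proof (rule halts_mono[OF search_halts_frame], goal_cases)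
  case (6 e)
  then show ?case using digraph_ready_less[of s] s by (simp add: after_search_1_def digraph_ready_def)
next
  case 7
  \<comment> \<open>The finishing order of the first search is a permutation of the nodes, hence an
    admissible order of roots.\<close>
  show ?case using s dfs_result.post_perm
    by (fastforce simp: after_search_1_def digraph_ready_def bij_betw_def)
next
  case (9 s')
  obtain nx cnt where d1: "dfs_result (Suc (Suc n)) (reg s ''K'') (cell s ''1src'') (cell s ''1dst'') nx
      (cell s ''id'') cnt (cell s ''1lab'') (cell s ''1post'')"
    using s by (auto simp: after_search_1_def)
  have N: "reg s ''N'' = Suc (Suc n)" and R: "arc_rel (cell s ''1src'') (cell s ''1dst'') {1..reg s ''K''} = dgraph"
    using s by (auto simp: after_search_1_def digraph_ready_def)
  from 9 N obtain nx' where d2: "dfs_result (Suc (Suc n)) (reg s ''K'') (cell s ''1dst'') (cell s ''1src'') nx'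
      (cell s ''1post'') (reg s' ''cnt'') (cell s' ''2lab'') (cell s' ''2post'')" by auto
  have "scc_labels s'"
    using kosaraju[OF d1 d2] unfolding R scc_labels_def scc_def by simp
  then show ?case using 9 s
    by (simp add: after_search_1_def after_search_2_def digraph_ready_def stores_input_def zero_cells_def)
qed (use s in \<open>auto simp: zero_cells_def after_search_1_def digraph_ready_def\<close>)

definition after_scc_arcs :: "state \<Rightarrow> bool" where
  "after_scc_arcs s \<longleftrightarrow> stores_input s \<and> scc_labels s \<and> zero_cells {''class'', ''3hd'', ''3lab''} s \<and>
    (\<forall>v<n. cell s ''id'' v = v) \<and> cell_arcs (CHR ''3'') (cell s) = flex_adj G b \<and> cell s ''3len'' 0 \<le> 2 * m"

lemma flex_adj_eq: "flex_adj G b = (\<Union>e<m. if (endA G e, endB G e) \<in> scc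
    then {(endA G e, endB G e), (endB G e, endA G e)} else {})"
  by (auto simp: flex_adj_iff edges split: if_splits)

lemma scc_arcs_halts:
  assumes s: "after_search_2 s"
  shows "halts scc_arcs s (100 * (n + m + 1)) after_scc_arcs"
  unfolding scc_arcs_def
proof (rule halts_mono[OF halts_For[where T = "100 * (n + m + 1)" and
    I = "\<lambda>i c. cell_arcs (CHR ''3'') c = (\<Union>e<i. if (endA G e, endB G e) \<in> scc
      then {(endA G e, endB G e), (endB G e, endA G e)} else {}) \<and> c ''3len'' 0 \<le> 2 * i"]], goal_cases)
  case 4
  show ?case using s by (simp add: cell_arcs_def arc_rel_def zero_cells_def after_search_2_def)
next
  case (5 i s')
  have i: "i < m" using 5 s by (simp add: after_search_2_def stores_input_def)
  have lab: "cell s ''2lab'' (endA G i) = cell s ''2lab'' (endB G i) \<longleftrightarrow> (endA G i, endB G i) \<in> scc"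
    using s endA_less[OF i] endB_less[OF i] by (simp add: after_search_2_def scc_labels_def)
  show ?case using 5(2,3) 5(4)[of "''endA''"] 5(4)[of "''endB''"] 5(4)[of "''2lab''"] s i lab
    by (simp add: add_arc_def after_search_2_def stores_input_def array_of_def cell_arcs_def
        arc_rel_append lessThan_Suc insert_commute)
next
  case 6
  then show ?case using s by (simp add: after_search_2_def stores_input_def add_arc_def)
next
  case (8 s')
  then show ?case using s
    by (simp add: after_scc_arcs_def after_search_2_def stores_input_def zero_cells_def add_arc_def
        flex_adj_eq scc_labels_def)
qed (use s in \<open>auto simp: add_arc_def after_search_2_def stores_input_def\<close>)

definition after_search_3 :: "state \<Rightarrow> bool" where
  "after_search_3 s \<longleftrightarrow> stores_input s \<and> scc_labels s \<and> zero_cells {''class''} s \<and>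
    cell s ''3lab'' ` {..<n} = {1..reg s ''cnt''} \<and>
    (\<forall>u<n. \<forall>v<n. cell s ''3lab'' u = cell s ''3lab'' v \<longleftrightarrow> (u, v) \<in> (flex_adj G b)\<^sup>*)"

lemma search_3_halts:
  assumes s: "after_scc_arcs s" and K: "reg s ''K'' = cell s ''3len'' 0"
  shows "halts (search (CHR ''3'') ''3src'' ''3dst'' ''id'' ''n'' ''K'') s (4000 * (n + m + 1)) after_search_3"
proof (rule halts_mono[OF search_halts_frame], goal_cases)
  case (6 e)
  then have "(cell s ''3src'' e, cell s ''3dst'' e) \<in> cell_arcs (CHR ''3'') (cell s)"
    using K by (auto simp: cell_arcs_def arc_rel_def)
  then have "(cell s ''3src'' e, cell s ''3dst'' e) \<in> flex_adj G b"
    using s by (simp add: after_scc_arcs_def)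
  then have "cell s ''3src'' e < n" "cell s ''3dst'' e < n"
    using endA_less endB_less by (auto simp: flex_adj_iff edges)
  then show ?case using s by (simp add: after_scc_arcs_def stores_input_def)
next
  case 7
  have "cell s ''id'' ` {..<n} = (\<lambda>v. v) ` {..<n}"
    by (rule image_cong) (use s in \<open>auto simp: after_scc_arcs_def\<close>)
  then show ?case using s by (simp add: after_scc_arcs_def stores_input_def)
next
  case (9 s')
  have n: "reg s ''n'' = n" and R: "arc_rel (cell s ''3src'') (cell s ''3dst'') {1..reg s ''K''} = flex_adj G b"
    using s K by (simp_all add: after_scc_arcs_def stores_input_def cell_arcs_def)
  from 9 n obtain nx where d: "dfs_result n (reg s ''K'') (cell s ''3src'') (cell s ''3dst'') nx
      (cell s ''id'') (reg s' ''cnt'') (cell s' ''3lab'') (cell s' ''3post'')" by auto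
  interpret d: dfs_result n "reg s ''K''" "cell s ''3src''" "cell s ''3dst''" nx
      "cell s ''id''" "reg s' ''cnt''" "cell s' ''3lab''" "cell s' ''3post''" by (fact d)
  have E: "d.E = flex_adj G b" using R by (simp add: d.E_def)
  have "\<forall>u<n. \<forall>v<n. cell s' ''3lab'' u = cell s' ''3lab'' v \<longleftrightarrow> (u, v) \<in> (flex_adj G b)\<^sup>*"
    using d.symmetric_components sym_flex_adj unfolding E by blast
  then show ?case using 9 s d.lab_image
    by (simp add: after_scc_arcs_def after_search_3_def scc_labels_def stores_input_def zero_cells_def)
next
  case 8
  then show ?case using s K by (simp add: after_scc_arcs_def stores_input_def)
qed (use s in \<open>auto simp: zero_cells_def after_scc_arcs_def\<close>)

definition comps_numbered :: "state \<Rightarrow> bool" where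
  "comps_numbered s \<longleftrightarrow> stores_input s \<and> scc_labels s \<and>
    cell s ''comp'' ` {..<n} = {..<reg s ''comps''} \<and> reg s ''arcs'' = m \<and>
    (\<forall>u<n. \<forall>v<n. cell s ''comp'' u = cell s ''comp'' v \<longleftrightarrow> (u, v) \<in> (flex_adj G b)\<^sup>*)"

lemma set_comp_halts:
  assumes s: "after_search_3 s" and r: "reg s ''comps'' = reg s ''cnt''" "reg s ''arcs'' = m"
  shows "halts set_comp s (100 * (n + m + 1)) (\<lambda>s'. comps_numbered s' \<and> zero_cells {''class''} s')"
  unfolding set_comp_def
proof (rule halts_mono[OF halts_For[where T = "100 * (n + m + 1)" and
    I = "\<lambda>i c. \<forall>v<i. c ''comp'' v = cell s ''3lab'' v - 1"]], goal_cases)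
  case (8 s')
  have n: "reg s ''n'' = n" using s by (simp add: after_search_3_def stores_input_def)
  have cp: "cell s' ''comp'' v = cell s ''3lab'' v - 1" if "v < n" for v using 8 that n by simp
  have lab: "cell s ''3lab'' ` {..<n} = {1..reg s ''cnt''}"
    and eq: "\<And>u v. u < n \<Longrightarrow> v < n \<Longrightarrow> cell s ''3lab'' u = cell s ''3lab'' v \<longleftrightarrow> (u, v) \<in> (flex_adj G b)\<^sup>*"
    using s by (simp_all add: after_search_3_def)
  have pos: "0 < cell s ''3lab'' v" if "v < n" for v
  proof -
    have "cell s ''3lab'' v \<in> {1..reg s ''cnt''}" unfolding lab[symmetric] using that by simp
    then show ?thesis by simp
  qed
  have "cell s' ''comp'' ` {..<n} = (\<lambda>l. l - 1) ` cell s ''3lab'' ` {..<n}"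
    unfolding image_image by (rule image_cong) (auto simp: cp)
  also have "\<dots> = {..<reg s ''cnt''}"
    unfolding lab by (force simp: image_iff intro: bexI[of _ "Suc _"])
  finally have im: "cell s' ''comp'' ` {..<n} = {..<reg s ''cnt''}" .
  have "cell s' ''comp'' u = cell s' ''comp'' v \<longleftrightarrow> (u, v) \<in> (flex_adj G b)\<^sup>*" if "u < n" "v < n" for u v
    using eq[OF that] pos[OF that(1)] pos[OF that(2)] cp[OF that(1)] cp[OF that(2)] by auto
  then show ?case using 8 s im r
    by (simp add: comps_numbered_def after_search_3_def scc_labels_def stores_input_def zero_cells_def)
qed (use s in \<open>auto simp: less_Suc_eq after_search_3_def stores_input_def\<close>)

section \<open>Order arcs and classes of the components\<close>

definition arcs_listed :: "state \<Rightarrow> bool" where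
  "arcs_listed s \<longleftrightarrow> (\<forall>e<m. (cell s ''src'' e, cell s ''tgt'' e) =
    (if e \<in> M then (cell s ''comp'' (endA G e), cell s ''comp'' (endB G e))
     else (cell s ''comp'' (endB G e), cell s ''comp'' (endA G e))))"

lemma set_arcs_halts:
  assumes s: "comps_numbered s" "zero_cells {''class''} s"
  shows "halts set_arcs s (100 * (n + m + 1))
    (\<lambda>s'. comps_numbered s' \<and> zero_cells {''class''} s' \<and> arcs_listed s')"
  unfolding set_arcs_def
proof (rule halts_mono[OF halts_For[where T = "100 * (n + m + 1)" and
    I = "\<lambda>i c. \<forall>e<i. (c ''src'' e, c ''tgt'' e) =
      (if e \<in> M then (cell s ''comp'' (endA G e), cell s ''comp'' (endB G e))
       else (cell s ''comp'' (endB G e), cell s ''comp'' (endA G e)))"]], goal_cases)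
  case (5 i s')
  have i: "i < m" using 5 s by (simp add: comps_numbered_def stores_input_def)
  show ?case using 5(2,3) 5(4)[of "''endA''"] 5(4)[of "''endB''"] 5(4)[of "''comp''"] 5(4)[of "''M''"] s i
    by (auto simp add: comps_numbered_def stores_input_def array_of_def less_Suc_eq)
next
  case (8 s')
  then show ?case using s
    by (simp add: comps_numbered_def scc_labels_def stores_input_def zero_cells_def arcs_listed_def)
qed (use s in \<open>auto simp: comps_numbered_def stores_input_def\<close>)

text \<open>The first alternative of the hook-up criterion, cut off after \<open>i\<close> vertices
  to serve as a loop invariant. The node \<open>x\<close> is \<open>n\<close> for
  \<open>W = A\<close> and \<open>Suc n\<close> for \<open>W = B\<close>.\<close>

definition vertex_hook :: "nat set \<Rightarrow> nat \<Rightarrow> (nat \<Rightarrow> nat) \<Rightarrow> nat \<Rightarrow> nat \<Rightarrow> bool" where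
  "vertex_hook W x cp i j \<longleftrightarrow> (\<exists>v<i. v \<in> W \<and> (v, x) \<in> scc \<and> cp v = j)"

text \<open>The second alternative, cut off after \<open>i\<close> edges: \<open>f\<close> selects
  the inactive end and \<open>g\<close> the loose one.\<close>

definition edge_hook :: "(nat \<Rightarrow> nat) \<Rightarrow> (nat \<Rightarrow> nat) \<Rightarrow> nat \<Rightarrow> (nat \<Rightarrow> nat) \<Rightarrow> nat \<Rightarrow> nat \<Rightarrow> bool" where
  "edge_hook f g x cp i j \<longleftrightarrow> (\<exists>e<i. b (f e) = 0 \<and> (g e, x) \<in> scc \<and> cp (f e) = j)"

lemma vertex_hook_Suc:
  "vertex_hook W x cp (Suc i) j \<longleftrightarrow> vertex_hook W x cp i j \<or> i \<in> W \<and> (i, x) \<in> scc \<and> j = cp i"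
  by (auto simp: vertex_hook_def less_Suc_eq)

lemma edge_hook_Suc:
  "edge_hook f g x cp (Suc i) j \<longleftrightarrow> edge_hook f g x cp i j \<or> b (f i) = 0 \<and> (g i, x) \<in> scc \<and> j = cp (f i)"
  by (auto simp: edge_hook_def less_Suc_eq)

lemma vertex_hook_mono: "vertex_hook W x cp i j \<Longrightarrow> i \<le> i' \<Longrightarrow> vertex_hook W x cp i' j"
  unfolding vertex_hook_def using order.strict_trans2 by blast

lemma edge_hook_mono: "edge_hook f g x cp i j \<Longrightarrow> i \<le> i' \<Longrightarrow> edge_hook f g x cp i' j"
  unfolding edge_hook_def using order.strict_trans2 by blast

lemma hooked_up_iff:
  assumes s: "comps_numbered s" and v: "v < n"
  defines "cp \<equiv> cell s ''comp''"
  shows "hooked_up_by G b A (flex_comp v) \<longleftrightarrow>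
      vertex_hook A n cp n (cp v) \<or> edge_hook (endB G) (endA G) n cp m (cp v)"
    and "hooked_up_by G b B (flex_comp v) \<longleftrightarrow>
      vertex_hook B (Suc n) cp n (cp v) \<or> edge_hook (endA G) (endB G) (Suc n) cp m (cp v)"
proof -
  have cp: "u \<in> flex_comp v \<longleftrightarrow> cp u = cp v" if "u < n" for u
    using s v that flex_reach_sym by (auto simp: comps_numbered_def cp_def)
  have AB: "u < n" if "u \<in> A \<or> u \<in> B" for u using that verts by (auto simp: verts_def)
  show "hooked_up_by G b A (flex_comp v) \<longleftrightarrow>
      vertex_hook A n cp n (cp v) \<or> edge_hook (endB G) (endA G) n cp m (cp v)"
    unfolding hooked_up_by_A[of v, unfolded verts lessThan_iff, OF v] vertex_hook_def edge_hook_def edges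
    using cp AB endA_less endB_less by (auto 4 4)
  show "hooked_up_by G b B (flex_comp v) \<longleftrightarrow>
      vertex_hook B (Suc n) cp n (cp v) \<or> edge_hook (endA G) (endB G) (Suc n) cp m (cp v)"
    unfolding hooked_up_by_B[of v, unfolded verts lessThan_iff, OF v] vertex_hook_def edge_hook_def edges
    using cp AB endA_less endB_less by (auto 4 4)
qed

text \<open>Partial hooks extend to complete ones, for which exclusivity is known. The cutoffs are
  independent because one mark may be considered a step ahead of the other.\<close>

lemma hooks_exclusive:
  assumes s: "comps_numbered s" and le: "i \<le> n" "i' \<le> n" "k \<le> m" "k' \<le> m"
  defines "cp \<equiv> cell s ''comp''"
  assumes hA: "vertex_hook A n cp i j \<or> edge_hook (endB G) (endA G) n cp k j"
    and hB: "vertex_hook B (Suc n) cp i' j \<or> edge_hook (endA G) (endB G) (Suc n) cp k' j"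
  shows False
proof -
  have hA': "vertex_hook A n cp n j \<or> edge_hook (endB G) (endA G) n cp m j"
    using hA le vertex_hook_mono edge_hook_mono by blast
  have hB': "vertex_hook B (Suc n) cp n j \<or> edge_hook (endA G) (endB G) (Suc n) cp m j"
    using hB le vertex_hook_mono edge_hook_mono by blast
  obtain v where v: "v < n" "cp v = j"
    using hA' endB_less unfolding vertex_hook_def edge_hook_def by blast
  show False
    using hA' hB' hooked_up_iff[OF s v(1)] hooked_up_exclusive[of v] v unfolding cp_def verts by simp
qed

lemma class_vertices_halts:
  assumes s: "comps_numbered s" "zero_cells {''class''} s" "arcs_listed s"
  defines "cp \<equiv> cell s ''comp''"
  shows "halts class_vertices s (100 * (n + m + 1)) (\<lambda>s'. comps_numbered s' \<and> arcs_listed s' \<and>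
    cell s' ''comp'' = cp \<and> marked (cell s' ''class'') (vertex_hook A n cp n) (vertex_hook B (Suc n) cp n))"
  unfolding class_vertices_def
proof (rule halts_mono[OF halts_For[where T = "100 * (n + m + 1)" and
    I = "\<lambda>i c. marked (c ''class'') (vertex_hook A n cp i) (vertex_hook B (Suc n) cp i)"]], goal_cases)
  case 4
  show ?case using s by (simp add: marked_def vertex_hook_def zero_cells_def)
next
  case (5 i s')
  have i: "i < n" using 5 s by (simp add: comps_numbered_def stores_input_def)
  have AB: "i \<in> B \<longleftrightarrow> i \<notin> A" using i verts disj by (auto simp: verts_def)
  have lab: "cell s ''2lab'' i = cell s ''2lab'' n \<longleftrightarrow> (i, n) \<in> scc"
    "cell s ''2lab'' i = cell s ''2lab'' (Suc n) \<longleftrightarrow> (i, Suc n) \<in> scc"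
    using s i by (simp_all add: comps_numbered_def scc_labels_def)
  have mk: "marked (cell s' ''class'') (vertex_hook A n cp i) (vertex_hook B (Suc n) cp i)" by (fact 5(2))
  \<comment> \<open>Vertex \<open>i\<close> itself hooks its component by \<open>B\<close>, so no
    earlier vertex can have marked that component 1.\<close>
  have nA: "\<not> vertex_hook A n cp i (cp i)" if "i \<in> B \<and> (i, Suc n) \<in> scc"
    using hooks_exclusive[OF s(1), of i "Suc i" 0 0 "cp i"] i that
    by (auto simp: cp_def vertex_hook_Suc)
  let ?c = "cell s' ''class''"
  let ?cA = "i \<in> A \<and> (i, n) \<in> scc" and ?cB = "i \<in> B \<and> (i, Suc n) \<in> scc"
  have hA: "vertex_hook A n cp (Suc i) = (\<lambda>j. vertex_hook A n cp i j \<or> ?cA \<and> j = cp i)"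
    and hB: "vertex_hook B (Suc n) cp (Suc i) = (\<lambda>j. vertex_hook B (Suc n) cp i j \<or> ?cB \<and> j = cp i)"
    by (simp_all add: fun_eq_iff vertex_hook_Suc)
  consider ?cA "\<not> ?cB" | "\<not> ?cA" ?cB | "\<not> ?cA" "\<not> ?cB" using AB by blast
  then have "marked (if ?cA then ?c(cp i := 1) else if ?cB then ?c(cp i := 2) else ?c)
      (vertex_hook A n cp (Suc i)) (vertex_hook B (Suc n) cp (Suc i))"
  proof cases
    case 1
    show ?thesis using marked_1[OF mk, of "cp i"] unfolding hA hB by (simp only: 1 simp_thms if_True)
  next
    case 2
    show ?thesis using marked_2[OF mk nA[OF 2(2)]] unfolding hA hB by (simp only: 2 simp_thms if_True if_False)
  next
    case 3
    show ?thesis using mk unfolding hA hB by (simp only: 3 simp_thms if_False)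
  qed
  moreover have "cell (exec class_vertex s') ''class'' =
      (if ?cA then ?c(cp i := 1) else if ?cB then ?c(cp i := 2) else ?c)"
    using 5(3) 5(4)[of "''colour''"] 5(4)[of "''comp''"] 5(4)[of "''2lab''"] s(1) i lab AB
    by (simp add: class_vertex_def comps_numbered_def stores_input_def array_of_def same_scc_def cp_def)
  ultimately show ?case by (simp only:)
next
  case (8 s')
  then show ?case using s
    by (simp add: comps_numbered_def scc_labels_def stores_input_def arcs_listed_def cp_def class_vertex_def class_edge_def)
qed (use s in \<open>auto simp: comps_numbered_def stores_input_def same_scc_def class_vertex_def class_edge_def\<close>)

lemma class_edges_halts:
  assumes s: "comps_numbered s" "arcs_listed s"
  defines "cp \<equiv> cell s ''comp''"
  assumes mk0: "marked (cell s ''class'') (vertex_hook A n cp n) (vertex_hook B (Suc n) cp n)"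
  shows "halts class_edges s (100 * (n + m + 1)) (\<lambda>s'. comps_numbered s' \<and> arcs_listed s' \<and>
    cell s' ''comp'' = cp \<and> marked (cell s' ''class'')
      (\<lambda>j. vertex_hook A n cp n j \<or> edge_hook (endB G) (endA G) n cp m j)
      (\<lambda>j. vertex_hook B (Suc n) cp n j \<or> edge_hook (endA G) (endB G) (Suc n) cp m j))"
  unfolding class_edges_def
proof (rule halts_mono[OF halts_For[where T = "100 * (n + m + 1)" and
    I = "\<lambda>i c. marked (c ''class'')
      (\<lambda>j. vertex_hook A n cp n j \<or> edge_hook (endB G) (endA G) n cp i j)
      (\<lambda>j. vertex_hook B (Suc n) cp n j \<or> edge_hook (endA G) (endB G) (Suc n) cp i j)"]], goal_cases)
  case 4
  show ?case using mk0 by (simp add: edge_hook_def)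
next
  case (5 i s')
  have i: "i < m" using 5 s by (simp add: comps_numbered_def stores_input_def)
  let ?x = "endA G i" and ?y = "endB G i"
  have xy: "?x < n" "?y < n" using endA_less endB_less i by auto
  let ?P = "\<lambda>i j. vertex_hook A n cp n j \<or> edge_hook (endB G) (endA G) n cp i j"
  let ?Q = "\<lambda>i j. vertex_hook B (Suc n) cp n j \<or> edge_hook (endA G) (endB G) (Suc n) cp i j"
  let ?cA = "b ?y = 0 \<and> (?x, n) \<in> scc" and ?cB = "b ?x = 0 \<and> (?y, Suc n) \<in> scc"
  let ?c = "cell s' ''class''"
  have lab: "cell s ''2lab'' ?x = cell s ''2lab'' n \<longleftrightarrow> (?x, n) \<in> scc"
    "cell s ''2lab'' ?y = cell s ''2lab'' (Suc n) \<longleftrightarrow> (?y, Suc n) \<in> scc"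
    using s xy by (simp_all add: comps_numbered_def scc_labels_def)
  have c1: "marked (if ?cA then ?c(cp ?y := 1) else ?c) (?P (Suc i)) (?Q i)"
    using 5(2) marked_1[OF 5(2), of "cp ?y"] by (auto simp: edge_hook_Suc disj_assoc)
  \<comment> \<open>Edge \<open>i\<close> hooks the component of \<open>?x\<close> by
    \<open>B\<close>, so that component carries no mark 1, not even from the first half of this
    body.\<close>
  have "\<not> ?P (Suc i) (cp ?x)" if "?cB"
    using hooks_exclusive[OF s(1), of n 0 "Suc i" "Suc i" "cp ?x"] i that
    by (auto simp: cp_def edge_hook_Suc)
  then have "marked (if ?cB then (if ?cA then ?c(cp ?y := 1) else ?c)(cp ?x := 2)
      else if ?cA then ?c(cp ?y := 1) else ?c) (?P (Suc i)) (?Q (Suc i))"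
    using c1 marked_2[OF c1, of "cp ?x"] by (auto simp: edge_hook_Suc[of "endA G"] disj_assoc)
  moreover have "cell (exec class_edge s') ''class''
    = (if ?cB then (if ?cA then ?c(cp ?y := 1) else ?c)(cp ?x := 2)
      else if ?cA then ?c(cp ?y := 1) else ?c)"
    using 5(3) 5(4)[of "''endA''"] 5(4)[of "''endB''"] 5(4)[of "''b''"] 5(4)[of "''comp''"] 5(4)[of "''2lab''"]
      s(1) i lab xy
    by (simp add: class_edge_def comps_numbered_def stores_input_def array_of_def same_scc_def cp_def)
  ultimately show ?case by (simp only:)
next
  case (8 s')
  then show ?case using s
    by (simp add: comps_numbered_def scc_labels_def stores_input_def arcs_listed_def cp_def class_vertex_def class_edge_def)
qed (use s in \<open>auto simp: comps_numbered_def stores_input_def same_scc_def class_vertex_def class_edge_def\<close>)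

section \<open>The output and the total time\<close>

lemma outputs:
  assumes s: "comps_numbered s" "arcs_listed s"
  defines "cp \<equiv> cell s ''comp''"
  assumes mk: "marked (cell s ''class'')
      (\<lambda>j. vertex_hook A n cp n j \<or> edge_hook (endB G) (endA G) n cp m j)
      (\<lambda>j. vertex_hook B (Suc n) cp n j \<or> edge_hook (endA G) (endB G) (Suc n) cp m j)"
  shows "outputs_decomposition G b s"
proof -
  let ?k = "reg s ''comps''"
  have eq: "\<forall>u\<in>verts G. \<forall>v\<in>verts G. cp u = cp v \<longleftrightarrow> (u, v) \<in> (flex_adj G b)\<^sup>*"
    and im: "cp ` verts G = {..<?k}" and arcs: "reg s ''arcs'' = m"
    using s by (simp_all add: comps_numbered_def cp_def verts)
  have blk: "block G s = (\<lambda>i. {v \<in> verts G. cp v = i})" by (simp add: fun_eq_iff block_def cp_def)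
  note bl = labelling_blocks[OF eq im]
  have bl1: "block G s (cp v) = flex_comp v" if "v \<in> verts G" for v
    using bl(1)[OF that] by (simp add: blk)
  have bl2: "bij_betw (block G s) {..<?k} (flex_comps G b)"
    using bl(2) by (simp only: blk)
  have cls: "(cell s ''class'' i = 0 \<longleftrightarrow> consistent G b (block G s i)) \<and>
        (cell s ''class'' i = 1 \<longleftrightarrow> hooked_up_by G b A (block G s i)) \<and>
        (cell s ''class'' i = 2 \<longleftrightarrow> hooked_up_by G b B (block G s i))" if "i < ?k" for i
  proof -
    obtain v where v: "v \<in> verts G" "cp v = i" "block G s i = flex_comp v" using bl(3)[OF \<open>i < ?k\<close>] bl1 by metis
    then have vn: "v < n" using verts by auto
    show ?thesis
      using mk hooked_up_iff[OF s(1) vn] hooked_up_exclusive[OF v(1)] consistent_iff[of "flex_comp v"] v(2)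
      unfolding v(3) cp_def marked_def by (auto split: if_splits)
  qed
  have lt: "cp u < ?k" if "u < n" for u using im that verts by auto
  have st: "cell s ''src'' e < ?k \<and> cell s ''tgt'' e < ?k" if "e < m" for e
    using s(2) that lt[OF endA_less[OF that]] lt[OF endB_less[OF that]]
    by (auto simp: arcs_listed_def cp_def split: if_splits)
  have pair: "(block G s (cell s ''src'' e), block G s (cell s ''tgt'' e)) =
      (if e \<in> M then (flex_comp (endA G e), flex_comp (endB G e))
       else (flex_comp (endB G e), flex_comp (endA G e)))" if "e < m" for e
  proof -
    have "(cell s ''src'' e, cell s ''tgt'' e) =
        (if e \<in> M then (cp (endA G e), cp (endB G e)) else (cp (endB G e), cp (endA G e)))"
      using s(2) that by (simp add: arcs_listed_def cp_def)
    moreover have "block G s (cp (endA G e)) = flex_comp (endA G e)"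
      "block G s (cp (endB G e)) = flex_comp (endB G e)"
      using bl1 endA_less[OF that] endB_less[OF that] by (simp_all add: verts)
    ultimately show ?thesis by (cases "e \<in> M") simp_all
  qed
  have "{(block G s (cell s ''src'' j), block G s (cell s ''tgt'' j)) | j. j < m} =
      (\<lambda>e. (block G s (cell s ''src'' e), block G s (cell s ''tgt'' e))) ` edges G"
    unfolding edges by auto
  also have "\<dots> = (\<lambda>e. if e \<in> M then (flex_comp (endA G e), flex_comp (endB G e))
          else (flex_comp (endB G e), flex_comp (endA G e))) ` edges G"
    by (rule image_cong[OF refl pair]) (simp add: edges)
  finally have "rtrancl_within (flex_comps G b)
      {(block G s (cell s ''src'' j), block G s (cell s ''tgt'' j)) | j. j < m} = le_A G b"
    by (simp only: le_A_arcs)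
  then show ?thesis
    unfolding outputs_decomposition_def arcs using bl2 cls st by blast
qed

text \<open>The phases are joined from the last to the first, each claim covering the rest of the
  program. The bounds add up to \<open>13000 * (n + m + 1)\<close>.\<close>

lemma decompose_halts:
  "halts decompose (input_state G b M) (20000 * (n + m + 1)) (outputs_decomposition G b)"
proof -
  let ?s = "input_state G b M"
  have s: "stores_input ?s"
    "zero_cells {''1len'', ''deg'', ''3len'', ''class'', ''1hd'', ''1lab'', ''2hd'', ''2lab'', ''3hd'', ''3lab''} ?s"
    by (simp_all add: input_state_def stores_input_def zero_cells_def verts edges Let_def)
  let ?L = "n + m + 1" and ?Q = "outputs_decomposition G b"
  have 1: "halts (Seq class_vertices class_edges) s (200 * ?L) ?Q"
    if "comps_numbered s" "zero_cells {''class''} s" "arcs_listed s" for s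
  proof (rule halts_Seq[OF class_vertices_halts[OF that]])
    fix s1 assume "comps_numbered s1 \<and> arcs_listed s1 \<and> cell s1 ''comp'' = cell s ''comp'' \<and>
      marked (cell s1 ''class'') (vertex_hook A n (cell s ''comp'') n) (vertex_hook B (Suc n) (cell s ''comp'') n)"
    then have "halts class_edges s1 (100 * ?L) (\<lambda>s'. comps_numbered s' \<and> arcs_listed s' \<and>
      cell s' ''comp'' = cell s1 ''comp'' \<and> marked (cell s' ''class'')
        (\<lambda>j. vertex_hook A n (cell s1 ''comp'') n j \<or> edge_hook (endB G) (endA G) n (cell s1 ''comp'') m j)
        (\<lambda>j. vertex_hook B (Suc n) (cell s1 ''comp'') n j \<or>
          edge_hook (endA G) (endB G) (Suc n) (cell s1 ''comp'') m j))"
      by (intro class_edges_halts) simp_all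
    then show "halts class_edges s1 (100 * ?L) ?Q"
      by (rule halts_mono) (simp, elim conjE, rule outputs, assumption, assumption, simp only:)
  qed simp
  have 2: "halts (Seq set_arcs (Seq class_vertices class_edges)) s (300 * ?L) ?Q"
    if "comps_numbered s" "zero_cells {''class''} s" for s
    by (rule halts_Seq[OF set_arcs_halts[OF that]], elim conjE, rule 1) auto
  have 3: "halts (Seq set_comp (Seq set_arcs (Seq class_vertices class_edges))) s (400 * ?L) ?Q"
    if "after_search_3 s" "reg s ''comps'' = reg s ''cnt''" "reg s ''arcs'' = m" for s
    by (rule halts_Seq[OF set_comp_halts[OF that]], elim conjE, rule 2) auto
  have 4: "halts (Seq (Seq (SetReg ''comps'' (Reg ''cnt'')) (SetReg ''arcs'' (Reg ''m'')))
      (Seq set_comp (Seq set_arcs (Seq class_vertices class_edges)))) s (500 * ?L) ?Q"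
    if "after_search_3 s" for s
  proof (rule halts_Seq[where ?T1.0 = 10])
    show "halts (Seq (SetReg ''comps'' (Reg ''cnt'')) (SetReg ''arcs'' (Reg ''m''))) s 10
      (\<lambda>s'. after_search_3 s' \<and> reg s' ''comps'' = reg s' ''cnt'' \<and> reg s' ''arcs'' = m)"
      by (rule halts_exec)
        (use that in \<open>simp_all add: after_search_3_def stores_input_def scc_labels_def zero_cells_def\<close>)
    show "10 + 400 * ?L \<le> 500 * ?L" by simp
  qed (elim conjE, rule 3)
  have 5: "halts (Seq (search (CHR ''3'') ''3src'' ''3dst'' ''id'' ''n'' ''K'')
     (Seq (Seq (SetReg ''comps'' (Reg ''cnt'')) (SetReg ''arcs'' (Reg ''m'')))
      (Seq set_comp (Seq set_arcs (Seq class_vertices class_edges))))) s (4500 * ?L) ?Q"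
    if "after_scc_arcs s" "reg s ''K'' = cell s ''3len'' 0" for s
    by (rule halts_Seq[OF search_3_halts[OF that]], rule 4) auto
  have 6: "halts (Seq (SetReg ''K'' (Cell ''3len'' (Const 0)))
     (Seq (search (CHR ''3'') ''3src'' ''3dst'' ''id'' ''n'' ''K'')
     (Seq (Seq (SetReg ''comps'' (Reg ''cnt'')) (SetReg ''arcs'' (Reg ''m'')))
      (Seq set_comp (Seq set_arcs (Seq class_vertices class_edges)))))) s (4600 * ?L) ?Q"
    if "after_scc_arcs s" for s
  proof (rule halts_Seq[where ?T1.0 = 10])
    show "halts (SetReg ''K'' (Cell ''3len'' (Const 0))) s 10
      (\<lambda>s'. after_scc_arcs s' \<and> reg s' ''K'' = cell s' ''3len'' 0)"
      by (rule halts_exec)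
        (use that in \<open>simp_all add: after_scc_arcs_def stores_input_def scc_labels_def zero_cells_def\<close>)
    show "10 + 4500 * ?L \<le> 4600 * ?L" by simp
  qed (elim conjE, rule 5)
  define scc_phase where "scc_phase = Seq scc_arcs (Seq (SetReg ''K'' (Cell ''3len'' (Const 0)))
     (Seq (search (CHR ''3'') ''3src'' ''3dst'' ''id'' ''n'' ''K'')
     (Seq (Seq (SetReg ''comps'' (Reg ''cnt'')) (SetReg ''arcs'' (Reg ''m'')))
      (Seq set_comp (Seq set_arcs (Seq class_vertices class_edges))))))"
  have 7: "halts scc_phase s (4700 * ?L) ?Q" if "after_search_2 s" for s
    unfolding scc_phase_def by (rule halts_Seq[OF scc_arcs_halts[OF that]], rule 6) auto
  have 8: "halts (Seq (search (CHR ''2'') ''1dst'' ''1src'' ''1post'' ''N'' ''K'') scc_phase) s (8700 * ?L) ?Q" if "after_search_1 s" for s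
    by (rule halts_Seq[OF search_2_halts[OF that]], rule 7) auto
  have 9: "halts (Seq (search (CHR ''1'') ''1src'' ''1dst'' ''id'' ''N'' ''K'')
      (Seq (search (CHR ''2'') ''1dst'' ''1src'' ''1post'' ''N'' ''K'') scc_phase)) s (12700 * ?L) ?Q"
    if "digraph_ready s"
      "zero_cells {''3len'', ''class'', ''1hd'', ''1lab'', ''2hd'', ''2lab'', ''3hd'', ''3lab''} s" for s
    by (rule halts_Seq[OF search_1_halts[OF that]], rule 8) auto
  have 10: "halts (Seq (Seq set_sizes set_ident) (Seq (search (CHR ''1'') ''1src'' ''1dst'' ''id'' ''N'' ''K'')
      (Seq (search (CHR ''2'') ''1dst'' ''1src'' ''1post'' ''N'' ''K'') scc_phase))) s (12800 * ?L) ?Q" if "after_vertex_arcs s" for s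
    by (rule halts_Seq[OF set_ident_halts[OF that]], elim conjE, rule 9) auto
  have 11: "halts (Seq vertex_arcs (Seq (Seq set_sizes set_ident) (Seq (search (CHR ''1'') ''1src'' ''1dst'' ''id'' ''N'' ''K'')
      (Seq (search (CHR ''2'') ''1dst'' ''1src'' ''1post'' ''N'' ''K'') scc_phase)))) s (12900 * ?L) ?Q" if "after_edge_arcs s" for s
    by (rule halts_Seq[OF vertex_arcs_halts[OF that]], rule 10) auto
  show ?thesis unfolding decompose_def scc_phase_def[symmetric]
    by (rule halts_Seq[OF edge_arcs_halts[OF s]], rule 11) auto
qed

end

theorem mainTheorem3:
  shows "\<exists>(prog :: com) (c :: nat).
    \<forall>(G :: (nat, nat) bgraph) (b :: nat \<Rightarrow> nat) (M :: nat set) (n :: nat) (m :: nat).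
      finite_bipartite G \<longrightarrow> verts G = {..<n} \<longrightarrow> edges G = {..<m} \<longrightarrow>
      max_b_matching G b M \<longrightarrow>
      (\<exists>t s. runs prog (input_state G b M) t s \<and> t \<le> c * (n + m + 1) \<and>
             outputs_decomposition G b s)"
proof (rule exI[of _ decompose], rule exI[of _ 20000], intro allI impI)
  fix G :: "(nat, nat) bgraph" and b M n m
  assume "finite_bipartite G" "verts G = {..<n}" "edges G = {..<m}" "max_b_matching G b M"
  then interpret matching_input G b M n m by unfold_locales auto
  show "\<exists>t s. runs decompose (input_state G b M) t s \<and> t \<le> 20000 * (n + m + 1) \<and>
      outputs_decomposition G b s"
    using decompose_halts by (simp add: halts_def)
qed

end
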